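(* Let $\mathcal U$ denote the set consisting of the trivial Hom-Lie algebra $\{0\}$, the one-dimensional Hom-Lie algebra, and the simple involutive Hom-Lie algebras. Let $(\mathfrak g,[\cdot,\cdot],\alpha,B)$ be a finite-dimensional IQH-Lie algebra over $\mathbb K$ with $\mathcal Z(\mathfrak g)=\{0\}$. Then either $\mathfrak g$ is an element of $\mathcal U$, or it is obtained from a finite number of elements of $\mathcal U$ by a finite sequence of involutive double extensions by the one-dimensional Hom-Lie algebra and/or involutive double extensions by a simple involutive Hom-Lie algebra and/or orthogonal direct sums of IQH-Lie algebras.
   Context: $\mathbb K$ is an algebraically closed field of characteristic $0$. A Hom-Lie algebra is a triple $(\mathfrak g,[\cdot,\cdot],\alpha)$ with $[\cdot,\cdot]$ a skew-symmetric bilinear bracket and $\alpha$ a linear map such that $[\alpha(x),[y,z]]+[\alpha(y),[z,x]]+[\alpha(z),[x,y]]=0$. It is called involutive here if $\alpha^2=\mathrm{id}$ and $\alpha([x,y])=[\alpha(x),\alpha(y)]$. An IQH-Lie algebra $(\mathfrak g,[\cdot,\cdot],\alpha,B)$ is an involutive Hom-Lie algebra with a symmetric nondegenerate bilinear form $B$ satisfying $B([x,y],z)=B(x,[y,z])$ and $B(\alpha(x),y)=B(x,\alpha(y))$. The center is $\mathcal Z(\mathfrak g)=\{x:[x,y]=0\ \forall y\}$. An ideal is a subspace $I$ with $[I,\mathfrak g]\subseteq I$, $\alpha(I)\subseteq I$. A Hom-Lie algebra is simple if its bracket is not identically zero and it has no ideals other than $\{0\}$ and itself. Elements of $\mathcal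 U$ are regarded as IQH-Lie algebras, i.e. with some involutive twist map and some admissible form. The orthogonal direct sum is the direct sum of vector spaces with componentwise bracket, twist map and form. "Obtained" is up to isomorphism (bijective linear maps preserving brackets, twist maps and forms). Involutive double extension by the one-dimensional Hom-Lie algebra: given an IQH-Lie algebra $(V,[\cdot,\cdot]_V,\alpha_V,B_V)$, a $B_V$-skew-symmetric linear map $\delta:V\to V$, $x_0\in V$, $\lambda\in\{-1,1\}$ with $\alpha_V(x_0)=-\lambda x_0$, and $\lambda_0=-\frac1{2\lambda}B_V(x_0,x_0)$ such that, with $\rho_V(x)=[x,\cdot]_V$, one has $\alpha_V\delta\alpha_V-\lambda\delta=\rho_V(x_0)$, $\alpha_V\delta^2-\delta^2\alpha_V=\rho_V(\delta(x_0))$, $(\lambda\delta+\rho_V(x_0))([x,y]_V)=[\delta(x),\alpha_V(y)]_V+[\alpha_V(x),\delta(y)]_V$ for $x,y\in V$, it is $\mathbb K b\oplus V\oplus\mathbb K e$ with skew-symmetric bracket $[x,y]=[x,y]_V+B_V(\delta(x),y)e$, $[b,x]=\delta(x)$, $[e,\cdot]=0$; twist map $\alpha(x)=\alpha_V(x)+B_V(x_0,x)e$, $\alpha(b)=\lambda b+x_0+\lambda_0e$, $\alpha(e)=\lambda e$; symmetric form $B$ equal to $B_V$ on $V$ with $B(b,e)=1$, $B(V,b)=B(V,e)=0$, $B(b,b)=B(e,e)=0$. Involutive double extension of an IQH-Lie algebra $(V,[\cdot,\cdot]_V,\alpha_V,B_V)$ by an involutive Hom-Lie algebra $(A,[\cdot,\cdot]_A,\alpha_A)$: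 let $\phi:A\to\mathrm{End}(V)$ be linear with, for all $a,b\in A$, $x,y\in V$, (i) $\phi([a,b]_A)\circ\alpha_V=\phi(\alpha_A(a))\phi(b)-\phi(\alpha_A(b))\phi(a)$; (ii) $\alpha_V\phi(a)([x,y]_V)=[\phi(a)\alpha_V(x),y]_V+[x,\phi(a)\alpha_V(y)]_V$; (iii) $\phi(\alpha_A(a))=\alpha_V\phi(a)\alpha_V$; (iv) $B_V(\phi(a)x,y)=-B_V(x,\phi(a)y)$. Let $\psi(x,y)\in A^*$, $\psi(x,y)(a)=B_V(\phi(a)x,y)$, $\widetilde{\mathrm{ad}}_A(a)(f)=-f\circ[a,\cdot]_A$ for $f\in A^*$, and let $\gamma$ be a symmetric bilinear form on $A$ with $\gamma([a,b]_A,c)=\gamma(a,[b,c]_A)$ and $\gamma(\alpha_A(a),b)=\gamma(a,\alpha_A(b))$. The extension is $A^*\oplus V\oplus A$ with $[f+v+a,f'+v'+a']=\widetilde{\mathrm{ad}}_A(a)(f')-\widetilde{\mathrm{ad}}_A(a')(f)+\psi(v,v')+[v,v']_V+\phi(a)(v')-\phi(a')(v)+[a,a']_A$, twist map $f+v+a\mapsto f\circ\alpha_A+\alpha_V(v)+\alpha_A(a)$, and form $B_V(v,v')+f(a')+f'(a)+\gamma(a,a')$. *)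

theory Defs
  imports
    "HOL-Computational_Algebra.Polynomial"
    "HOL-Library.Function_Algebras"
    "HOL-Library.FuncSet"
    "HOL-Library.Product_Plus"
begin

text \<open>
  An algebra lives on a subspace \<open>carr G\<close> of an ambient vector space, whose addition is that of the
  type and whose scalar multiplication is \<open>scal G\<close>.  The operations are total functions, but only
  their values on the carrier are meaningful, and all axioms are relativised to it.
\<close>

definition linear_on ::
  "('k \<Rightarrow> 'v \<Rightarrow> 'v) \<Rightarrow> ('k \<Rightarrow> 'w \<Rightarrow> 'w) \<Rightarrow> 'v set \<Rightarrow> 'w set \<Rightarrow> ('v::plus \<Rightarrow> 'w::plus) \<Rightarrow> bool"
  where "linear_on s t S T f \<longleftrightarrow>
    f \<in> S \<rightarrow> T \<and>
    (\<forall>x\<in>S. \<forall>y\<in>S. f (x + y) = f x + f y) \<and>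
    (\<forall>c. \<forall>x\<in>S. f (s c x) = t c (f x))"

definition bilinear_on ::
  "('k \<Rightarrow> 'v \<Rightarrow> 'v) \<Rightarrow> ('k \<Rightarrow> 'w \<Rightarrow> 'w) \<Rightarrow> 'v set \<Rightarrow> 'w set \<Rightarrow> ('v::plus \<Rightarrow> 'v \<Rightarrow> 'w::plus) \<Rightarrow> bool"
  where "bilinear_on s t S T b \<longleftrightarrow>
    (\<forall>x\<in>S. linear_on s t S T (\<lambda>y. b x y)) \<and> (\<forall>y\<in>S. linear_on s t S T (\<lambda>x. b x y))"

record ('k, 'v) hom_alg =
  carr :: "'v set"
  scal :: "'k \<Rightarrow> 'v \<Rightarrow> 'v"
  brk :: "'v \<Rightarrow> 'v \<Rightarrow> 'v"
  twist :: "'v \<Rightarrow> 'v"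

record ('k, 'v) quad_hom_alg = "('k, 'v) hom_alg" +
  form :: "'v \<Rightarrow> 'v \<Rightarrow> 'k"

locale hom_lie_algebra = vector_space "scal G"
  for G :: "('k::field, 'v::ab_group_add, 'z) hom_alg_scheme" +
  assumes subspace_carr: "subspace (carr G)"
    and brk_bilinear: "bilinear_on (scal G) (scal G) (carr G) (carr G) (brk G)"
    and brk_skew: "\<lbrakk>x \<in> carr G; y \<in> carr G\<rbrakk> \<Longrightarrow> brk G x y = - brk G y x"
    and twist_linear: "linear_on (scal G) (scal G) (carr G) (carr G) (twist G)"
    and hom_jacobi: "\<lbrakk>x \<in> carr G; y \<in> carr G; z \<in> carr G\<rbrakk> \<Longrightarrow>
      brk G (twist G x) (brk G y z) + brk G (twist G y) (brk G z x)
        + brk G (twist G z) (brk G x y) = 0"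

locale involutive_hom_lie_algebra = hom_lie_algebra +
  assumes twist_twist: "x \<in> carr G \<Longrightarrow> twist G (twist G x) = x"
    and twist_brk: "\<lbrakk>x \<in> carr G; y \<in> carr G\<rbrakk> \<Longrightarrow>
      twist G (brk G x y) = brk G (twist G x) (twist G y)"

locale iqh_lie_algebra = involutive_hom_lie_algebra G
  for G :: "('k::field, 'v::ab_group_add) quad_hom_alg" +
  assumes form_bilinear: "bilinear_on (scal G) (*) (carr G) UNIV (form G)"
    and form_sym: "\<lbrakk>x \<in> carr G; y \<in> carr G\<rbrakk> \<Longrightarrow> form G x y = form G y x"
    and form_nondegenerate: "\<lbrakk>x \<in> carr G; \<And>y. y \<in> carr G \<Longrightarrow> form G x y = 0\<rbrakk> \<Longrightarrow> x = 0"
    and form_invariant: "\<lbrakk>x \<in> carr G; y \<in> carr G; z \<in> carr G\<rbrakk> \<Longrightarrow>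
      form G (brk G x y) z = form G x (brk G y z)"
    and form_twist: "\<lbrakk>x \<in> carr G; y \<in> carr G\<rbrakk> \<Longrightarrow>
      form G (twist G x) y = form G x (twist G y)"

definition finite_dim :: "('k::field, 'v::ab_group_add, 'z) hom_alg_scheme \<Rightarrow> bool"
  where "finite_dim G \<longleftrightarrow> (\<exists>B. finite B \<and> module.span (scal G) B = carr G)"

definition center :: "('k, 'v::zero, 'z) hom_alg_scheme \<Rightarrow> 'v set"
  where "center G = {x \<in> carr G. \<forall>y\<in>carr G. brk G x y = 0}"

definition hom_ideal :: "('k::field, 'v::ab_group_add, 'z) hom_alg_scheme \<Rightarrow> 'v set \<Rightarrow> bool"
  where "hom_ideal G I \<longleftrightarrow>
    module.subspace (scal G) I \<and> I \<subseteq> carr G \<and>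
    (\<forall>x\<in>I. \<forall>y\<in>carr G. brk G x y \<in> I) \<and> (\<forall>x\<in>I. twist G x \<in> I)"

definition simple_alg :: "('k::field, 'v::ab_group_add, 'z) hom_alg_scheme \<Rightarrow> bool"
  where "simple_alg G \<longleftrightarrow>
    (\<exists>x\<in>carr G. \<exists>y\<in>carr G. brk G x y \<noteq> 0) \<and>
    (\<forall>I. hom_ideal G I \<longrightarrow> I = {0} \<or> I = carr G)"

definition in_U :: "('k::field, 'v::ab_group_add) quad_hom_alg \<Rightarrow> bool"
  where "in_U G \<longleftrightarrow>
    iqh_lie_algebra G \<and>
    (carr G = {0} \<or> vector_space.dim (scal G) (carr G) = 1 \<or> simple_alg G)"

definition iqh_isomorphic ::
  "('k::field, 'v::ab_group_add) quad_hom_alg \<Rightarrow> ('k, 'w::ab_group_add) quad_hom_alg \<Rightarrow> bool"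
  (infix "\<simeq>" 50)
  where "G \<simeq> H \<longleftrightarrow> (\<exists>h.
    linear_on (scal G) (scal H) (carr G) (carr H) h \<and>
    bij_betw h (carr G) (carr H) \<and>
    (\<forall>x\<in>carr G. \<forall>y\<in>carr G. h (brk G x y) = brk H (h x) (h y)) \<and>
    (\<forall>x\<in>carr G. h (twist G x) = twist H (h x)) \<and>
    (\<forall>x\<in>carr G. \<forall>y\<in>carr G. form G x y = form H (h x) (h y)))"

definition orth_sum ::
  "('k, 'v) quad_hom_alg \<Rightarrow> ('k, 'w) quad_hom_alg \<Rightarrow> ('k::field, 'v \<times> 'w) quad_hom_alg"
  where "orth_sum G H = \<lparr>
    carr = carr G \<times> carr H,
    scal = (\<lambda>c (x, y). (scal G c x, scal H c y)),
    brk = (\<lambda>(x, y) (x', y'). (brk G x x', brk H y y')),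
    twist = (\<lambda>(x, y). (twist G x, twist H y)),
    form = (\<lambda>(x, y) (x', y'). form G x x' + form H y y')\<rparr>"


subsection \<open>Involutive double extension by the one-dimensional Hom-Lie algebra\<close>

locale one_dim_extension_data = iqh_lie_algebra V
  for V :: "('k::field, 'v::ab_group_add) quad_hom_alg" +
  fixes \<delta> :: "'v \<Rightarrow> 'v" and x0 :: 'v and lam :: 'k
  assumes delta_linear: "linear_on (scal V) (scal V) (carr V) (carr V) \<delta>"
    and delta_skew: "\<lbrakk>x \<in> carr V; y \<in> carr V\<rbrakk> \<Longrightarrow> form V (\<delta> x) y = - form V x (\<delta> y)"
    and x0_in_carr: "x0 \<in> carr V"
    and lambda_cases: "lam \<in> {-1, 1}"
    and twist_x0: "twist V x0 = scal V (- lam) x0"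
    and delta_twist: "x \<in> carr V \<Longrightarrow>
      twist V (\<delta> (twist V x)) - scal V lam (\<delta> x) = brk V x0 x"
    and delta_square: "x \<in> carr V \<Longrightarrow>
      twist V (\<delta> (\<delta> x)) - \<delta> (\<delta> (twist V x)) = brk V (\<delta> x0) x"
    and delta_brk: "\<lbrakk>x \<in> carr V; y \<in> carr V\<rbrakk> \<Longrightarrow>
      scal V lam (\<delta> (brk V x y)) + brk V x0 (brk V x y)
        = brk V (\<delta> x) (twist V y) + brk V (twist V x) (\<delta> y)"

text \<open>The triple \<open>(\<beta>, x, \<epsilon>)\<close> stands for \<open>\<beta> b + x + \<epsilon> e\<close>.\<close>

definition one_dim_extension ::
  "('k::field, 'v::ab_group_add) quad_hom_alg \<Rightarrow> ('v \<Rightarrow> 'v) \<Rightarrow> 'v \<Rightarrow> 'k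
    \<Rightarrow> ('k, 'k \<times> 'v \<times> 'k) quad_hom_alg"
  where "one_dim_extension V \<delta> x0 lam =
    (let lam0 = - (1 / (2 * lam)) * form V x0 x0 in \<lparr>
      carr = UNIV \<times> carr V \<times> UNIV,
      scal = (\<lambda>c (\<beta>, x, \<epsilon>). (c * \<beta>, scal V c x, c * \<epsilon>)),
      brk = (\<lambda>(\<beta>, x, \<epsilon>) (\<beta>', x', \<epsilon>').
        (0, brk V x x' + scal V \<beta> (\<delta> x') - scal V \<beta>' (\<delta> x), form V (\<delta> x) x')),
      twist = (\<lambda>(\<beta>, x, \<epsilon>).
        (lam * \<beta>, twist V x + scal V \<beta> x0, \<beta> * lam0 + form V x0 x + lam * \<epsilon>)),
      form = (\<lambda>(\<beta>, x, \<epsilon>) (\<beta>', x', \<epsilon>'). form V x x' + \<beta> * \<epsilon>' + \<epsilon> * \<beta>')\<rparr>)"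


subsection \<open>Involutive double extension by an involutive Hom-Lie algebra\<close>

text \<open>Linear functionals on \<open>carr A\<close> are represented by their extension by \<open>0\<close> to the whole type.\<close>

definition dual_space :: "('k::field, 'a::ab_group_add, 'z) hom_alg_scheme \<Rightarrow> ('a \<Rightarrow> 'k) set"
  where "dual_space A =
    {f. linear_on (scal A) (*) (carr A) UNIV f \<and> (\<forall>a. a \<notin> carr A \<longrightarrow> f a = 0)}"

definition restrict0 :: "'a set \<Rightarrow> ('a \<Rightarrow> 'k::zero) \<Rightarrow> 'a \<Rightarrow> 'k"
  where "restrict0 S f = (\<lambda>a. if a \<in> S then f a else 0)"

definition coadjoint ::
  "('k::field, 'a::ab_group_add, 'z) hom_alg_scheme \<Rightarrow> 'a \<Rightarrow> ('a \<Rightarrow> 'k) \<Rightarrow> 'a \<Rightarrow> 'k"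
  where "coadjoint A a f = restrict0 (carr A) (\<lambda>b. - f (brk A a b))"

locale double_extension_data = V: iqh_lie_algebra V + A: involutive_hom_lie_algebra A
  for V :: "('k::field, 'v::ab_group_add) quad_hom_alg"
    and A :: "('k, 'a::ab_group_add) hom_alg" +
  fixes \<phi> :: "'a \<Rightarrow> 'v \<Rightarrow> 'v" and \<gamma> :: "'a \<Rightarrow> 'a \<Rightarrow> 'k"
  assumes phi_endomorphism:
      "a \<in> carr A \<Longrightarrow> linear_on (scal V) (scal V) (carr V) (carr V) (\<phi> a)"
    and phi_linear:
      "x \<in> carr V \<Longrightarrow> linear_on (scal A) (scal V) (carr A) (carr V) (\<lambda>a. \<phi> a x)"
    and phi_brk: "\<lbrakk>a \<in> carr A; b \<in> carr A; x \<in> carr V\<rbrakk> \<Longrightarrow>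
      \<phi> (brk A a b) (twist V x) = \<phi> (twist A a) (\<phi> b x) - \<phi> (twist A b) (\<phi> a x)"
    and phi_derivation: "\<lbrakk>a \<in> carr A; x \<in> carr V; y \<in> carr V\<rbrakk> \<Longrightarrow>
      twist V (\<phi> a (brk V x y))
        = brk V (\<phi> a (twist V x)) y + brk V x (\<phi> a (twist V y))"
    and phi_twist: "\<lbrakk>a \<in> carr A; x \<in> carr V\<rbrakk> \<Longrightarrow>
      \<phi> (twist A a) x = twist V (\<phi> a (twist V x))"
    and phi_skew: "\<lbrakk>a \<in> carr A; x \<in> carr V; y \<in> carr V\<rbrakk> \<Longrightarrow>
      form V (\<phi> a x) y = - form V x (\<phi> a y)"
    and gamma_bilinear: "bilinear_on (scal A) (*) (carr A) UNIV \<gamma>"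
    and gamma_sym: "\<lbrakk>a \<in> carr A; b \<in> carr A\<rbrakk> \<Longrightarrow> \<gamma> a b = \<gamma> b a"
    and gamma_invariant: "\<lbrakk>a \<in> carr A; b \<in> carr A; c \<in> carr A\<rbrakk> \<Longrightarrow>
      \<gamma> (brk A a b) c = \<gamma> a (brk A b c)"
    and gamma_twist: "\<lbrakk>a \<in> carr A; b \<in> carr A\<rbrakk> \<Longrightarrow> \<gamma> (twist A a) b = \<gamma> a (twist A b)"

definition double_extension ::
  "('k::field, 'v::ab_group_add) quad_hom_alg \<Rightarrow> ('k, 'a::ab_group_add) hom_alg
    \<Rightarrow> ('a \<Rightarrow> 'v \<Rightarrow> 'v) \<Rightarrow> ('a \<Rightarrow> 'a \<Rightarrow> 'k) \<Rightarrow> ('k, ('a \<Rightarrow> 'k) \<times> 'v \<times> 'a) quad_hom_alg"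
  where "double_extension V A \<phi> \<gamma> =
    (let \<psi> = (\<lambda>x y. restrict0 (carr A) (\<lambda>a. form V (\<phi> a x) y)) in \<lparr>
      carr = dual_space A \<times> carr V \<times> carr A,
      scal = (\<lambda>c (f, v, a). ((\<lambda>b. c * f b), scal V c v, scal A c a)),
      brk = (\<lambda>(f, v, a) (f', v', a').
        (coadjoint A a f' - coadjoint A a' f + \<psi> v v',
         brk V v v' + \<phi> a v' - \<phi> a' v,
         brk A a a')),
      twist = (\<lambda>(f, v, a). (restrict0 (carr A) (f \<circ> twist A), twist V v, twist A a)),
      form = (\<lambda>(f, v, a) (f', v', a'). form V v v' + f a' + f' a + \<gamma> a a')\<rparr>)"


subsection \<open>Algebras obtained from \<open>\<U>\<close>\<close>

text \<open>
  Every construction is followed by an isomorphism, so its result may be realised on any carrier.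
  All algebras in a derivation live in the ambient type of the final one; this is no restriction,
  since the summands, the algebra \<open>V\<close> and the simple algebra \<open>A\<close> entering a construction never have
  larger dimension than its result.
\<close>

inductive obtained :: "('k::field, 'v::ab_group_add) quad_hom_alg \<Rightarrow> bool" where
  base: "in_U G \<Longrightarrow> obtained G"
| one_dim_ext: "\<lbrakk>obtained V; one_dim_extension_data V \<delta> x0 lam;
    iqh_lie_algebra G; one_dim_extension V \<delta> x0 lam \<simeq> G\<rbrakk> \<Longrightarrow> obtained G"
| simple_ext: "\<lbrakk>obtained V; simple_alg (A :: ('k, 'v) hom_alg); double_extension_data V A \<phi> \<gamma>;
    iqh_lie_algebra G; double_extension V A \<phi> \<gamma> \<simeq> G\<rbrakk> \<Longrightarrow> obtained G"
| orthogonal_sum: "\<lbrakk>obtained V; obtained W; iqh_lie_algebra G; orth_sum V W \<simeq> G\<rbrakk> \<Longrightarrow> obtained G"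

end

theory Submission
  imports Defs
begin

text \<open>
  A minimal nonzero ideal \<open>I\<close>, chosen inside the centre if the centre is nonzero, either meets its
  orthogonal complement trivially and then splits off, or is isotropic.  If it is isotropic and
  central, it is a line, and the algebra is a one-dimensional double extension of \<open>I\<^sup>\<bottom> / I\<close>.  If the
  centre vanishes, \<open>I\<^sup>\<bottom>\<close> is a maximal ideal with simple quotient, and what is needed is a
  twist-stable subalgebra complementing \<open>I\<^sup>\<bottom>\<close>.

  Since \<open>(x, y) \<mapsto> \<alpha>[x, y]\<close> is a Lie bracket with involutive automorphism \<open>\<alpha>\<close>, the complement comes
  from an equivariant form of Levi's theorem.  One may assume that the ideal \<open>N\<close> to be complemented is
  minimal.  If it is not abelian, its orthogonal complement for the trace form of the action on \<open>N\<close>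
  works; if it is abelian, a Casimir operator provides the complement, as in Whitehead's lemmas.
  Nondegeneracy of the trace forms is Cartan's criterion.
\<close>

section \<open>Finite-dimensional subspaces and traces\<close>

text \<open>As \<open>obtained\<close> keeps a derivation in one type, the induction must do so too.
  A quotient \<open>R / I\<close> is therefore carried by a vector space complement of
  \<open>I\<close> in \<open>R\<close>, with its operations corrected by a projection. Linear maps
  are total on the ambient type, which may be infinite-dimensional; finiteness is a property of
  subspaces. Passing from an isotropic ideal \<open>I\<close> to \<open>perp I / I\<close> can
  create a centre, so the induction on the dimension covers every centre; this is where
  one-dimensional extensions arise. In the centreless case, \<open>g / perp I\<close> is only a
  quotient, whereas a double extension contains its algebra \<open>A\<close> as a subalgebra: hence
  the search for a complement. The classical Levi theorem does not apply as it stands: the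
  complement must be stable under the twist, \<open>N\<close> need not be solvable, and
  \<open>h / N\<close> is simple only as an algebra with involution, so it may consist of two Lie
  algebras exchanged by \<open>sg\<close>. What is used of \<open>h / N\<close> is that it is
  perfect and has no proper nonzero stable ideal; \<open>perfect_on\<close> adapts Cartan's
  criterion to any action with perfect image.\<close>

locale lin_space = vector_space scale
  for scale :: "'k::field \<Rightarrow> 'v::ab_group_add \<Rightarrow> 'v" (infixr \<open>*s\<close> 75)
begin

sublocale self: vector_space_pair scale scale ..

abbreviation lin :: "('v \<Rightarrow> 'v) \<Rightarrow> bool"
  where "lin \<equiv> Vector_Spaces.linear scale scale"

lemma linI:
  assumes "\<And>x y. T (x + y) = T x + T y" "\<And>c x. T (c *s x) = c *s T x"
  shows "lin T"
  using assms vector_space_axioms by (simp add: Vector_Spaces.linear_iff)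

lemmas lin_add = self.linear_add
  and lin_scale = self.linear_scale
  and lin_0 = self.linear_0
  and lin_neg = self.linear_neg
  and lin_diff = self.linear_diff
  and lin_sum = self.linear_sum

lemma lin_compose: "lin S \<Longrightarrow> lin T \<Longrightarrow> lin (\<lambda>x. S (T x))"
  by (rule linI) (simp_all add: lin_add lin_scale)

lemma lin_plus: "lin S \<Longrightarrow> lin T \<Longrightarrow> lin (\<lambda>x. S x + T x)"
  by (rule linI) (simp_all add: lin_add lin_scale scale_right_distrib)

lemma lin_minus: "lin S \<Longrightarrow> lin T \<Longrightarrow> lin (\<lambda>x. S x - T x)"
  by (rule linI) (simp_all add: lin_add lin_scale scale_right_diff_distrib)

lemma lin_scaled: "lin T \<Longrightarrow> lin (\<lambda>x. c *s T x)"
  by (rule linI) (simp_all add: lin_add lin_scale scale_right_distrib mult.commute)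

lemma lin_ident: "lin (\<lambda>x. x)"
  by (rule linI) simp_all

lemma lin_sum_fun: "(\<And>i. i \<in> A \<Longrightarrow> lin (F i)) \<Longrightarrow> lin (\<lambda>x. \<Sum>i\<in>A. F i x)"
  by (rule linI) (simp_all add: lin_add lin_scale sum.distrib scale_sum_right)

lemma lin_funpow: "lin T \<Longrightarrow> lin (T ^^ n)"
proof (induction n)
  case 0
  show ?case by (rule linI) auto
next
  case (Suc n)
  then show ?case by (auto simp: o_def intro: lin_compose)
qed

lemmas lin_intros = lin_plus lin_minus lin_scaled lin_ident lin_sum_fun

definition fd :: "'v set \<Rightarrow> bool"
  where "fd U \<longleftrightarrow> subspace U \<and> (\<exists>B. finite B \<and> U \<subseteq> span B)"

definition basis_of :: "'v set \<Rightarrow> 'v set \<Rightarrow> bool"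
  where "basis_of U B \<longleftrightarrow> finite B \<and> independent B \<and> span B = U"

lemma fd_subspace: "fd U \<Longrightarrow> subspace U"
  by (simp add: fd_def)

lemma fd_subset: "fd V \<Longrightarrow> subspace U \<Longrightarrow> U \<subseteq> V \<Longrightarrow> fd U"
  unfolding fd_def by blast

lemma basis_of_subset: "basis_of U B \<Longrightarrow> B \<subseteq> U"
  unfolding basis_of_def using span_superset by blast

lemma basis_of_card: "basis_of U B \<Longrightarrow> card B = dim U"
  unfolding basis_of_def using dim_span_eq_card_independent by auto

lemma basis_extend:
  assumes "fd U" "independent A" "A \<subseteq> U"
  obtains B where "A \<subseteq> B" "basis_of U B"
proof -
  obtain B where B: "A \<subseteq> B" "B \<subseteq> U" "independent B" "U \<subseteq> span B"
    using maximal_independent_subset_extend[OF assms(3,2)] by blast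
  obtain F where "finite F" "U \<subseteq> span F" using assms(1) by (auto simp: fd_def)
  then have "finite B" using independent_span_bound[of F B] B by auto
  moreover have "span B = U"
    using B assms(1) span_minimal[of B U] by (auto simp: fd_def)
  ultimately show ?thesis using B that by (auto simp: basis_of_def)
qed

lemma fd_basis: "fd U \<Longrightarrow> \<exists>B. basis_of U B"
  by (meson basis_extend empty_subsetI independent_empty)

lemma basis_of_fd: "basis_of U B \<Longrightarrow> fd U"
  unfolding basis_of_def fd_def by auto

lemma basis_extend_subspace:
  assumes "fd V" "subspace U" "U \<subseteq> V"
  obtains A B where "A \<subseteq> B" "basis_of U A" "basis_of V B"
proof -
  obtain A where A: "basis_of U A" using fd_subset[OF assms] fd_basis by blast
  have "independent A" "A \<subseteq> V" using A basis_of_subset[OF A] assms(3) by (auto simp: basis_of_def)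
  then show ?thesis using basis_extend[OF assms(1)] A that by metis
qed

lemma fd_dim_mono:
  assumes "fd V" "subspace U" "U \<subseteq> V"
  shows "dim U \<le> dim V"
proof -
  obtain A B where "A \<subseteq> B" "basis_of U A" "basis_of V B"
    using basis_extend_subspace[OF assms] .
  then show ?thesis using basis_of_card by (metis basis_of_def card_mono)
qed

lemma fd_dim_eq:
  assumes "fd V" "subspace U" "U \<subseteq> V" "dim V \<le> dim U"
  shows "U = V"
proof -
  obtain A B where A: "basis_of U A" and B: "A \<subseteq> B" "basis_of V B"
    using basis_extend_subspace[OF assms(1-3)] .
  then have "A = B" using A assms(4) basis_of_card
    by (metis basis_of_def card_seteq)
  then show ?thesis using A B by (auto simp: basis_of_def)
qed

lemma fd_dim_less:
  assumes "fd V" "subspace U" "U \<subseteq> V" "U \<noteq> V"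
  shows "dim U < dim V"
  using fd_dim_eq[OF assms(1-3)] assms(4) by linarith

lemma fd_dim_0: "fd U \<Longrightarrow> dim U = 0 \<Longrightarrow> U = {0}"
  by (metis basis_of_card basis_of_def card_0_eq fd_basis span_empty)

lemma lin_span_image: "lin T \<Longrightarrow> span (T ` B) = T ` span B"
  by (rule self.linear_span_image)

lemma lin_subspace_image: "lin T \<Longrightarrow> subspace U \<Longrightarrow> subspace (T ` U)"
  by (rule self.linear_subspace_image)

lemma lin_subspace_kernel:
  assumes "lin T" "subspace U" shows "subspace {x \<in> U. T x = 0}"
  using assms by (auto simp: subspace_def lin_add lin_scale lin_0)

lemma lin_subspace_preimage:
  assumes "lin T" "subspace U" "subspace V" shows "subspace {x \<in> U. T x \<in> V}"
  using assms by (auto simp: subspace_def lin_add lin_scale lin_0)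

lemma fd_image:
  assumes "lin T" "fd U" shows "fd (T ` U)"
proof -
  obtain B where "finite B" "U \<subseteq> span B" using assms(2) by (auto simp: fd_def)
  then have "finite (T ` B)" "T ` U \<subseteq> span (T ` B)"
    using lin_span_image[OF assms(1)] by auto
  then show ?thesis unfolding fd_def
    using lin_subspace_image assms by (auto simp: fd_def)
qed

lemma inj_imp_onto:
  assumes T: "lin T" "T ` U \<subseteq> U" and U: "fd U"
    and inj: "\<And>x. x \<in> U \<Longrightarrow> T x = 0 \<Longrightarrow> x = 0"
  shows "T ` U = U"
proof (rule fd_dim_eq)
  obtain B where B: "basis_of U B" using U fd_basis by blast
  have io: "inj_on T U"
  proof (rule inj_onI)
    fix x y assume "x \<in> U" "y \<in> U" "T x = T y"
    then show "x = y" using inj[of "x - y"] U subspace_diff[of U x y]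
      by (auto simp: lin_diff[OF T(1)] fd_def)
  qed
  have "independent (T ` B)"
    using self.linear_independent_injective_image[OF T(1)] B io by (auto simp: basis_of_def)
  then have "dim (T ` U) = card (T ` B)"
    using dim_span_eq_card_independent lin_span_image[OF T(1)] B by (metis basis_of_def)
  also have "\<dots> = card B"
    using io basis_of_subset[OF B] by (meson card_image inj_on_subset)
  finally show "dim U \<le> dim (T ` U)" using basis_of_card[OF B] by simp
qed (use T U lin_subspace_image in \<open>auto simp: fd_def\<close>)

text \<open>A nonzero kernel vector, completed to a basis, would leave an image spanned by fewer
  vectors than the dimension.\<close>

lemma onto_imp_inj:
  assumes T: "lin T" "T ` U = U" and U: "fd U" and x: "x \<in> U" "T x = 0"
  shows "x = 0"
proof (rule ccontr)
  assume "x \<noteq> 0"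
  then have "independent {x}" by simp
  then obtain B where B: "{x} \<subseteq> B" "basis_of U B"
    using basis_extend[OF U, of "{x}"] x by auto
  have "U = span (T ` B)" using B T lin_span_image[OF T(1)] by (auto simp: basis_of_def)
  also have "T ` B = insert 0 (T ` (B - {x}))" using B x by auto
  also have "span \<dots> = span (T ` (B - {x}))" by simp
  finally have "dim U \<le> card (T ` (B - {x}))"
    using B by (metis basis_of_def dim_le_card finite_Diff finite_imageI order_refl)
  also have "\<dots> \<le> card (B - {x})" using B by (intro card_image_le) (auto simp: basis_of_def)
  also have "\<dots> < card B" using B by (metis basis_of_def card_Diff1_less insert_subset)
  finally show False using basis_of_card B by simp
qed

text \<open>The image of \<open>U\<close> under \<open>r\<close> is the complement of
  \<open>M\<close> on which the quotient of \<open>U\<close> by \<open>M\<close> is modelled. A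
  basis of \<open>M\<close> is sent to 0, and the vectors completing it to a basis of
  \<open>U\<close> are fixed.\<close>

lemma projection_exists:
  assumes "subspace U" "subspace M" "M \<subseteq> U"
  obtains r where "lin r" "\<And>x. r x \<in> U" "\<And>x. r (r x) = r x" "\<And>x. x \<in> M \<Longrightarrow> r x = 0"
    "\<And>x. x \<in> U \<Longrightarrow> x - r x \<in> M"
proof -
  obtain A where A: "A \<subseteq> M" "independent A" "M \<subseteq> span A"
    using maximal_independent_subset by blast
  obtain B where B: "A \<subseteq> B" "B \<subseteq> U" "independent B" "U \<subseteq> span B"
    using maximal_independent_subset_extend[of A U] A assms by blast
  let ?f = "\<lambda>b. if b \<in> A then 0 else b"
  obtain r where r: "lin r" "\<And>b. b \<in> B \<Longrightarrow> r b = ?f b" "range r = span (?f ` B)"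
    using self.linear_independent_extend_subspace[OF B(3), of ?f] by blast
  have sub: "?f ` B \<subseteq> U" using B assms subspace_0 by auto
  have rU: "r x \<in> U" for x
    using r(3) span_minimal[OF sub assms(1)] by auto
  have rr: "r y = y" if "y \<in> range r" for y
  proof -
    have "y \<in> span (?f ` B)" using that r by simp
    then show ?thesis
      by (rule self.linear_eq_on[OF r(1) lin_ident]) (use r(2) lin_0[OF r(1)] in auto)
  qed
  have r0: "r x = 0" if "x \<in> M" for x
  proof (rule self.linear_eq_0_on_span[OF r(1)])
    show "x \<in> span A" using that A by auto
  qed (use A B r(2) in auto)
  have rM: "x - r x \<in> M" if "x \<in> U" for x
  proof -
    have "x \<in> span B" using that B by auto
    then show ?thesis
    proof (induction rule: span_induct_alt)
      case base
      show ?case using lin_0[OF r(1)] subspace_0 assms by simp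
    next
      case (step c b y)
      have "b - r b \<in> M" using step(1) r(2) A assms subspace_0 by auto
      then have "c *s (b - r b) + (y - r y) \<in> M"
        using step assms subspace_add subspace_scale by metis
      then show ?case
        by (simp add: lin_add[OF r(1)] lin_scale[OF r(1)] algebra_simps)
    qed
  qed
  show ?thesis
    by (rule that[OF r(1) rU rr[OF rangeI] r0 rM])
qed

lemma subspace_plus: "subspace U \<Longrightarrow> subspace V \<Longrightarrow> subspace {u + v |u v. u \<in> U \<and> v \<in> V}"
  by (rule subspace_sums)

section \<open>Traces of operators on invariant subspaces\<close>

definition trace :: "'v set \<Rightarrow> ('v \<Rightarrow> 'v) \<Rightarrow> 'k"
  where "trace U T = (let B = SOME B. basis_of U B in \<Sum>b\<in>B. representation B (T b) b)"

text \<open>Two bases serve two ends: with one map the identity, the trace turns out not to depend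
  on the basis, and with \<open>A = B\<close> this is \<open>trace_commute\<close>. Both sides are
  the same double sum over matrix entries of \<open>S\<close> and \<open>T\<close>.\<close>

lemma trace_swap:
  assumes A: "basis_of U A" and B: "basis_of U B"
    and S: "lin S" "S ` U \<subseteq> U" and T: "lin T" "T ` U \<subseteq> U"
  shows "(\<Sum>a\<in>A. representation A (S (T a)) a) = (\<Sum>b\<in>B. representation B (T (S b)) b)"
proof -
  have iA: "independent A" "finite A" "span A = U" and iB: "independent B" "finite B" "span B = U"
    using A B by (auto simp: basis_of_def)
  have mem: "a \<in> U" if "a \<in> A \<or> a \<in> B" for a using that A B basis_of_subset by blast
  have 1: "representation A (S (T a)) a
      = (\<Sum>b\<in>B. representation B (T a) b * representation A (S b) a)" if a: "a \<in> A" for a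
  proof -
    have "T a = (\<Sum>b\<in>B. representation B (T a) b *s b)"
      using sum_representation_eq[OF iB(1), of "T a" B] iB mem a T by (simp add: image_subset_iff)
    from arg_cong[OF this, of S] have "S (T a) = (\<Sum>b\<in>B. representation B (T a) b *s S b)"
      by (simp only: lin_sum[OF S(1)] lin_scale[OF S(1)])
    then have "representation A (S (T a)) a
        = representation A (\<Sum>b\<in>B. representation B (T a) b *s S b) a"
      by (rule arg_cong[where f = "\<lambda>v. representation A v a"])
    also have "\<dots> = (\<Sum>b\<in>B. representation A (representation B (T a) b *s S b) a)"
      by (subst representation_sum) (use iA S mem in \<open>auto intro!: span_scale\<close>)
    also have "\<dots> = (\<Sum>b\<in>B. representation B (T a) b * representation A (S b) a)"
      by (rule sum.cong) (use iA S mem in \<open>auto simp: image_subset_iff representation_scale\<close>)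
    finally show ?thesis .
  qed
  have 2: "representation B (T (S b)) b
      = (\<Sum>a\<in>A. representation A (S b) a * representation B (T a) b)" if b: "b \<in> B" for b
  proof -
    have "S b = (\<Sum>a\<in>A. representation A (S b) a *s a)"
      using sum_representation_eq[OF iA(1), of "S b" A] iA mem b S by (simp add: image_subset_iff)
    from arg_cong[OF this, of T] have "T (S b) = (\<Sum>a\<in>A. representation A (S b) a *s T a)"
      by (simp only: lin_sum[OF T(1)] lin_scale[OF T(1)])
    then have "representation B (T (S b)) b
        = representation B (\<Sum>a\<in>A. representation A (S b) a *s T a) b"
      by (rule arg_cong[where f = "\<lambda>v. representation B v b"])
    also have "\<dots> = (\<Sum>a\<in>A. representation B (representation A (S b) a *s T a) b)"
      by (subst representation_sum) (use iB T mem in \<open>auto intro!: span_scale\<close>)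
    also have "\<dots> = (\<Sum>a\<in>A. representation A (S b) a * representation B (T a) b)"
      by (rule sum.cong) (use iB T mem in \<open>auto simp: image_subset_iff representation_scale\<close>)
    finally show ?thesis .
  qed
  show ?thesis
    by (simp add: 1 2 cong: sum.cong) (subst sum.swap, simp add: mult.commute)
qed

lemma trace_basis:
  assumes B: "basis_of U B" and T: "lin T" "T ` U \<subseteq> U"
  shows "trace U T = (\<Sum>b\<in>B. representation B (T b) b)"
proof -
  have "basis_of U (SOME B. basis_of U B)" using B by (rule someI)
  then show ?thesis
    using trace_swap[OF _ B T lin_ident, of "SOME B. basis_of U B"] by (auto simp: trace_def Let_def)
qed

lemma image_comp_subset:
  "S ` U \<subseteq> U \<Longrightarrow> T ` U \<subseteq> U \<Longrightarrow> (\<lambda>x. S (T x)) ` U \<subseteq> U"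
  by auto

lemma trace_commute:
  assumes U: "fd U" and S: "lin S" "S ` U \<subseteq> U" and T: "lin T" "T ` U \<subseteq> U"
  shows "trace U (\<lambda>x. S (T x)) = trace U (\<lambda>x. T (S x))"
proof -
  obtain B where B: "basis_of U B" using U fd_basis by blast
  have "trace U (\<lambda>x. S (T x)) = (\<Sum>b\<in>B. representation B (S (T b)) b)"
    "trace U (\<lambda>x. T (S x)) = (\<Sum>b\<in>B. representation B (T (S b)) b)"
    using trace_basis[OF B lin_compose[OF S(1) T(1)] image_comp_subset[OF S(2) T(2)]]
      trace_basis[OF B lin_compose[OF T(1) S(1)] image_comp_subset[OF T(2) S(2)]] by auto
  then show ?thesis using trace_swap[OF B B S T] by simp
qed

lemma trace_add:
  assumes U: "fd U" and S: "lin S" "S ` U \<subseteq> U" and T: "lin T" "T ` U \<subseteq> U"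
  shows "trace U (\<lambda>x. S x + T x) = trace U S + trace U T"
proof -
  obtain B where B: "basis_of U B" using U fd_basis by blast
  then have U': "\<And>b. b \<in> B \<Longrightarrow> b \<in> U" "subspace U" "span B = U" "independent B"
    using basis_of_subset basis_of_fd fd_subspace by (auto simp: basis_of_def)
  then have *: "(\<lambda>x. S x + T x) ` U \<subseteq> U" "\<And>b. b \<in> B \<Longrightarrow> S b \<in> span B \<and> T b \<in> span B"
    using U' S(2) T(2) by (simp_all add: image_subset_iff subspace_add)
  show ?thesis
    using *(2) U'(4)
    by (simp add: trace_basis[OF B S] trace_basis[OF B T]
        trace_basis[OF B lin_plus[OF S(1) T(1)] *(1)] representation_add sum.distrib)
qed

lemma trace_scale:
  assumes U: "fd U" and T: "lin T" "T ` U \<subseteq> U"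
  shows "trace U (\<lambda>x. c *s T x) = c * trace U T"
proof -
  obtain B where B: "basis_of U B" using U fd_basis by blast
  then have U': "\<And>b. b \<in> B \<Longrightarrow> b \<in> U" "subspace U" "span B = U" "independent B"
    using basis_of_subset basis_of_fd fd_subspace by (auto simp: basis_of_def)
  then have *: "(\<lambda>x. c *s T x) ` U \<subseteq> U" "\<And>b. b \<in> B \<Longrightarrow> T b \<in> span B"
    using U' T(2) by (simp_all add: image_subset_iff subspace_scale)
  show ?thesis
    unfolding trace_basis[OF B T] trace_basis[OF B lin_scaled[OF T(1)] *(1)]
    using *(2) U'(4) by (simp add: sum_distrib_left representation_scale)
qed

lemma trace_cong:
  assumes U: "fd U" and S: "lin S" "S ` U \<subseteq> U" and T: "lin T"
    and eq: "\<And>x. x \<in> U \<Longrightarrow> S x = T x"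
  shows "trace U S = trace U T"
proof -
  obtain B where B: "basis_of U B" using U fd_basis by blast
  have "T ` U \<subseteq> U" using S eq by (metis image_cong)
  then show ?thesis
    unfolding trace_basis[OF B S] trace_basis[OF B T \<open>T ` U \<subseteq> U\<close>]
    using eq basis_of_subset[OF B] by (intro sum.cong) auto
qed

lemma trace_diff:
  assumes U: "fd U" and S: "lin S" "S ` U \<subseteq> U" and T: "lin T" "T ` U \<subseteq> U"
  shows "trace U (\<lambda>x. S x - T x) = trace U S - trace U T"
proof -
  have "(\<lambda>x. -1 *s T x) ` U \<subseteq> U" using T U by (auto simp: fd_def intro!: subspace_neg)
  then have "trace U (\<lambda>x. S x + -1 *s T x) = trace U S + -1 * trace U T"
    using trace_add[OF U S lin_scaled[OF T(1)]] trace_scale[OF U T] by metis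
  then show ?thesis by simp
qed

lemma trace_zero:
  assumes "fd U" "\<And>x. x \<in> U \<Longrightarrow> T x = 0" shows "trace U T = 0"
proof -
  have "basis_of U (SOME B. basis_of U B)" using fd_basis[OF assms(1)] by (rule someI_ex)
  then have "T b = 0" if "b \<in> (SOME B. basis_of U B)" for b
    using that assms(2) basis_of_subset by blast
  then show ?thesis
    by (simp add: trace_def Let_def representation_zero)
qed

lemma trace_ident:
  assumes "fd U" shows "trace U (\<lambda>x. x) = of_nat (dim U)"
proof -
  obtain B where B: "basis_of U B" using assms fd_basis by blast
  then have "trace U (\<lambda>x. x) = (\<Sum>b\<in>B. 1)"
    by (subst trace_basis[OF B]) (auto simp: lin_ident representation_basis basis_of_def)
  then show ?thesis using basis_of_card[OF B] by simp
qed

lemma trace_sum: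
  assumes "finite A" "fd U" "\<And>i. i \<in> A \<Longrightarrow> lin (F i)" "\<And>i. i \<in> A \<Longrightarrow> F i ` U \<subseteq> U"
  shows "trace U (\<lambda>x. \<Sum>i\<in>A. F i x) = (\<Sum>i\<in>A. trace U (F i))"
  using assms(1,3,4)
proof (induction A)
  case empty
  show ?case using trace_zero[OF assms(2)] by simp
next
  case (insert a A)
  have "(\<lambda>x. \<Sum>i\<in>A. F i x) ` U \<subseteq> U"
    using insert assms(2) by (auto simp: fd_def intro!: subspace_sum)
  then have "trace U (\<lambda>x. F a x + (\<Sum>i\<in>A. F i x)) = trace U (F a) + trace U (\<lambda>x. \<Sum>i\<in>A. F i x)"
    using insert by (intro trace_add assms(2) lin_sum_fun) auto
  then show ?case using insert by simp
qed

text \<open>In a basis of \<open>U\<close> extended to \<open>V\<close>, the added basis vectors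
  have diagonal coefficient 0, because \<open>T\<close> takes values in \<open>U\<close>.\<close>

lemma trace_image:
  assumes V: "fd V" and U: "subspace U" "U \<subseteq> V" and T: "lin T" "T ` V \<subseteq> U"
  shows "trace V T = trace U T"
proof -
  obtain A B where A: "basis_of U A" and B: "A \<subseteq> B" "basis_of V B"
    using basis_extend_subspace[OF V U] .
  have rep: "representation B (T b) = representation A (T b)" if "b \<in> B" for b
    using representation_extend[of B "T b" A] A B T basis_of_subset[OF B(2)] that
    by (auto simp: basis_of_def)
  have "trace V T = (\<Sum>b\<in>B. representation A (T b) b)"
    using T U by (subst trace_basis[OF B(2)]) (auto simp: rep)
  also have "\<dots> = (\<Sum>b\<in>A. representation A (T b) b)"
    using B by (intro sum.mono_neutral_right) (auto simp: basis_of_def dest: representation_ne_zero)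
  finally show ?thesis using T U by (subst trace_basis[OF A]) auto
qed

text \<open>If \<open>T\<close> is onto, so are its powers, and \<open>U\<close> is zero; otherwise
  the trace may be computed on the image, which has smaller dimension.\<close>

lemma trace_nilpotent:
  assumes "fd U" "lin T" "T ` U \<subseteq> U" "\<And>x. x \<in> U \<Longrightarrow> (T ^^ n) x = 0"
  shows "trace U T = 0"
  using assms
proof (induction "dim U" arbitrary: U rule: less_induct)
  case less
  show ?case
  proof (cases "T ` U = U")
    case True
    have "(T ^^ m) ` U = U" for m
      by (induction m) (simp, metis True funpow.simps(2) image_comp)
    then have "U = (T ^^ n) ` U" by simp
    also have "\<dots> \<subseteq> {0}" using less by auto
    finally have "\<And>x. x \<in> U \<Longrightarrow> T x = 0" using lin_0[OF less(3)] by auto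
    then show ?thesis using trace_zero less by blast
  next
    case False
    have s: "subspace (T ` U)" using less lin_subspace_image fd_subspace by blast
    have "trace U T = trace (T ` U) T" by (rule trace_image) (use s less in auto)
    also have "\<dots> = 0"
      by (rule less) (use s less False fd_dim_less fd_subset in auto)
    finally show ?thesis .
  qed
qed

end

section \<open>Generalised eigenvectors\<close>

context lin_space begin

text \<open>A projection killing exactly \<open>V\<close> is injective on \<open>U\<close>;
  following it by a left inverse with values in \<open>U\<close> gives the projection onto
  \<open>U\<close> along \<open>V\<close>.\<close>

lemma direct_projection:
  assumes "subspace U" "subspace V" "U \<inter> V = {0}"
  obtains p where "lin p" "\<And>x. p x \<in> U" "\<And>x. x \<in> U \<Longrightarrow> p x = x" "\<And>x. x \<in> V \<Longrightarrow> p x = 0"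
proof -
  obtain r where r: "lin r" "\<And>x. x \<in> V \<Longrightarrow> r x = 0" "\<And>x. x - r x \<in> V"
    using projection_exists[OF subspace_UNIV assms(2) subset_UNIV] by (metis UNIV_I)
  have "inj_on r U"
  proof (rule inj_onI)
    fix x y assume xy: "x \<in> U" "y \<in> U" "r x = r y"
    then have "x - y \<in> V" using r(3)[of "x - y"] by (simp add: lin_diff[OF r(1)])
    moreover have "x - y \<in> U" using xy assms subspace_diff by blast
    ultimately have "x - y \<in> U \<inter> V" by blast
    then show "x = y" using assms(3) by simp
  qed
  then obtain g where g: "range g \<subseteq> U" "lin g" "\<forall>v\<in>U. g (r v) = v"
    using self.linear_exists_left_inverse_on[OF r(1) assms(1)] by blast
  show ?thesis
    by (rule that[of "\<lambda>x. g (r x)"]) (use g r lin_compose lin_0 in auto)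
qed

lemma commute_funpow:
  assumes "\<And>x. x \<in> U \<Longrightarrow> S x \<in> U" "\<And>x. x \<in> U \<Longrightarrow> R (S x) = S (R x)" "x \<in> U"
  shows "R ((S ^^ k) x) = (S ^^ k) (R x)"
proof -
  have "(S ^^ k) x \<in> U \<and> R ((S ^^ k) x) = (S ^^ k) (R x)"
    by (induction k) (use assms in auto)
  then show ?thesis ..
qed

lemma funpow_invariant: "(\<And>x. x \<in> U \<Longrightarrow> S x \<in> U) \<Longrightarrow> x \<in> U \<Longrightarrow> (S ^^ k) x \<in> U"
  by (induction k) auto

text \<open>The power \<open>n\<close> minimises the dimension of the image, so \<open>S\<close>
  maps this image onto itself and hence injectively. Each \<open>x\<close> then differs from an
  element of the image by a vector that the power kills.\<close>

lemma fitting: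
  assumes U: "fd U" and S: "lin S" "S ` U \<subseteq> U"
  obtains n where "{x \<in> U. (S ^^ n) x = 0} \<inter> (S ^^ n) ` U = {0}"
    "\<And>x. x \<in> U \<Longrightarrow> \<exists>a\<in>{x \<in> U. (S ^^ n) x = 0}. \<exists>b\<in>(S ^^ n) ` U. x = a + b"
    "S ` (S ^^ n) ` U = (S ^^ n) ` U"
proof -
  define n where "n = (ARG_MIN (\<lambda>m. dim ((S ^^ m) ` U)) m. True)"
  let ?V = "(S ^^ n) ` U"
  have min: "dim ?V \<le> dim ((S ^^ m) ` U)" for m
    unfolding n_def by (rule arg_min_nat_le) simp
  have V: "fd ?V" by (rule fd_image[OF lin_funpow[OF S(1)] U])
  have inv: "(S ^^ m) ` U \<subseteq> U" for m
    using funpow_invariant[of U S] S(2) by auto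
  have shift: "S ` ?V = (S ^^ Suc n) ` U" by (simp add: image_image)
  have sub: "S ` ?V \<subseteq> ?V"
  proof -
    have "S ` ?V = (S ^^ n) ` (S ` U)" by (simp add: image_image funpow_swap1)
    then show ?thesis using S(2) by auto
  qed
  have onto: "S ` ?V = ?V"
  proof (rule fd_dim_eq[OF V _ sub])
    show "subspace (S ` ?V)" using V S lin_subspace_image fd_subspace by blast
    show "dim ?V \<le> dim (S ` ?V)" unfolding shift by (rule min)
  qed
  have onto_n: "(S ^^ m) ` ?V = ?V" for m
    by (induction m) (simp, metis onto funpow.simps(2) image_comp)
  have inj: "x = 0" if "x \<in> ?V" "(S ^^ n) x = 0" for x
    by (rule onto_imp_inj[OF lin_funpow[OF S(1)] onto_n V that])
  show ?thesis
  proof (rule that[of n])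
    show "{x \<in> U. (S ^^ n) x = 0} \<inter> ?V = {0}"
      using inj U V lin_0[OF lin_funpow[OF S(1)]] subspace_0[OF fd_subspace] by auto
    fix x assume x: "x \<in> U"
    then have "(S ^^ n) x \<in> (S ^^ n) ` ?V" using onto_n by auto
    then obtain v where v: "v \<in> ?V" "(S ^^ n) x = (S ^^ n) v" by auto
    have "x - v \<in> U" using x v inv[of n] U subspace_diff fd_subspace by blast
    then have "x - v \<in> {x \<in> U. (S ^^ n) x = 0}"
      using v by (simp add: lin_diff[OF lin_funpow[OF S(1)]])
    then show "\<exists>a\<in>{x \<in> U. (S ^^ n) x = 0}. \<exists>b\<in>?V. x = a + b"
      using v by (metis diff_add_cancel)
  qed (rule onto)
qed

text \<open>The coefficients are indexed by \<open>I\<close> rather than by the image, since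
  \<open>f\<close> need not be injective.\<close>

lemma span_image_sum:
  assumes "finite I" "v \<in> span (f ` I)"
  shows "\<exists>c. v = (\<Sum>i\<in>I. c i *s f i)"
  using assms(2)
proof (induction rule: span_induct_alt)
  case base
  show ?case by (rule exI[of _ "\<lambda>_. 0"]) simp
next
  case (step a x y)
  then obtain i c where i: "i \<in> I" "x = f i" "y = (\<Sum>i\<in>I. c i *s f i)" by auto
  have "a *s x + y = (\<Sum>j\<in>I. (if j = i then a else 0) *s f j) + y"
    using i assms(1) by (simp add: if_distrib[of "\<lambda>c. c *s _"] sum.delta cong: if_cong)
  then have "a *s x + y = (\<Sum>j\<in>I. ((if j = i then a else 0) + c j) *s f j)"
    using i by (simp add: scale_left_distrib sum.distrib)
  then show ?case by (rule exI[where x = "\<lambda>j. (if j = i then a else 0) + c j"])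
qed

end

locale alg_closed_space = lin_space scale
  for scale :: "'k::{alg_closed_field, field_char_0} \<Rightarrow> 'v::ab_group_add \<Rightarrow> 'v" (infixr \<open>*s\<close> 75)
begin

text \<open>The iterates of a nonzero \<open>u\<close> become linearly dependent, so some nonzero
  polynomial in \<open>T\<close> kills \<open>u\<close>. Take one of least degree and a root
  \<open>\<mu>\<close>: dividing out the linear factor leaves a polynomial whose value on
  \<open>u\<close> is nonzero, and this value is an eigenvector.\<close>

lemma eigenvector_exists:
  assumes U: "fd U" "U \<noteq> {0}" and T: "lin T" "T ` U \<subseteq> U"
  obtains \<mu> w where "w \<in> U" "w \<noteq> 0" "T w = \<mu> *s w"
proof -
  obtain u where u: "u \<in> U" "u \<noteq> 0" using U subspace_0[OF fd_subspace[OF U(1)]] by auto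
  let ?f = "\<lambda>i. (T ^^ i) u"
  have fU: "?f i \<in> U" for i using funpow_invariant[of U T u] T u by auto
  have "\<exists>n. ?f n \<in> span (?f ` {..<n})"
  proof (rule ccontr)
    assume "\<nexists>n. ?f n \<in> span (?f ` {..<n})"
    then have no: "?f n \<notin> span (?f ` {..<n})" for n by (rule not_ex[THEN iffD1, THEN spec])
    have "independent (?f ` {..<n}) \<and> card (?f ` {..<n}) = n" for n
    proof (induction n)
      case (Suc n)
      have "?f n \<notin> ?f ` {..<n}" using no[of n] by (rule contrapos_nn) (rule span_base)
      then show ?case
        using Suc no[of n] independent_insertI[of "?f n" "?f ` {..<n}"] by (simp add: lessThan_Suc)
    qed (simp add: independent_empty)
    then have i: "independent (?f ` {..dim U})" "card (?f ` {..dim U}) = Suc (dim U)"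
      by (metis lessThan_Suc_atMost)+
    obtain B where B: "basis_of U B" using U fd_basis by blast
    have "?f ` {..dim U} \<subseteq> span B" using fU B by (auto simp: basis_of_def)
    then have "card (?f ` {..dim U}) \<le> card B"
      using independent_span_bound[of B "?f ` {..dim U}"] i B by (auto simp: basis_of_def)
    then show False using i basis_of_card[OF B] by simp
  qed
  then obtain n where n: "?f n \<in> span (?f ` {..<n})" by blast
  \<comment> \<open>\<open>ev p\<close> is the vector \<open>p(T) u\<close>.\<close>
  define ev where "ev p = (\<Sum>i\<le>degree p. coeff p i *s ?f i)" for p :: "'k poly"
  have ev: "ev p = (\<Sum>i\<le>N. coeff p i *s ?f i)" if "degree p \<le> N" for p N
    unfolding ev_def
    by (rule sum.mono_neutral_left) (use that in \<open>auto intro!: coeff_eq_0\<close>)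
  obtain c where c: "?f n = (\<Sum>i<n. c i *s ?f i)"
    using span_image_sum[OF _ n] by auto
  define P where "P p \<longleftrightarrow> p \<noteq> 0 \<and> ev p = 0" for p
  have "P (monom 1 n - (\<Sum>i<n. monom (c i) i))" (is "P ?p")
  proof -
    have cf: "coeff ?p i = (if i < n then - c i else if i = n then 1 else 0)" for i
      by (simp add: coeff_sum if_distrib)
    have "degree ?p \<le> n" by (rule degree_le) (simp add: cf del: coeff_diff)
    then have "ev ?p = (\<Sum>i\<le>n. coeff ?p i *s ?f i)" by (rule ev)
    also have "\<dots> = (\<Sum>i<n. - c i *s ?f i) + ?f n"
      unfolding lessThan_Suc_atMost[symmetric] sum.lessThan_Suc by (simp add: cf del: coeff_diff)
    also have "\<dots> = 0" unfolding c by (simp add: sum_negf)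
    finally have "ev ?p = 0" .
    moreover have "?p \<noteq> 0" using cf[of n] by (metis coeff_0 less_irrefl zero_neq_one)
    ultimately show ?thesis by (simp add: P_def)
  qed
  then obtain p where p: "P p" "\<And>q. P q \<Longrightarrow> degree p \<le> degree q"
    using arg_min_nat_lemma[of P _ degree] by blast
  have "degree p > 0"
  proof (rule ccontr)
    assume "\<not> degree p > 0"
    then obtain a where "p = [:a:]" using degree_eq_zeroE by blast
    then show False using p(1) u by (auto simp: P_def ev_def)
  qed
  then obtain \<mu> where "poly p \<mu> = 0" using alg_closed_imp_poly_has_root by blast
  then obtain q where q: "p = [:- \<mu>, 1:] * q" using poly_eq_0_iff_dvd by (metis dvdE)
  have q0: "q \<noteq> 0" using q p by (auto simp: P_def)
  have dp: "degree p = Suc (degree q)" unfolding q using q0 by (subst degree_mult_eq) simp_all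
  have "ev q \<noteq> 0" using p(2)[of q] q0 dp by (auto simp: P_def)
  moreover have "T (ev q) = \<mu> *s ev q"
  proof -
    have "ev p = (\<Sum>i\<le>Suc (degree q). coeff p i *s ?f i)" by (rule ev) (simp add: dp)
    \<comment> \<open>Multiplication by the linear factor shifts the coefficients of
      \<open>q\<close> and subtracts \<open>\<mu>\<close> times them; on vectors this is
      \<open>T - \<mu>\<close>.\<close>
    also have "\<dots> = (\<Sum>i\<le>Suc (degree q). (coeff (pCons 0 q) i - \<mu> * coeff q i) *s ?f i)"
      by (rule sum.cong) (auto simp: q)
    also have "\<dots> = (\<Sum>i\<le>Suc (degree q). coeff (pCons 0 q) i *s ?f i)
        - \<mu> *s (\<Sum>i\<le>Suc (degree q). coeff q i *s ?f i)"
      by (simp only: scale_left_diff_distrib sum_subtractf scale_sum_right scale_scale)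
    also have "(\<Sum>i\<le>Suc (degree q). coeff q i *s ?f i) = ev q" by (simp only: ev[OF le_SucI[OF order_refl]])
    also have "(\<Sum>i\<le>Suc (degree q). coeff (pCons 0 q) i *s ?f i) = T (ev q)"
      unfolding sum.atMost_Suc_shift
      by (simp add: ev_def lin_sum[OF T(1)] lin_scale[OF T(1)])
    finally show ?thesis using p(1) by (simp add: P_def)
  qed
  moreover have "ev q \<in> U"
    unfolding ev_def using fd_subspace[OF U(1)] fU by (intro subspace_sum subspace_scale)
  ultimately show ?thesis using that[of "ev q" \<mu>] by simp
qed

definition gen_eigen :: "('v \<Rightarrow> 'v) \<Rightarrow> 'k \<Rightarrow> 'v \<Rightarrow> bool"
  where "gen_eigen T \<mu> w \<longleftrightarrow> (\<exists>k. ((\<lambda>z. T z - \<mu> *s z) ^^ k) w = 0)"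

lemma lin_shift: "lin T \<Longrightarrow> lin (\<lambda>z. T z - \<mu> *s z)"
  by (intro lin_intros) assumption

text \<open>By induction on the sum of the exponents, both \<open>T v - \<mu> v\<close> and
  \<open>T v - \<nu> v\<close> vanish, since each lowers one exponent and keeps the other. Their
  difference is a nonzero multiple of \<open>v\<close>.\<close>

lemma gen_eigen_unique:
  assumes T: "lin T" and "gen_eigen T \<mu> v" "gen_eigen T \<nu> v" "\<mu> \<noteq> \<nu>"
  shows "v = 0"
proof -
  let ?D = "\<lambda>\<mu> z. T z - \<mu> *s z"
  have comm: "(?D \<mu> ^^ k) (?D \<nu> v) = ?D \<nu> ((?D \<mu> ^^ k) v)" for \<mu> \<nu> k v
    by (rule commute_funpow[of UNIV "?D \<mu>" "?D \<nu>", symmetric])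
      (simp_all add: lin_diff[OF T] lin_scale[OF T] scale_right_diff_distrib mult.commute)
  have "\<forall>v. (?D \<mu> ^^ k) v = 0 \<longrightarrow> (?D \<nu> ^^ l) v = 0 \<longrightarrow> v = 0" for k l
  proof (induction "k + l" arbitrary: k l)
    case 0
    then show ?case by simp
  next
    case (Suc m)
    show ?case
    proof (intro allI impI)
      fix v assume v: "(?D \<mu> ^^ k) v = 0" "(?D \<nu> ^^ l) v = 0"
      show "v = 0"
      proof (cases "k = 0 \<or> l = 0")
        case False
        then obtain k' l' where kl: "k = Suc k'" "l = Suc l'" by (metis not0_implies_Suc)
        have "?D \<mu> v = 0"
        proof (rule Suc(1)[of k' l, rule_format])
          show "(?D \<mu> ^^ k') (?D \<mu> v) = 0" using v(1) kl by (simp only: funpow_Suc_right o_def)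
          show "(?D \<nu> ^^ l) (?D \<mu> v) = 0" using v(2) by (simp add: comm lin_0[OF T])
        qed (use Suc(2) kl in simp)
        moreover have "?D \<nu> v = 0"
        proof (rule Suc(1)[of k l', rule_format])
          show "(?D \<nu> ^^ l') (?D \<nu> v) = 0" using v(2) kl by (simp only: funpow_Suc_right o_def)
          show "(?D \<mu> ^^ k) (?D \<nu> v) = 0" using v(1) by (simp add: comm lin_0[OF T])
        qed (use Suc(2) kl in simp)
        ultimately have "(\<mu> - \<nu>) *s v = 0" by (simp add: scale_left_diff_distrib)
        then show ?thesis using assms(4) by simp
      qed (use v in auto)
    qed
  qed
  then show ?thesis using assms(2,3) by (auto simp: gen_eigen_def)
qed

text \<open>Fitting's decomposition for \<open>T - \<mu>\<close> at an eigenvalue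
  \<open>\<mu>\<close>. The complement \<open>U1\<close> is smaller than \<open>U\<close> because
  \<open>T - \<mu>\<close> is onto \<open>U1\<close> but not injective on \<open>U\<close>. This is
  the induction step for \<open>span_gen_eigen\<close> and
  \<open>semisimple_calculus\<close>.\<close>

lemma eigen_split:
  assumes U: "fd U" "U \<noteq> {0}" and T: "lin T" "T ` U \<subseteq> U"
  obtains \<mu> n U0 U1 p q where
    "subspace U0" "subspace U1" "U0 \<subseteq> U" "U1 \<subseteq> U" "dim U1 < dim U" "U0 \<noteq> {0}"
    "T ` U0 \<subseteq> U0" "T ` U1 \<subseteq> U1" "\<And>x. x \<in> U0 \<Longrightarrow> ((\<lambda>z. T z - \<mu> *s z) ^^ n) x = 0"
    "lin p" "lin q" "\<And>x. p x \<in> U0" "\<And>x. q x \<in> U1" "\<And>x. x \<in> U0 \<Longrightarrow> p x = x"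
    "\<And>x. x \<in> U \<Longrightarrow> p x + q x = x" "\<And>x. x \<in> U \<Longrightarrow> p (T x) = T (p x)"
    "\<And>x. x \<in> U \<Longrightarrow> q (T x) = T (q x)" "\<And>x. x \<in> U1 \<Longrightarrow> q x = x"
proof -
  obtain \<mu> w where w: "w \<in> U" "w \<noteq> 0" "T w = \<mu> *s w" using eigenvector_exists[OF assms] .
  let ?S = "\<lambda>z. T z - \<mu> *s z"
  have sU: "subspace U" using U fd_subspace by blast
  have S: "lin ?S" "?S ` U \<subseteq> U"
    using T lin_shift sU by (auto intro!: subspace_diff subspace_scale)
  obtain n where n: "{x \<in> U. (?S ^^ n) x = 0} \<inter> (?S ^^ n) ` U = {0}"
    "\<And>x. x \<in> U \<Longrightarrow> \<exists>a\<in>{x \<in> U. (?S ^^ n) x = 0}. \<exists>b\<in>(?S ^^ n) ` U. x = a + b"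
    "?S ` (?S ^^ n) ` U = (?S ^^ n) ` U"
    by (rule fitting[OF U(1) S]) (rule that)
  define U0 where "U0 = {x \<in> U. (?S ^^ n) x = 0}"
  define U1 where "U1 = (?S ^^ n) ` U"
  note n = n[folded U0_def U1_def]
  have Sn: "lin (?S ^^ n)" using S lin_funpow by blast
  have s0: "subspace U0" and s1: "subspace U1"
    unfolding U0_def U1_def using lin_subspace_kernel[OF Sn sU] lin_subspace_image[OF Sn sU] by auto
  have sub0: "U0 \<subseteq> U" and sub1: "U1 \<subseteq> U"
    unfolding U0_def U1_def using funpow_invariant[of U ?S] S(2) by auto
  have ne: "U1 \<noteq> U"
  proof
    assume "U1 = U"
    then have "w = 0" using onto_imp_inj[OF S(1) _ U(1) w(1)] n(3) w(3) by auto
    then show False using w by simp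
  qed
  have "U0 \<noteq> {0}"
  proof
    assume "U0 = {0}"
    then have "U \<subseteq> U1" using n(2) by fastforce
    then show False using ne sub1 by auto
  qed
  obtain p where p: "lin p" "\<And>x. p x \<in> U0" "\<And>x. x \<in> U0 \<Longrightarrow> p x = x" "\<And>x. x \<in> U1 \<Longrightarrow> p x = 0"
    by (rule direct_projection[OF s0 s1 n(1)]) (rule that)
  obtain q where q: "lin q" "\<And>x. q x \<in> U1" "\<And>x. x \<in> U1 \<Longrightarrow> q x = x" "\<And>x. x \<in> U0 \<Longrightarrow> q x = 0"
    by (rule direct_projection[OF s1 s0 n(1)[unfolded Int_commute[of U0]]]) (rule that)
  have pq: "p x + q x = x" if x: "x \<in> U" for x
  proof -
    obtain a b where ab: "a \<in> U0" "b \<in> U1" "x = a + b" using n(2)[OF x] by blast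
    have "p x = a" "q x = b"
      using ab p(3,4) q(3,4) by (simp_all add: lin_add[OF p(1)] lin_add[OF q(1)])
    then show ?thesis using ab by simp
  qed
  have T0: "T x \<in> U0" if "x \<in> U0" for x
  proof -
    have "?S ((?S ^^ n) x) = (?S ^^ n) (?S x)" by (rule funpow_swap1)
    then have "?S x \<in> U0" using that S by (auto simp: U0_def lin_0[OF T(1)])
    then have "?S x + \<mu> *s x \<in> U0" using that s0 subspace_add subspace_scale by blast
    then show ?thesis by simp
  qed
  have T1: "T x \<in> U1" if "x \<in> U1" for x
  proof -
    have "?S x \<in> U1" using n(3) that by blast
    then have "?S x + \<mu> *s x \<in> U1" using that s1 subspace_add subspace_scale by blast
    then show ?thesis by simp
  qed
  have comm: "p (T x) = T (p x)" "q (T x) = T (q x)" if x: "x \<in> U" for x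
  proof -
    have "T x = T (p x + q x)" using pq[OF x] by simp
    then have *: "T x = T (p x) + T (q x)" by (simp add: lin_add[OF T(1)])
    show "p (T x) = T (p x)" unfolding * lin_add[OF p(1)] using p T0 T1 q(2) by simp
    show "q (T x) = T (q x)" unfolding * lin_add[OF q(1)] using q T0 T1 p(2) by simp
  qed
  show ?thesis
    by (rule that[OF s0 s1 sub0 sub1 fd_dim_less[OF U(1) s1 sub1 ne] \<open>U0 \<noteq> {0}\<close> _ _ _ p(1) q(1) p(2) q(2) p(3) pq comm q(3)])
      (use T0 T1 in \<open>auto simp: U0_def\<close>)
qed

lemma span_gen_eigen:
  assumes "fd U" "lin T" "T ` U \<subseteq> U"
  shows "U \<subseteq> span {w \<in> U. \<exists>\<mu>. gen_eigen T \<mu> w}"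
  using assms
proof (induction "dim U" arbitrary: U rule: less_induct)
  case less
  show ?case
  proof (cases "U = {0}")
    case True
    then show ?thesis using span_zero by auto
  next
    case False
    obtain \<mu> n U0 U1 p q where s: "subspace U0" "subspace U1" "U0 \<subseteq> U" "U1 \<subseteq> U" "dim U1 < dim U"
      "T ` U1 \<subseteq> U1" "\<And>x. x \<in> U0 \<Longrightarrow> ((\<lambda>z. T z - \<mu> *s z) ^^ n) x = 0"
      "\<And>x. p x \<in> U0" "\<And>x. q x \<in> U1" "\<And>x. x \<in> U \<Longrightarrow> p x + q x = x"
      by (rule eigen_split[OF less(2) False less(3,4)]) (rule that)
    let ?E = "{w \<in> U. \<exists>\<mu>. gen_eigen T \<mu> w}"
    have "U1 \<subseteq> span {w \<in> U1. \<exists>\<mu>. gen_eigen T \<mu> w}"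
      using less(1)[OF s(5)] fd_subset less s by blast
    also have "\<dots> \<subseteq> span ?E" using s(4) by (intro span_mono) auto
    finally have U1: "U1 \<subseteq> span ?E" .
    have U0: "U0 \<subseteq> ?E" using s(3,7) by (auto simp: gen_eigen_def)
    show ?thesis
    proof
      fix x assume "x \<in> U"
      then have "x = p x + q x" using s(10) by simp
      moreover have "p x \<in> span ?E" "q x \<in> span ?E" using U0 U1 s(8,9) span_base by blast+
      ultimately show "x \<in> span ?E" using span_add by metis
    qed
  qed
qed

text \<open>The list \<open>L\<close> collects the eigenvalues of \<open>T\<close> with multiplicity; \<open>y\<close> is \<open>f\<close> applied to the
  semisimple part of \<open>T\<close>.\<close>

lemma semisimple_calculus:
  assumes "fd U" "lin T" "T ` U \<subseteq> U"
  shows "\<exists>L. (set L \<subseteq> {0} \<longrightarrow> (\<exists>n. \<forall>x\<in>U. (T ^^ n) x = 0)) \<and>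
    (\<forall>f. \<exists>y. lin y \<and> y ` U \<subseteq> U \<and> (\<forall>\<mu> w. w \<in> U \<longrightarrow> gen_eigen T \<mu> w \<longrightarrow> y w = f \<mu> *s w) \<and>
      trace U (\<lambda>x. T (y x)) = (\<Sum>\<mu>\<leftarrow>L. \<mu> * f \<mu>))"
  using assms
proof (induction "dim U" arbitrary: U rule: less_induct)
  case less
  note T = less(3,4) and U = less(2)
  show ?case
  proof (cases "U = {0}")
    case True
    have z: "lin (\<lambda>x. 0)" by (rule linI) auto
    show ?thesis
      by (rule exI[of _ "[]"], intro conjI impI allI exI[of _ "\<lambda>x. 0"] exI[of _ 0])
        (use True trace_zero[of U] U lin_0[OF T(1)] z in \<open>auto\<close>)
  next
    case False
    obtain \<mu> n U0 U1 p q where s: "subspace U0" "subspace U1" "U0 \<subseteq> U" "U1 \<subseteq> U" "dim U1 < dim U" "U0 \<noteq> {0}"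
      "T ` U0 \<subseteq> U0" "T ` U1 \<subseteq> U1" "\<And>x. x \<in> U0 \<Longrightarrow> ((\<lambda>z. T z - \<mu> *s z) ^^ n) x = 0"
      "lin p" "lin q" "\<And>x. p x \<in> U0" "\<And>x. q x \<in> U1" "\<And>x. x \<in> U0 \<Longrightarrow> p x = x"
      "\<And>x. x \<in> U \<Longrightarrow> p x + q x = x" "\<And>x. x \<in> U \<Longrightarrow> p (T x) = T (p x)"
      "\<And>x. x \<in> U \<Longrightarrow> q (T x) = T (q x)" "\<And>x. x \<in> U1 \<Longrightarrow> q x = x"
      by (rule eigen_split[OF U False T]) (rule that)
    let ?S = "\<lambda>z. T z - \<mu> *s z"
    have fd0: "fd U0" and fd1: "fd U1" using fd_subset U s by auto
    obtain L where L: "set L \<subseteq> {0} \<Longrightarrow> \<exists>n. \<forall>x\<in>U1. (T ^^ n) x = 0"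
      "\<And>f. \<exists>y. lin y \<and> y ` U1 \<subseteq> U1 \<and> (\<forall>\<mu> w. w \<in> U1 \<longrightarrow> gen_eigen T \<mu> w \<longrightarrow> y w = f \<mu> *s w) \<and>
      trace U1 (\<lambda>x. T (y x)) = (\<Sum>\<mu>\<leftarrow>L. \<mu> * f \<mu>)"
      using less(1)[OF s(5) fd1 T(1) s(8)] by blast
    have comm: "((\<lambda>z. T z - \<nu> *s z) ^^ k) (r w) = r (((\<lambda>z. T z - \<nu> *s z) ^^ k) w)"
      if "lin r" "\<And>x. x \<in> U \<Longrightarrow> r (T x) = T (r x)" "w \<in> U" for r \<nu> k w
      by (rule commute_funpow[of U, symmetric])
        (use that T fd_subspace[OF U] in \<open>auto simp: lin_diff lin_scale intro!: subspace_diff subspace_scale\<close>)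
    show ?thesis
    proof (intro exI[of _ "replicate (dim U0) \<mu> @ L"] conjI allI impI)
      assume "set (replicate (dim U0) \<mu> @ L) \<subseteq> {0}"
      moreover have "dim U0 \<noteq> 0" using fd_dim_0[OF fd0] s(6) by blast
      ultimately have \<mu>: "\<mu> = 0" "set L \<subseteq> {0}" by auto
      then obtain m where m: "\<And>x. x \<in> U1 \<Longrightarrow> (T ^^ m) x = 0" using L(1) by blast
      have "(T ^^ (m + n)) x = 0" if x: "x \<in> U" for x
      proof -
        have 0: "(T ^^ (m + n)) (p x) = 0"
          using s(9)[OF s(12), of x] \<mu> lin_0[OF lin_funpow[OF T(1)]] by (simp add: funpow_add)
        have 1: "(T ^^ (n + m)) (q x) = 0"
          using m[OF s(13), of x] lin_0[OF lin_funpow[OF T(1)]] by (simp add: funpow_add)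
        have "(T ^^ (m + n)) (p x + q x) = 0"
          using 0 1 by (simp add: lin_add[OF lin_funpow[OF T(1)]] add.commute)
        then show ?thesis using s(15)[OF x] by simp
      qed
      then show "\<exists>n. \<forall>x\<in>U. (T ^^ n) x = 0" by blast
    next
      fix f :: "'k \<Rightarrow> 'k"
      obtain y where *: "lin y \<and> y ` U1 \<subseteq> U1 \<and> (\<forall>\<nu> w. w \<in> U1 \<longrightarrow> gen_eigen T \<nu> w \<longrightarrow> y w = f \<nu> *s w)
        \<and> trace U1 (\<lambda>x. T (y x)) = (\<Sum>\<nu>\<leftarrow>L. \<nu> * f \<nu>)"
        using L(2)[of f] ..
      then have y: "lin y" "y ` U1 \<subseteq> U1" "\<And>\<nu> w. w \<in> U1 \<Longrightarrow> gen_eigen T \<nu> w \<Longrightarrow> y w = f \<nu> *s w"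
        "trace U1 (\<lambda>x. T (y x)) = (\<Sum>\<nu>\<leftarrow>L. \<nu> * f \<nu>)"
        by simp_all
      \<comment> \<open>Multiplication by \<open>f \<mu>\<close> on the generalised eigenspace, and
        the operator from the induction hypothesis on its complement.\<close>
      let ?y = "\<lambda>x. f \<mu> *s p x + y (q x)"
      have inU: "p x \<in> U" "q x \<in> U" "y (q x) \<in> U1" "y (q x) \<in> U" "T (p x) \<in> U0" "T (y (q x)) \<in> U1" for x
      proof -
        show 1: "y (q x) \<in> U1" using y(2) s(13)[of x] by (rule subsetD[OF _ imageI])
        show "T (p x) \<in> U0" using s(7) s(12)[of x] by (rule subsetD[OF _ imageI])
        show "T (y (q x)) \<in> U1" using s(8) 1 by (rule subsetD[OF _ imageI])
        show "p x \<in> U" using s(3) s(12)[of x] by (rule subsetD)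
        show "q x \<in> U" using s(4) s(13)[of x] by (rule subsetD)
        show "y (q x) \<in> U" using s(4) 1 by (rule subsetD)
      qed
      have l: "lin (\<lambda>x. y (q x))" "lin (\<lambda>x. T (p x))" "lin (\<lambda>x. T (y (q x)))" "lin (\<lambda>x. T (y x))"
        by (intro lin_compose[OF y(1) s(11)] lin_compose[OF T(1) s(10)]
            lin_compose[OF T(1) lin_compose[OF y(1) s(11)]] lin_compose[OF T(1) y(1)])+
      have "lin ?y" using l s(10) by (intro lin_intros)
      moreover have "?y ` U \<subseteq> U" using inU fd_subspace[OF U] by (auto intro!: subspace_add subspace_scale)
      moreover have "?y w = f \<nu> *s w" if w: "w \<in> U" "gen_eigen T \<nu> w" for \<nu> w
      proof -
        obtain k where k: "((\<lambda>z. T z - \<nu> *s z) ^^ k) w = 0" using w by (auto simp: gen_eigen_def)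
        have gp: "gen_eigen T \<nu> (p w)" and gq: "gen_eigen T \<nu> (q w)"
          unfolding gen_eigen_def
          using comm[OF s(10,16) w(1), where \<nu> = \<nu> and k = k]
            comm[OF s(11,17) w(1), where \<nu> = \<nu> and k = k]
          by (intro exI[of _ k]; simp add: k lin_0[OF s(10)] lin_0[OF s(11)])+
        \<comment> \<open>\<open>p w\<close> is a generalised eigenvector for both
          \<open>\<mu>\<close> and \<open>\<nu>\<close>, so it vanishes unless they agree.\<close>
        have "f \<mu> *s p w = f \<nu> *s p w"
        proof (cases "\<mu> = \<nu>")
          case False
          moreover have "gen_eigen T \<mu> (p w)" using s(9)[OF s(12), of w] by (auto simp: gen_eigen_def)
          ultimately have "p w = 0" using gen_eigen_unique[OF T(1)] gp by blast
          then show ?thesis by simp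
        qed simp
        moreover have "y (q w) = f \<nu> *s q w" using y(3)[OF s(13) gq] .
        ultimately have "?y w = f \<nu> *s (p w + q w)" by (simp add: scale_right_distrib)
        then show ?thesis using s(15)[OF w(1)] by simp
      qed
      moreover have "trace U (\<lambda>x. T (?y x)) = (\<Sum>\<nu>\<leftarrow>replicate (dim U0) \<mu> @ L. \<nu> * f \<nu>)"
      proof -
        have l1: "lin (\<lambda>x. f \<mu> *s T (p x))" and l2: "lin (\<lambda>x. T (y (q x)))"
          using l by (auto intro: lin_scaled)
        have m1: "(\<lambda>x. f \<mu> *s T (p x)) ` U \<subseteq> U0" and m2: "(\<lambda>x. T (y (q x))) ` U \<subseteq> U1"
          using inU s(1) by (auto intro!: subspace_scale)
        have "trace U (\<lambda>x. T (?y x)) = trace U (\<lambda>x. f \<mu> *s T (p x) + T (y (q x)))"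
          by (simp add: lin_add[OF T(1)] lin_scale[OF T(1)])
        also have "\<dots> = trace U (\<lambda>x. f \<mu> *s T (p x)) + trace U (\<lambda>x. T (y (q x)))"
          by (rule trace_add[OF U l1 _ l2]) (use m1 m2 s(3,4) in blast)+
        also have "trace U (\<lambda>x. f \<mu> *s T (p x)) = trace U0 (\<lambda>x. f \<mu> *s T (p x))"
          by (rule trace_image[OF U s(1,3) l1 m1])
        \<comment> \<open>On \<open>U0\<close> the operator \<open>T\<close> is \<open>\<mu>\<close>
          plus a nilpotent operator, and the latter has trace 0.\<close>
        also have "\<dots> = trace U0 (\<lambda>x. f \<mu> *s ((T x - \<mu> *s x) + \<mu> *s x))"
        proof (rule trace_cong[OF fd0 l1])
          show "(\<lambda>x. f \<mu> *s T (p x)) ` U0 \<subseteq> U0" using m1 s(3) by blast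
        qed (use T s(14) in \<open>auto intro!: lin_intros\<close>)
        also have "\<dots> = f \<mu> * trace U0 (\<lambda>x. (T x - \<mu> *s x) + \<mu> *s x)"
          by (rule trace_scale[OF fd0]) (use s(7) T in \<open>auto intro!: lin_intros\<close>)
        also have "trace U0 (\<lambda>x. (T x - \<mu> *s x) + \<mu> *s x) = trace U0 ?S + trace U0 (\<lambda>x. \<mu> *s x)"
          by (rule trace_add[OF fd0])
            (use s(1,7) T in \<open>auto intro!: lin_intros subspace_diff subspace_scale\<close>)
        also have "trace U0 ?S = 0"
          by (rule trace_nilpotent[OF fd0 lin_shift[OF T(1)] _ s(9)])
            (use s(1,7) in \<open>auto intro!: subspace_diff subspace_scale\<close>)
        also have "trace U0 (\<lambda>x. \<mu> *s x) = \<mu> * of_nat (dim U0)"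
          using trace_scale[OF fd0 lin_ident, of \<mu>] trace_ident[OF fd0] by simp
        also have "trace U (\<lambda>x. T (y (q x))) = trace U1 (\<lambda>x. T (y (q x)))"
          by (rule trace_image[OF U s(2,4) l2 m2])
        also have "\<dots> = trace U1 (\<lambda>x. T (y x))"
        proof (rule trace_cong[OF fd1 l2])
          show "(\<lambda>x. T (y (q x))) ` U1 \<subseteq> U1" using m2 s(4) by blast
        qed (use l s(18) in auto)
        finally show ?thesis using y(4) by (simp add: sum_list_replicate mult.commute mult.left_commute)
      qed
      ultimately show "\<exists>y. lin y \<and> y ` U \<subseteq> U \<and>
          (\<forall>\<nu> w. w \<in> U \<longrightarrow> gen_eigen T \<nu> w \<longrightarrow> y w = f \<nu> *s w) \<and>
          trace U (\<lambda>x. T (y x)) = (\<Sum>\<nu>\<leftarrow>replicate (dim U0) \<mu> @ L. \<nu> * f \<nu>)"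
        by (intro exI[of _ ?y]) simp
    qed
  qed
qed

end

section \<open>Engel's theorem and Cartan's criterion\<close>

text \<open>A coordinate function for a basis of the field over the rationals that contains
  \<open>a\<close>. Its values lie in an ordered field, where a vanishing sum of squares forces each
  square to vanish.\<close>

lemma rat_linear_functional:
  fixes a :: "'k::field_char_0"
  assumes "a \<noteq> 0"
  obtains g :: "'k \<Rightarrow> rat" where "\<And>x y. g (x + y) = g x + g y"
    "\<And>q x. g (of_rat q * x) = q * g x" "g a = 1"
proof -
  interpret Q: vector_space "\<lambda>q (x::'k). of_rat q * x"
    by unfold_locales (simp_all add: of_rat_add of_rat_mult algebra_simps)
  have "Q.independent {a}" using assms by simp
  then obtain B where B: "{a} \<subseteq> B" "Q.independent B" "UNIV \<subseteq> Q.span B"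
    using Q.maximal_independent_subset_extend[of "{a}" UNIV] by auto
  have s: "x \<in> Q.span B" for x using B(3) by auto
  show ?thesis
  proof (rule that[of "\<lambda>x. Q.representation B x a"])
    show "Q.representation B (x + y) a = Q.representation B x a + Q.representation B y a" for x y
      using Q.representation_add[OF B(2) s s] by simp
    show "Q.representation B (of_rat q * x) a = q * Q.representation B x a" for q x
      using Q.representation_scale[OF B(2) s] by simp
    show "Q.representation B a a = 1" using Q.representation_basis[OF B(2), of a] B(1) by simp
  qed
qed

text \<open>The identities hold on the whole ambient type, which spares membership conditions. A
  bracket given on a carrier is first composed with a projection onto it, as in
  \<open>levi_hom\<close>.\<close>

locale lie_space = alg_closed_space scale
  for scale :: "'k::{alg_closed_field, field_char_0} \<Rightarrow> 'v::ab_group_add \<Rightarrow> 'v" (infixr \<open>*s\<close> 75) +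
  fixes lb :: "'v \<Rightarrow> 'v \<Rightarrow> 'v"
  assumes lin_lb_right: "lin (lb x)"
    and lin_lb_left: "lin (\<lambda>x. lb x y)"
    and lb_skew: "lb x y = - lb y x"
    and jacobi: "lb x (lb y z) = lb (lb x y) z + lb y (lb x z)"
begin

lemma lb_add_right: "lb x (y + z) = lb x y + lb x z"
  and lb_diff_right: "lb x (y - z) = lb x y - lb x z"
  and lb_minus_right: "lb x (- y) = - lb x y"
  and lb_scale_right: "lb x (c *s y) = c *s lb x y"
  and lb_zero_right: "lb x 0 = 0"
  and lb_sum_right: "lb x (sum F A) = (\<Sum>i\<in>A. lb x (F i))"
  using lin_add[OF lin_lb_right] lin_diff[OF lin_lb_right] lin_neg[OF lin_lb_right]
    lin_scale[OF lin_lb_right] lin_0[OF lin_lb_right] lin_sum[OF lin_lb_right] by auto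

lemma lb_add_left: "lb (x + y) z = lb x z + lb y z"
  and lb_diff_left: "lb (x - y) z = lb x z - lb y z"
  and lb_minus_left: "lb (- x) z = - lb x z"
  and lb_scale_left: "lb (c *s x) z = c *s lb x z"
  and lb_zero_left: "lb 0 z = 0"
  using lin_add[OF lin_lb_left] lin_diff[OF lin_lb_left] lin_neg[OF lin_lb_left]
    lin_scale[OF lin_lb_left] lin_0[OF lin_lb_left] by auto

lemmas lb_simps = lb_add_right lb_diff_right lb_minus_right lb_scale_right lb_zero_right
  lb_add_left lb_diff_left lb_minus_left lb_scale_left lb_zero_left

lemma lb_self: "lb x x = 0"
proof -
  have "lb x x + lb x x = 0" using lb_skew[of x x] by (simp add: eq_neg_iff_add_eq_0)
  then have "2 *s lb x x = 0" using scale_left_distrib[of 1 1 "lb x x"] by simp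
  then show ?thesis by simp
qed

lemma lb_lb_left: "lb (lb x y) z = lb x (lb y z) - lb y (lb x z)"
  using jacobi[of x y z] by simp

section \<open>Modules and Engel's theorem\<close>

definition subalg :: "'v set \<Rightarrow> bool"
  where "subalg h \<longleftrightarrow> fd h \<and> (\<forall>x\<in>h. \<forall>y\<in>h. lb x y \<in> h)"

text \<open>Modules over \<open>h\<close> are subspaces of the ambient algebra on which
  \<open>h\<close> acts by the bracket; all representations that occur are of this kind.\<close>

definition stable :: "'v set \<Rightarrow> 'v set \<Rightarrow> bool"
  where "stable h W \<longleftrightarrow> subspace W \<and> (\<forall>x\<in>h. \<forall>w\<in>W. lb x w \<in> W)"

lemma stableD: "stable h W \<Longrightarrow> x \<in> h \<Longrightarrow> w \<in> W \<Longrightarrow> lb x w \<in> W"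
  by (simp add: stable_def)

lemma stable_subspace: "stable h W \<Longrightarrow> subspace W"
  by (simp add: stable_def)

lemma subalg_fd: "subalg h \<Longrightarrow> fd h"
  by (simp add: subalg_def)

lemma subalg_subspace: "subalg h \<Longrightarrow> subspace h"
  by (simp add: subalg_def fd_def)

text \<open>Every nonzero quotient module \<open>W / U\<close> contains a nonzero vector killed by
  \<open>K\<close>. Quantifying over \<open>U\<close> expresses this without forming
  quotients.\<close>

definition engel :: "'v set \<Rightarrow> 'v set \<Rightarrow> bool"
  where "engel W K \<longleftrightarrow> (\<forall>U. stable K U \<longrightarrow> U \<subseteq> W \<longrightarrow> U \<noteq> W \<longrightarrow>
    (\<exists>v\<in>W. v \<notin> U \<and> (\<forall>x\<in>K. lb x v \<in> U)))"

text \<open>The preimage in \<open>W\<close> of the vectors of \<open>W / U\<close> killed by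
  \<open>K\<close>. Iterated from \<open>{0}\<close>, it gives a filtration along which
  \<open>K\<close> acts strictly triangularly.\<close>

definition up :: "'v set \<Rightarrow> 'v set \<Rightarrow> 'v set \<Rightarrow> 'v set"
  where "up W K U = {v \<in> W. \<forall>x\<in>K. lb x v \<in> U}"

lemma up_stable:
  assumes "stable K W" "stable K U" "U \<subseteq> W"
  shows "stable K (up W K U)" "U \<subseteq> up W K U" "up W K U \<subseteq> W"
proof -
  have "subspace W" "subspace U" using assms stable_subspace by auto
  then have "subspace (up W K U)"
    by (auto simp: subspace_def up_def lb_simps)
  then show "stable K (up W K U)"
    using assms by (auto simp: stable_def up_def)
  show "U \<subseteq> up W K U" "up W K U \<subseteq> W" using assms by (auto simp: stable_def up_def)
qed

lemma stable_zero: "stable K {0}"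
  by (auto simp: stable_def lb_simps)

lemma up_chain:
  assumes "stable K W"
  shows "stable K ((up W K ^^ i) {0}) \<and> (up W K ^^ i) {0} \<subseteq> W"
proof (induction i)
  case 0
  show ?case using stable_zero subspace_0[OF stable_subspace[OF assms]] by simp
next
  case (Suc i)
  then show ?case using up_stable[OF assms] by simp
qed

lemma engel_chain:
  assumes W: "fd W" "stable K W" and e: "engel W K"
  obtains m where "(up W K ^^ m) {0} = W"
proof -
  let ?U = "\<lambda>i. (up W K ^^ i) {0}"
  note ch = up_chain[OF W(2)]
  have grow: "?U i = W \<or> dim (?U i) < dim (?U (Suc i))" for i
  proof (cases "?U i = W")
    case False
    then obtain v where v: "v \<in> W" "v \<notin> ?U i" "\<forall>x\<in>K. lb x v \<in> ?U i"
      using e ch[of i] unfolding engel_def by blast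
    then have "v \<in> ?U (Suc i)" by (simp add: up_def)
    then have "?U i \<noteq> ?U (Suc i)" using v(2) by blast
    moreover have "?U i \<subseteq> ?U (Suc i)" using up_stable(2)[OF W(2)] ch[of i] by simp
    moreover have "fd (?U (Suc i))"
      using fd_subset[OF W(1)] ch[of "Suc i"] stable_subspace by blast
    ultimately show ?thesis using fd_dim_less ch[of i] stable_subspace by blast
  qed simp
  have "\<exists>m. ?U m = W"
  proof (rule ccontr)
    assume no: "\<nexists>m. ?U m = W"
    have "i \<le> dim (?U i)" for i
    proof (induction i)
      case (Suc i)
      have "dim (?U i) < dim (?U (Suc i))" using grow[of i] no by blast
      then show ?case using Suc by linarith
    qed simp
    from this[of "Suc (dim W)"] show False
      using fd_dim_mono[OF W(1)] ch[of "Suc (dim W)"] stable_subspace by fastforce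
  qed
  then show ?thesis using that by blast
qed

text \<open>Since \<open>z\<close> normalises \<open>K\<close>, it preserves the space of vectors
  that \<open>K\<close> maps into \<open>U\<close>. Among the iterates of \<open>z\<close> on such a
  vector outside \<open>U\<close>, the last one outside \<open>U\<close> is mapped into
  \<open>U\<close> by both \<open>K\<close> and \<open>z\<close>.\<close>

lemma engel_extend:
  assumes W: "fd W" "stable h W" and K: "subspace K" "K \<subseteq> h" "engel W K"
    and z: "z \<in> h" "\<And>y. y \<in> K \<Longrightarrow> lb y z \<in> K"
    and nil: "\<And>w. w \<in> W \<Longrightarrow> (lb z ^^ n) w = 0"
  shows "engel W (span (insert z K))"
  unfolding engel_def
proof (intro allI impI)
  have spK: "span K = K" using K(1) by (rule span_eq_iff[THEN iffD2])
  fix U assume U: "stable (span (insert z K)) U" "U \<subseteq> W" "U \<noteq> W"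
  have sub: "K \<subseteq> span (insert z K)" "z \<in> span (insert z K)"
    using span_base[of _ "insert z K"] by auto
  have UK: "stable K U" using U(1) sub by (auto simp: stable_def)
  let ?X = "up W K U"
  have zX: "lb z v \<in> ?X" if v: "v \<in> ?X" for v
  proof -
    have "lb y (lb z v) \<in> U" if y: "y \<in> K" for y
    proof -
      have "lb (lb y z) v \<in> U" using v z(2)[OF y] by (simp add: up_def)
      moreover have "lb z (lb y v) \<in> U" using v y U(1) sub by (auto simp: up_def stable_def)
      ultimately show ?thesis
        using jacobi[of y z v] subspace_add[OF stable_subspace[OF U(1)]] by simp
    qed
    moreover have "lb z v \<in> W" using v W z by (auto simp: up_def stable_def)
    ultimately show ?thesis by (simp add: up_def)
  qed
  obtain v where v: "v \<in> W" "v \<notin> U" "\<forall>x\<in>K. lb x v \<in> U"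
    using K(3) UK U(2,3) unfolding engel_def by blast
  have vX: "(lb z ^^ k) v \<in> ?X" for k
    by (rule funpow_invariant[OF zX]) (use v in \<open>auto simp: up_def\<close>)
  define k where "k = (LEAST k. (lb z ^^ k) v \<in> U)"
  have "(lb z ^^ n) v \<in> U" using nil[OF v(1)] subspace_0[OF stable_subspace[OF U(1)]] by simp
  then have k: "(lb z ^^ k) v \<in> U" unfolding k_def by (rule LeastI)
  have "k \<noteq> 0" using k v(2) by (metis funpow_0)
  then obtain j where j: "k = Suc j" by (metis not0_implies_Suc)
  have nj: "(lb z ^^ j) v \<notin> U"
    using not_less_Least[of j "\<lambda>k. (lb z ^^ k) v \<in> U"] j unfolding k_def by simp
  let ?v = "(lb z ^^ j) v"
  have "lb x ?v \<in> U" if "x \<in> span (insert z K)" for x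
  proof -
    obtain c where c: "x - c *s z \<in> K" using \<open>x \<in> span (insert z K)\<close> spK by (auto simp: span_insert)
    have "lb (x - c *s z) ?v \<in> U" using vX[of j] c by (simp add: up_def)
    moreover have "c *s lb z ?v \<in> U"
      using k j subspace_scale[OF stable_subspace[OF U(1)]] by simp
    ultimately have "lb (x - c *s z) ?v + c *s lb z ?v \<in> U"
      using subspace_add[OF stable_subspace[OF U(1)]] by blast
    then show ?thesis by (simp add: lb_simps)
  qed
  then show "\<exists>v\<in>W. v \<notin> U \<and> (\<forall>x\<in>span (insert z K). lb x v \<in> U)"
    using nj vX[of j] by (auto simp: up_def)
qed

text \<open>The filtration of \<open>W\<close> induces a decreasing filtration \<open>G\<close> on
  \<open>h\<close>, and bracketing with \<open>K\<close> moves one step down in it. The last member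
  not contained in \<open>K\<close> supplies \<open>z\<close>.\<close>

lemma engel_normalizer:
  assumes h: "subalg h" and W: "fd W" "stable h W" and K: "K \<subseteq> h" "engel W K" "K \<noteq> h"
    and ker: "\<And>x. x \<in> h \<Longrightarrow> (\<And>w. w \<in> W \<Longrightarrow> lb x w = 0) \<Longrightarrow> x \<in> K"
  obtains z where "z \<in> h" "z \<notin> K" "\<And>y. y \<in> K \<Longrightarrow> lb y z \<in> K"
proof -
  have WK: "stable K W" using W K by (auto simp: stable_def)
  obtain m where m: "(up W K ^^ m) {0} = W" using engel_chain[OF W(1) WK K(2)] .
  define U where "U i = (up W K ^^ i) {0}" for i
  have U0: "U 0 = {0}" by (simp add: U_def)
  have Us: "stable K (U i)" "U i \<subseteq> W" for i using up_chain[OF WK] by (auto simp: U_def)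
  have down: "lb y u \<in> U (i - 1)" if "y \<in> K" "u \<in> U i" for y u i
  proof (cases i)
    case 0
    then show ?thesis using that by (simp add: U0 lb_simps)
  next
    case (Suc j)
    then show ?thesis using that by (simp add: U_def up_def)
  qed
  have Uup: "U i \<subseteq> U (Suc i)" for i using up_stable(2)[OF WK Us] by (simp add: U_def)
  have UW: "U (m + i) = W" for i
  proof (induction i)
    case 0
    show ?case using m by (simp add: U_def)
  next
    case (Suc i)
    then show ?case using Uup[of "m + i"] Us(2)[of "Suc (m + i)"] by auto
  qed
  \<comment> \<open>\<open>G i\<close> consists of the elements lowering the filtration of
    \<open>W\<close> by \<open>i - m\<close> steps. The offset \<open>m\<close> makes
    \<open>G 0\<close> all of \<open>h\<close>, while \<open>G (2 * m)\<close> acts by zero on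
    \<open>W = U m\<close>.\<close>
  define G where "G i = {x \<in> h. \<forall>j. \<forall>u\<in>U j. lb x u \<in> U (j + m - i)}" for i
  have G0: "G 0 = h"
  proof -
    have "lb x u \<in> U (j + m - 0)" if "x \<in> h" "u \<in> U j" for x u j
    proof -
      have "lb x u \<in> W" using W(2) that Us(2)[of j] by (auto simp: stable_def)
      then show ?thesis using UW[of j] by (simp add: add.commute)
    qed
    then show ?thesis unfolding G_def by blast
  qed
  have step: "lb y x \<in> G (Suc i)" if y: "y \<in> K" and x: "x \<in> G i" for x y i
  proof -
    have "lb (lb y x) u \<in> U (j + m - Suc i)" if u: "u \<in> U j" for j u
    proof (cases j)
      case 0
      then show ?thesis
        using u subspace_0[OF stable_subspace[OF Us(1)]] by (simp add: U0 lb_simps)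
    next
      case (Suc l)
      have "lb x u \<in> U (j + m - i)" using x u by (simp add: G_def)
      from down[OF y this] have 1: "lb y (lb x u) \<in> U (j + m - Suc i)" by simp
      have "lb y u \<in> U l" using down[OF y u] Suc by simp
      then have "lb x (lb y u) \<in> U (l + m - i)" using x by (simp add: G_def)
      then have 2: "lb x (lb y u) \<in> U (j + m - Suc i)" using Suc by simp
      show ?thesis
        unfolding lb_lb_left using 1 2 subspace_diff[OF stable_subspace[OF Us(1)]] by blast
    qed
    moreover have "lb y x \<in> h" using y x K(1) h by (auto simp: G_def subalg_def)
    ultimately show ?thesis by (simp add: G_def)
  qed
  have "G (2 * m) \<subseteq> K"
  proof
    fix x assume x: "x \<in> G (2 * m)"
    show "x \<in> K"
    proof (rule ker)
      show "x \<in> h" using x by (simp add: G_def)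
      fix w assume "w \<in> W"
      then have "w \<in> U m" using UW[of 0] by simp
      then have "lb x w \<in> U (m + m - 2 * m)" using x unfolding G_def by blast
      then show "lb x w = 0" by (simp add: U0 mult_2)
    qed
  qed
  then have ex: "\<exists>i. G i \<subseteq> K" by blast
  define i where "i = (LEAST i. G i \<subseteq> K)"
  have i: "G i \<subseteq> K" unfolding i_def using ex by (rule LeastI_ex)
  have "i \<noteq> 0" using i G0 K by (metis subset_antisym)
  then obtain j where j: "i = Suc j" by (metis not0_implies_Suc)
  have "\<not> G j \<subseteq> K" using not_less_Least[of j "\<lambda>i. G i \<subseteq> K"] j unfolding i_def by simp
  then obtain z where z: "z \<in> G j" "z \<notin> K" by blast
  show ?thesis
  proof (rule that[of z])
    show "z \<in> h" using z by (simp add: G_def)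
    show "z \<notin> K" by (rule z)
    show "lb y z \<in> K" if "y \<in> K" for y using step[OF that z(1)] i j by blast
  qed
qed

text \<open>A subalgebra \<open>K\<close> of largest dimension with the Engel property is all of
  \<open>h\<close>, since otherwise \<open>engel_normalizer\<close> and \<open>engel_extend\<close>
  enlarge it. The competing subalgebras contain the kernel \<open>K0\<close> of the action because
  nilpotency is known on \<open>W\<close> only, not for the adjoint action on
  \<open>h\<close>.\<close>

lemma engel_theorem:
  assumes h: "subalg h" and W: "fd W" "stable h W"
    and nil: "\<And>x. x \<in> h \<Longrightarrow> \<exists>n. \<forall>w\<in>W. (lb x ^^ n) w = 0"
  shows "engel W h"
proof -
  define K0 where "K0 = {x \<in> h. \<forall>w\<in>W. lb x w = 0}"
  define P where "P K \<longleftrightarrow> subspace K \<and> K0 \<subseteq> K \<and> K \<subseteq> h \<and> engel W K \<and> (\<forall>x\<in>K. \<forall>y\<in>K. lb x y \<in> K)" for K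
  note sh = subalg_subspace[OF h]
  have "P K0"
  proof -
    have "subspace K0" using sh by (auto simp: subspace_def K0_def lb_simps)
    moreover have "engel W K0"
      unfolding engel_def
    proof (intro allI impI)
      fix U assume U: "stable K0 U" "U \<subseteq> W" "U \<noteq> W"
      then obtain v where "v \<in> W" "v \<notin> U" by blast
      then show "\<exists>v\<in>W. v \<notin> U \<and> (\<forall>x\<in>K0. lb x v \<in> U)"
        using subspace_0[OF stable_subspace[OF U(1)]] by (intro bexI[of _ v]) (auto simp: K0_def)
    qed
    moreover have "lb x y \<in> K0" if "x \<in> K0" "y \<in> K0" for x y
      using that W(2) h by (auto simp: K0_def stable_def subalg_def lb_lb_left lb_simps)
    ultimately show ?thesis by (auto simp: P_def K0_def)
  qed
  moreover have bound: "\<forall>K. P K \<longrightarrow> dim K < Suc (dim h)"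
    using fd_dim_mono[OF subalg_fd[OF h]] by (auto simp: P_def less_Suc_eq_le)
  ultimately obtain K where K: "P K" "\<And>K'. P K' \<Longrightarrow> dim K' \<le> dim K"
    using ex_has_greatest_nat[of P K0 dim "Suc (dim h)"] by auto
  have "K = h"
  proof (rule ccontr)
    assume ne: "K \<noteq> h"
    have KP: "subspace K" "K0 \<subseteq> K" "K \<subseteq> h" "engel W K" "\<And>x y. x \<in> K \<Longrightarrow> y \<in> K \<Longrightarrow> lb x y \<in> K"
      using K(1) unfolding P_def by auto
    have ker: "x \<in> K" if "x \<in> h" "\<And>w. w \<in> W \<Longrightarrow> lb x w = 0" for x
      using that KP(2) by (auto simp: K0_def)
    obtain z where z: "z \<in> h" "z \<notin> K" "\<And>y. y \<in> K \<Longrightarrow> lb y z \<in> K"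
      by (rule engel_normalizer[OF h W KP(3,4) ne]) (erule ker, simp, rule that)
    obtain n where n: "\<forall>w\<in>W. (lb z ^^ n) w = 0" using nil[OF z(1)] ..
    let ?K = "span (insert z K)"
    have spK: "span K = K" using KP(1) by (rule span_eq_iff[THEN iffD2])
    have sub: "K \<subseteq> ?K" "z \<in> ?K" using span_base[of _ "insert z K"] by auto
    have subh: "?K \<subseteq> h" by (rule span_minimal) (use z KP sh in auto)
    have "engel W ?K" using n by (intro engel_extend[OF W KP(1,3,4) z(1,3)]) auto
    moreover have "lb x y \<in> ?K" if x: "x \<in> ?K" and y: "y \<in> ?K" for x y
    proof -
      obtain c d where cd: "x - c *s z \<in> K" "y - d *s z \<in> K"
        using x y spK by (auto simp: span_insert)
      have "lb (x - c *s z) (y - d *s z) + d *s lb (x - c *s z) z - c *s lb (y - d *s z) z \<in> K"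
        using KP cd z(3) by (intro subspace_diff subspace_add subspace_scale) auto
      also have "lb (x - c *s z) (y - d *s z) + d *s lb (x - c *s z) z - c *s lb (y - d *s z) z
          = lb x y"
        using lb_skew[of z y] by (simp add: lb_simps lb_self algebra_simps)
      finally show ?thesis using sub by blast
    qed
    ultimately have "P ?K" using KP(2) sub subh by (auto simp: P_def subspace_span)
    then have "dim ?K \<le> dim K" using K(2) by blast
    then have "K = ?K" using fd_dim_eq[OF _ KP(1) sub(1)] fd_subset[OF subalg_fd[OF h] subspace_span subh] by blast
    then show False using z(2) sub(2) by blast
  qed
  then show ?thesis using K(1) by (simp add: P_def)
qed

section \<open>Perfect actions and Cartan's criterion\<close>

definition derived :: "'v set \<Rightarrow> 'v set"
  where "derived h = span {lb x y |x y. x \<in> h \<and> y \<in> h}"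

text \<open>The image of \<open>h\<close> in the endomorphisms of \<open>W\<close> is perfect,
  although \<open>h\<close> itself may not be. This is what a maximal ideal with nonabelian quotient
  provides when it acts on \<open>W\<close> by zero.\<close>

definition perfect_on :: "'v set \<Rightarrow> 'v set \<Rightarrow> bool"
  where "perfect_on W h \<longleftrightarrow> (\<forall>x\<in>h. \<exists>x'\<in>derived h. \<forall>w\<in>W. lb x w = lb x' w)"

lemma derived_subset: "subalg h \<Longrightarrow> derived h \<subseteq> h"
  unfolding derived_def using subalg_subspace by (intro span_minimal) (auto simp: subalg_def)

text \<open>Induction along the Engel filtration: elements of \<open>h\<close> map the next layer
  into one on which \<open>h\<close> acts by zero, so commutators kill that layer, and on
  \<open>W\<close> every element acts as a sum of commutators.\<close>

lemma engel_perfect_trivial: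
  assumes W: "fd W" "stable h W" and e: "engel W h" and p: "perfect_on W h"
    and x: "x \<in> h" "w \<in> W"
  shows "lb x w = 0"
proof -
  obtain m where m: "(up W h ^^ m) {0} = W" using engel_chain[OF W e] .
  have "\<forall>x\<in>h. \<forall>u\<in>(up W h ^^ i) {0}. lb x u = 0" for i
  proof (induction i)
    case 0
    show ?case by (simp add: lb_simps)
  next
    case (Suc i)
    show ?case
    proof (intro ballI)
      fix x u assume x: "x \<in> h" and "u \<in> (up W h ^^ Suc i) {0}"
      then have u: "u \<in> W" "\<And>y. y \<in> h \<Longrightarrow> lb y u \<in> (up W h ^^ i) {0}" by (simp_all add: up_def)
      obtain x' where x': "x' \<in> derived h" "lb x u = lb x' u"
        using p x u(1) unfolding perfect_on_def by blast
      have "lb x' u = 0"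
        using x'(1) unfolding derived_def
      proof (induction rule: span_induct_alt)
        case base
        show ?case by (simp add: lb_simps)
      next
        case (step c a y)
        then obtain p q where "a = lb p q" "p \<in> h" "q \<in> h" by blast
        then have "lb a u = 0" using Suc u(2) by (simp add: lb_lb_left)
        then show ?case using step by (simp add: lb_simps)
      qed
      then show "lb x u = 0" using x' by simp
    qed
  qed
  then show ?thesis using m x by blast
qed

text \<open>The shifts of \<open>lb x\<close> by \<open>\<nu>\<close>, \<open>\<mu>\<close> and
  \<open>\<mu> + \<nu>\<close> satisfy a Leibniz rule. If the powers \<open>k\<close> and
  \<open>l\<close> of the first two kill \<open>b\<close> and \<open>w\<close>, the power
  \<open>k + l\<close> of the third kills \<open>lb b w\<close>.\<close>

lemma gen_eigen_lb:
  assumes "gen_eigen (lb x) \<nu> b" "gen_eigen (lb x) \<mu> w"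
  shows "gen_eigen (lb x) (\<mu> + \<nu>) (lb b w)"
proof -
  let ?D = "\<lambda>\<mu> z. lb x z - \<mu> *s z"
  have leib: "?D (\<mu> + \<nu>) (lb b w) = lb (?D \<nu> b) w + lb b (?D \<mu> w)" for b w
    using jacobi[of x b w] by (simp add: lb_simps scale_left_distrib algebra_simps)
  have D: "lin (?D (\<mu> + \<nu>) ^^ n)" for n by (rule lin_funpow[OF lin_shift[OF lin_lb_right]])
  have "\<forall>b w. (?D \<nu> ^^ k) b = 0 \<longrightarrow> (?D \<mu> ^^ l) w = 0 \<longrightarrow> (?D (\<mu> + \<nu>) ^^ (k + l)) (lb b w) = 0" for k l
  proof (induction "k + l" arbitrary: k l)
    case 0
    then show ?case by (simp add: lb_simps)
  next
    case (Suc n)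
    show ?case
    proof (intro allI impI)
      fix b w assume bw: "(?D \<nu> ^^ k) b = 0" "(?D \<mu> ^^ l) w = 0"
      have 1: "(?D (\<mu> + \<nu>) ^^ n) (lb (?D \<nu> b) w) = 0"
      proof (cases k)
        case 0
        then have "b = 0" using bw by simp
        then show ?thesis using lin_0[OF D] by (simp add: lb_simps)
      next
        case (Suc k')
        then have n: "n = k' + l" using Suc.hyps(2) by simp
        have "(?D \<nu> ^^ k') (?D \<nu> b) = 0" using bw(1) Suc by (simp only: funpow_Suc_right o_def)
        then show ?thesis using Suc.hyps(1)[OF n] bw(2) n by blast
      qed
      have 2: "(?D (\<mu> + \<nu>) ^^ n) (lb b (?D \<mu> w)) = 0"
      proof (cases l)
        case 0
        then have "w = 0" using bw by simp
        then show ?thesis using lin_0[OF D] by (simp add: lb_simps)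
      next
        case (Suc l')
        then have n: "n = k + l'" using Suc.hyps(2) by simp
        have "(?D \<mu> ^^ l') (?D \<mu> w) = 0" using bw(2) Suc by (simp only: funpow_Suc_right o_def)
        then show ?thesis using Suc.hyps(1)[OF n] bw(1) n by blast
      qed
      have "(?D (\<mu> + \<nu>) ^^ (k + l)) (lb b w) = (?D (\<mu> + \<nu>) ^^ n) (?D (\<mu> + \<nu>) (lb b w))"
        using Suc.hyps(2)[symmetric] by (simp only: funpow_Suc_right o_def)
      also have "\<dots> = 0" unfolding leib lin_add[OF D] 1 2 by simp
      finally show "(?D (\<mu> + \<nu>) ^^ (k + l)) (lb b w) = 0" .
    qed
  qed
  then show ?thesis using assms unfolding gen_eigen_def by blast
qed

definition tform :: "'v set \<Rightarrow> 'v \<Rightarrow> 'v \<Rightarrow> 'k"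
  where "tform W x y = trace W (\<lambda>w. lb x (lb y w))"

text \<open>If \<open>b\<close> is a generalised eigenvector for \<open>\<nu>\<close>, the
  commutator of \<open>y\<close> with \<open>lb b\<close> is \<open>f \<nu>\<close> times
  \<open>lb b\<close>, because \<open>f (\<mu> + \<nu>) - f \<mu> = f \<nu>\<close>. Such
  \<open>b\<close> span \<open>h\<close>. So \<open>y\<close> normalises the image of
  \<open>h\<close> in the endomorphisms of \<open>W\<close>, even if it does not belong to
  it.\<close>

lemma ad_semisimple:
  assumes h: "subalg h" and W: "fd W" "stable h W" and x: "x \<in> h"
    and f: "\<And>\<mu> \<nu>. f (\<mu> + \<nu>) = f \<mu> + f \<nu>"
    and y: "lin y" "\<And>\<mu> w. w \<in> W \<Longrightarrow> gen_eigen (lb x) \<mu> w \<Longrightarrow> y w = f \<mu> *s w"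
    and b: "b \<in> h"
  shows "\<exists>b'\<in>h. \<forall>w\<in>W. y (lb b w) - lb b (y w) = lb b' w"
proof -
  have sh: "lb x ` h \<subseteq> h" using h x by (auto simp: subalg_def)
  have sW: "lb x ` W \<subseteq> W" using W x by (auto simp: stable_def)
  have "b \<in> span {b \<in> h. \<exists>\<nu>. gen_eigen (lb x) \<nu> b}"
    using span_gen_eigen[OF subalg_fd[OF h] lin_lb_right sh] b by blast
  then show ?thesis
  proof (induction rule: span_induct_alt)
    case base
    show ?case
      by (rule bexI[of _ 0]) (use subspace_0[OF subalg_subspace[OF h]] in \<open>auto simp: lb_simps lin_0[OF y(1)]\<close>)
  next
    case (step c b a)
    then obtain \<nu> where \<nu>: "b \<in> h" "gen_eigen (lb x) \<nu> b" by blast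
    obtain a' where a': "a' \<in> h" "\<And>w. w \<in> W \<Longrightarrow> y (lb a w) - lb a (y w) = lb a' w"
      using step.IH by blast
    have bw: "y (lb b w) - lb b (y w) = f \<nu> *s lb b w" if w: "w \<in> W" for w
    proof -
      have "w \<in> span {w \<in> W. \<exists>\<mu>. gen_eigen (lb x) \<mu> w}"
        using span_gen_eigen[OF W(1) lin_lb_right sW] w by blast
      then show ?thesis
      proof (induction rule: span_induct_alt)
        case base
        show ?case by (simp add: lb_simps lin_0[OF y(1)])
      next
        case (step c w v)
        then obtain \<mu> where \<mu>: "w \<in> W" "gen_eigen (lb x) \<mu> w" by blast
        have "y (lb b w) = f (\<mu> + \<nu>) *s lb b w"
          by (rule y(2)[OF stableD[OF W(2) \<nu>(1) \<mu>(1)] gen_eigen_lb[OF \<nu>(2) \<mu>(2)]])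
        moreover have "y w = f \<mu> *s w" by (rule y(2)[OF \<mu>])
        ultimately have "y (lb b w) - lb b (y w) = f \<nu> *s lb b w"
          by (simp add: f lb_simps scale_left_distrib)
        then have "c *s (y (lb b w) - lb b (y w)) + (y (lb b v) - lb b (y v))
            = c *s (f \<nu> *s lb b w) + f \<nu> *s lb b v" using step.IH by simp
        then show ?case
          by (simp add: lb_simps lin_add[OF y(1)] lin_scale[OF y(1)] algebra_simps)
      qed
    qed
    have "y (lb (c *s b + a) w) - lb (c *s b + a) (y w) = lb (c *s (f \<nu> *s b) + a') w" if w: "w \<in> W" for w
    proof -
      have "c *s (y (lb b w) - lb b (y w)) + (y (lb a w) - lb a (y w)) = c *s (f \<nu> *s lb b w) + lb a' w"
        using bw[OF w] a'(2)[OF w] by simp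
      then show ?thesis
        by (simp add: lb_simps lin_add[OF y(1)] lin_scale[OF y(1)] algebra_simps)
    qed
    moreover have "c *s (f \<nu> *s b) + a' \<in> h"
      by (intro subspace_add[OF subalg_subspace[OF h]] subspace_scale[OF subalg_subspace[OF h]] a' \<nu>)
    ultimately show ?case by (intro bexI[of _ "c *s (f \<nu> *s b) + a'"] ballI)
  qed
qed

lemma lb_image: "stable h W \<Longrightarrow> x \<in> h \<Longrightarrow> lb x ` W \<subseteq> W"
  by (auto simp: stable_def)

text \<open>Cartan's criterion.  If an eigenvalue of \<open>ad x\<close> were nonzero, apply a rational linear
  functional to the eigenvalues: the resulting operator \<open>y\<close> pairs to zero with \<open>ad x\<close>, although the
  functional maps the trace of the product to a sum of squares.\<close>

lemma cartan_criterion: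
  assumes h: "subalg h" and W: "fd W" "stable h W" and p: "perfect_on W h"
    and tf: "\<And>x y. x \<in> h \<Longrightarrow> y \<in> h \<Longrightarrow> tform W x y = 0"
    and x: "x \<in> h" "w \<in> W"
  shows "lb x w = 0"
proof -
  have nilD: "\<exists>n. \<forall>w\<in>W. (lb x ^^ n) w = 0" if x: "x \<in> derived h" for x
  proof -
    have xh: "x \<in> h" using x derived_subset[OF h] by blast
    obtain L where L: "set L \<subseteq> {0} \<longrightarrow> (\<exists>n. \<forall>w\<in>W. (lb x ^^ n) w = 0)"
      "\<And>f. \<exists>y. lin y \<and> y ` W \<subseteq> W \<and> (\<forall>\<mu> w. w \<in> W \<longrightarrow> gen_eigen (lb x) \<mu> w \<longrightarrow> y w = f \<mu> *s w) \<and>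
        trace W (\<lambda>w. lb x (y w)) = (\<Sum>\<mu>\<leftarrow>L. \<mu> * f \<mu>)"
      using semisimple_calculus[OF W(1) lin_lb_right lb_image[OF W(2) xh]] by blast
    have "set L \<subseteq> {0}"
    proof
      fix a assume a: "a \<in> set L"
      show "a \<in> {0}"
      proof (rule ccontr)
        assume "a \<notin> {0}"
        then have "a \<noteq> 0" by simp
        then obtain g :: "'k \<Rightarrow> rat" where g: "\<And>x y. g (x + y) = g x + g y"
          "\<And>q x. g (of_rat q * x) = q * g x" "g a = 1"
          by (rule rat_linear_functional) (rule that)
        let ?f = "\<lambda>\<mu>. of_rat (g \<mu>) :: 'k"
        obtain y where y: "lin y \<and> y ` W \<subseteq> W \<and> (\<forall>\<mu> w. w \<in> W \<longrightarrow> gen_eigen (lb x) \<mu> w \<longrightarrow> y w = ?f \<mu> *s w) \<and>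
          trace W (\<lambda>w. lb x (y w)) = (\<Sum>\<mu>\<leftarrow>L. \<mu> * ?f \<mu>)"
          using L(2)[of ?f] ..
        then have ly: "lin y" "y ` W \<subseteq> W" and yg: "\<And>\<mu> w. w \<in> W \<Longrightarrow> gen_eigen (lb x) \<mu> w \<Longrightarrow> y w = ?f \<mu> *s w"
          and trE: "trace W (\<lambda>w. lb x (y w)) = (\<Sum>\<mu>\<leftarrow>L. \<mu> * ?f \<mu>)" by simp_all
        have lin2: "lin (\<lambda>w. lb u (y w))" "(\<lambda>w. lb u (y w)) ` W \<subseteq> W" if "u \<in> h" for u
          using lin_compose[OF lin_lb_right ly(1)] image_comp_subset[OF lb_image[OF W(2) that] ly(2)] by auto
        \<comment> \<open>For \<open>u = lb a b\<close>, the trace of \<open>[a, b] y\<close> is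
          that of \<open>a [b, y]\<close>. The commutator \<open>[b, y]\<close> acts as the element
          \<open>- b'\<close> of \<open>h\<close>, so the trace is a value of the trace
          form.\<close>
        have main: "u \<in> h \<and> trace W (\<lambda>w. lb u (y w)) = 0" if u: "u \<in> derived h" for u
          using u unfolding derived_def
        proof (induction rule: span_induct_alt)
          case base
          have "trace W (\<lambda>w. lb 0 (y w)) = 0" by (rule trace_zero[OF W(1)]) (simp add: lb_simps)
          then show ?case using subspace_0[OF subalg_subspace[OF h]] by blast
        next
          case (step c u v)
          then obtain a b where ab: "u = lb a b" "a \<in> h" "b \<in> h" by blast
          have uh: "u \<in> h" using ab h by (simp add: subalg_def)
          have vh: "v \<in> h" using step.IH by blast
          have cuv: "c *s u + v \<in> h"
            by (intro subspace_add[OF subalg_subspace[OF h]] subspace_scale[OF subalg_subspace[OF h]] uh vh)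
          obtain b' where b': "b' \<in> h" "\<And>w. w \<in> W \<Longrightarrow> y (lb b w) - lb b (y w) = lb b' w"
            using ad_semisimple[where f = ?f, OF h W xh _ ly(1) yg ab(3)] by (auto simp: g(1) of_rat_add)
          have yb: "lin (\<lambda>w. y (lb b w))" "(\<lambda>w. y (lb b w)) ` W \<subseteq> W"
            using lin_compose[OF ly(1) lin_lb_right] image_comp_subset[OF ly(2) lb_image[OF W(2) ab(3)]] by auto
          have "trace W (\<lambda>w. lb u (y w)) = trace W (\<lambda>w. lb a (lb b (y w)) - lb b (lb a (y w)))"
            by (simp add: ab lb_lb_left)
          also have "\<dots> = trace W (\<lambda>w. lb a (lb b (y w))) - trace W (\<lambda>w. lb b (lb a (y w)))"
            by (rule trace_diff[OF W(1) lin_compose[OF lin_lb_right lin2(1)[OF ab(3)]]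
                  image_comp_subset[OF lb_image[OF W(2) ab(2)] lin2(2)[OF ab(3)]]
                  lin_compose[OF lin_lb_right lin2(1)[OF ab(2)]]
                  image_comp_subset[OF lb_image[OF W(2) ab(3)] lin2(2)[OF ab(2)]]])
          also have "trace W (\<lambda>w. lb b (lb a (y w))) = trace W (\<lambda>w. lb a (y (lb b w)))"
            by (rule trace_commute[OF W(1) lin_lb_right lb_image[OF W(2) ab(3)] lin2[OF ab(2)]])
          also have "trace W (\<lambda>w. lb a (lb b (y w))) - trace W (\<lambda>w. lb a (y (lb b w)))
            = trace W (\<lambda>w. lb a (lb b (y w)) - lb a (y (lb b w)))"
            by (rule trace_diff[symmetric, OF W(1) lin_compose[OF lin_lb_right lin2(1)[OF ab(3)]]
                  image_comp_subset[OF lb_image[OF W(2) ab(2)] lin2(2)[OF ab(3)]]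
                  lin_compose[OF lin_lb_right yb(1)]
                  image_comp_subset[OF lb_image[OF W(2) ab(2)] yb(2)]])
          also have "\<dots> = trace W (\<lambda>w. - 1 *s lb a (lb b' w))"
          proof (rule trace_cong[OF W(1)])
            show "lin (\<lambda>w. lb a (lb b (y w)) - lb a (y (lb b w)))"
              by (intro lin_minus lin_compose[OF lin_lb_right lin2(1)[OF ab(3)]] lin_compose[OF lin_lb_right yb(1)])
            show "lin (\<lambda>w. - 1 *s lb a (lb b' w))"
              by (rule lin_scaled[OF lin_compose[OF lin_lb_right lin_lb_right]])
            show "(\<lambda>w. lb a (lb b (y w)) - lb a (y (lb b w))) ` W \<subseteq> W"
            proof
              fix v assume "v \<in> (\<lambda>w. lb a (lb b (y w)) - lb a (y (lb b w))) ` W"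
              then obtain w where w: "w \<in> W" "v = lb a (lb b (y w)) - lb a (y (lb b w))" by blast
              have "lb b (y w) \<in> W" "y (lb b w) \<in> W" using w lin2(2)[OF ab(3)] yb(2) by blast+
              then show "v \<in> W" unfolding w(2)
                by (intro subspace_diff[OF stable_subspace[OF W(2)]] stableD[OF W(2) ab(2)])
            qed
            fix w assume "w \<in> W"
            then show "lb a (lb b (y w)) - lb a (y (lb b w)) = - 1 *s lb a (lb b' w)"
              unfolding b'(2)[symmetric, OF \<open>w \<in> W\<close>] by (simp add: lb_simps)
          qed
          also have "\<dots> = - 1 * tform W a b'"
            unfolding tform_def
            by (rule trace_scale[OF W(1) lin_compose[OF lin_lb_right lin_lb_right]
                  image_comp_subset[OF lb_image[OF W(2) ab(2)] lb_image[OF W(2) b'(1)]]])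
          also have "\<dots> = 0" using tf[OF ab(2) b'(1)] by simp
          finally have 0: "trace W (\<lambda>w. lb u (y w)) = 0" .
          have "trace W (\<lambda>w. lb (c *s u + v) (y w)) = trace W (\<lambda>w. c *s lb u (y w) + lb v (y w))"
            by (simp add: lb_simps)
          also have "\<dots> = trace W (\<lambda>w. c *s lb u (y w)) + trace W (\<lambda>w. lb v (y w))"
          proof (rule trace_add[OF W(1) lin_scaled[OF lin2(1)[OF uh]] _ lin2[OF vh]])
            show "(\<lambda>w. c *s lb u (y w)) ` W \<subseteq> W"
              using lin2(2)[OF uh] subspace_scale[OF stable_subspace[OF W(2)]] by blast
          qed
          also have "\<dots> = 0"
            using trace_scale[OF W(1) lin2[OF uh], of c] 0 step.IH by simp
          finally show ?case using cuv by blast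
        qed
        from main[OF x] have "(\<Sum>\<mu>\<leftarrow>L. \<mu> * ?f \<mu>) = 0" using trE by simp
        moreover have "g (\<Sum>\<mu>\<leftarrow>L. \<mu> * ?f \<mu>) = (\<Sum>\<mu>\<leftarrow>L. g \<mu> * g \<mu>)" for L
        proof (induction L)
          case Nil
          show ?case using g(1)[of 0 0] by simp
        next
          case (Cons b L)
          then show ?case using g(1) g(2)[of "g b" b] by (simp add: mult.commute)
        qed
        moreover have "g 0 = 0" using g(1)[of 0 0] by simp
        ultimately have "(\<Sum>\<mu>\<leftarrow>L. g \<mu> * g \<mu>) = 0" by metis
        then have "\<forall>q\<in>set (map (\<lambda>\<mu>. g \<mu> * g \<mu>) L). q = 0"
          by (subst (asm) sum_list_nonneg_eq_0_iff) auto
        then show False using a g(3) by auto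
      qed
    qed
    then show ?thesis using L(1) by blast
  qed
  \<comment> \<open>Every element acts on \<open>W\<close> as one of \<open>derived h\<close>, so
    nilpotency carries over to all of \<open>h\<close>.\<close>
  have "\<exists>n. \<forall>w\<in>W. (lb x ^^ n) w = 0" if x: "x \<in> h" for x
  proof -
    obtain x' where x': "x' \<in> derived h" "\<And>w. w \<in> W \<Longrightarrow> lb x w = lb x' w"
      using p x unfolding perfect_on_def by blast
    have xh: "x' \<in> h" using x' derived_subset[OF h] by blast
    have "(lb x ^^ n) w = (lb x' ^^ n) w \<and> (lb x' ^^ n) w \<in> W" if "w \<in> W" for n w
      by (induction n) (use that x'(2) stableD[OF W(2) xh] in auto)
    then show ?thesis using nilD[OF x'(1)] by metis
  qed
  then have "engel W h" by (rule engel_theorem[OF h W])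
  then show ?thesis by (rule engel_perfect_trivial[OF W _ p x])
qed

end

section \<open>Casimir elements\<close>

context lin_space begin

definition linear_functional :: "'v set \<Rightarrow> ('v \<Rightarrow> 'k) \<Rightarrow> bool"
  where "linear_functional U F \<longleftrightarrow> (\<forall>x\<in>U. \<forall>y\<in>U. F (x + y) = F x + F y) \<and> (\<forall>c. \<forall>x\<in>U. F (c *s x) = c * F x)"

lemma linear_functional_0: "linear_functional U F \<Longrightarrow> subspace U \<Longrightarrow> F 0 = 0"
  unfolding linear_functional_def using subspace_0 by (metis mult_zero_left scale_zero_left)

lemma linear_functional_sum:
  assumes "linear_functional U F" "subspace U" "finite A" "\<And>a. a \<in> A \<Longrightarrow> g a \<in> U"
  shows "F (\<Sum>a\<in>A. c a *s g a) = (\<Sum>a\<in>A. c a * F (g a))"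
  using assms(3,4)
proof (induction A)
  case empty
  then show ?case using linear_functional_0 assms by simp
next
  case (insert a A)
  have "(\<Sum>a\<in>A. c a *s g a) \<in> U" using insert assms(2) by (intro subspace_sum subspace_scale) auto
  moreover have "c a *s g a \<in> U" using insert assms(2) by (intro subspace_scale) auto
  ultimately show ?case using insert assms(1) by (simp add: linear_functional_def)
qed

lemma linear_functional_diff:
  assumes "linear_functional U F" "subspace U" "x \<in> U" "y \<in> U"
  shows "F (x - y) = F x - F y"
proof -
  have "F (x + -1 *s y) = F x + -1 * F y"
    using assms subspace_scale[OF assms(2,4), of "-1"] unfolding linear_functional_def by metis
  then show ?thesis by simp
qed

definition bilinear_form :: "'v set \<Rightarrow> ('v \<Rightarrow> 'v \<Rightarrow> 'k) \<Rightarrow> bool"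
  where "bilinear_form U \<beta> \<longleftrightarrow>
    (\<forall>x\<in>U. linear_functional U (\<beta> x)) \<and> (\<forall>y\<in>U. linear_functional U (\<lambda>x. \<beta> x y))"

lemma linear_functional_subset: "linear_functional U F \<Longrightarrow> V \<subseteq> U \<Longrightarrow> linear_functional V F"
  unfolding linear_functional_def by blast

lemma bilinear_form_subset: "bilinear_form U \<beta> \<Longrightarrow> V \<subseteq> U \<Longrightarrow> bilinear_form V \<beta>"
  unfolding bilinear_form_def using linear_functional_subset by blast

lemma coefficients_unique:
  assumes "basis_of U B" "(\<Sum>b\<in>B. c b *s b) = (\<Sum>b\<in>B. d b *s b)" "b \<in> B"
  shows "c b = d b"
proof -
  have "(\<Sum>b\<in>B. (c b - d b) *s b) = 0"
    using assms(2) by (simp add: scale_left_diff_distrib sum_subtractf)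
  then have "c b - d b = 0"
    using independentD[of B B "\<lambda>b. c b - d b" b] assms by (auto simp: basis_of_def)
  then show ?thesis by simp
qed

definition nondegenerate :: "'v set \<Rightarrow> ('v \<Rightarrow> 'v \<Rightarrow> 'k) \<Rightarrow> bool"
  where "nondegenerate U \<beta> \<longleftrightarrow> (\<forall>u\<in>U. (\<forall>v\<in>U. \<beta> u v = 0) \<longrightarrow> u = 0)"

lemma nondegenerateI:
  "(\<And>u. u \<in> U \<Longrightarrow> (\<And>v. v \<in> U \<Longrightarrow> \<beta> u v = 0) \<Longrightarrow> u = 0) \<Longrightarrow> nondegenerate U \<beta>"
  by (simp add: nondegenerate_def)

lemma nondegenerateD:
  "nondegenerate U \<beta> \<Longrightarrow> u \<in> U \<Longrightarrow> (\<And>v. v \<in> U \<Longrightarrow> \<beta> u v = 0) \<Longrightarrow> u = 0"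
  by (simp add: nondegenerate_def)

text \<open>Sending \<open>u\<close> to the vector with coordinates \<open>\<beta> u b\<close>
  defines an endomorphism of \<open>U\<close>. It is injective by nondegeneracy, hence onto, and a
  preimage of the coordinate vector of \<open>F\<close> represents \<open>F\<close>.\<close>

lemma riesz:
  assumes U: "fd U" and \<beta>: "bilinear_form U \<beta>"
    and nd: "nondegenerate U \<beta>"
    and F: "linear_functional U F"
  obtains u where "u \<in> U" "\<And>v. v \<in> U \<Longrightarrow> \<beta> u v = F v"
proof -
  obtain B where B: "basis_of U B" using U fd_basis by blast
  have sU: "subspace U" using U fd_subspace by blast
  have BU: "\<And>b. b \<in> B \<Longrightarrow> b \<in> U" using basis_of_subset[OF B] by blast
  have spB: "span B = U" "finite B" using B by (simp_all add: basis_of_def)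
  \<comment> \<open>The form is bilinear on \<open>U\<close> only; composing with a projection
    \<open>p\<close> onto \<open>U\<close> makes the endomorphism linear on the whole type.\<close>
  have "U \<inter> {0} = {0}" using subspace_0[OF sU] by blast
  then obtain p where p: "lin p" "\<And>x. p x \<in> U" "\<And>x. x \<in> U \<Longrightarrow> p x = x" "\<And>x. x \<in> {0} \<Longrightarrow> p x = 0"
    by (rule direct_projection[OF sU subspace_single_0]) (rule that)
  have ext: "G v = H v" if "linear_functional U G" "linear_functional U H" "\<And>b. b \<in> B \<Longrightarrow> G b = H b" "v \<in> U" for G H v
  proof -
    have "v = (\<Sum>b\<in>B. representation B v b *s b)"
      using sum_representation_eq[of B v B] B that(4) by (simp add: basis_of_def)
    then obtain c where v: "v = (\<Sum>b\<in>B. c b *s b)" by blast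
    show ?thesis unfolding v
      using linear_functional_sum[OF that(1) sU spB(2), of "\<lambda>b. b" c]
        linear_functional_sum[OF that(2) sU spB(2), of "\<lambda>b. b" c] BU that(3) by simp
  qed
  define \<Phi> where "\<Phi> u = (\<Sum>b\<in>B. \<beta> (p u) b *s b)" for u
  have inU: "(\<Sum>b\<in>B. c b *s b) \<in> U" for c
    using sU BU by (intro subspace_sum subspace_scale) auto
  have lb: "\<beta> (x + y) b = \<beta> x b + \<beta> y b" "\<beta> (c *s x) b = c * \<beta> x b"
    if "x \<in> U" "y \<in> U" "b \<in> B" for x y b c
    using \<beta> that BU unfolding bilinear_form_def linear_functional_def by blast+
  have "lin \<Phi>"
    by (rule linI)
      (simp_all add: \<Phi>_def lin_add[OF p(1)] lin_scale[OF p(1)] lb(1)[OF p(2) p(2)]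
        lb(2)[OF p(2) p(2)] scale_left_distrib sum.distrib scale_sum_right cong: sum.cong)
  moreover have "\<Phi> ` U \<subseteq> U" using inU by (auto simp: \<Phi>_def)
  moreover have "u = 0" if u: "u \<in> U" "\<Phi> u = 0" for u
  proof (rule nondegenerateD[OF nd u(1)])
    fix v assume v: "v \<in> U"
    have "(\<Sum>b\<in>B. \<beta> u b *s b) = (\<Sum>b\<in>B. 0 *s b)" using u by (simp add: \<Phi>_def p(3))
    then have "\<beta> u b = 0" if "b \<in> B" for b
      using coefficients_unique[OF B, of "\<beta> u" "\<lambda>_. 0"] that by simp
    moreover have "linear_functional U (\<lambda>_. 0)" by (simp add: linear_functional_def)
    ultimately show "\<beta> u v = 0" using ext[of "\<beta> u" "\<lambda>_. 0" v] \<beta> u v by (simp add: bilinear_form_def)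
  qed
  ultimately have "\<Phi> ` U = U" by (intro inj_imp_onto U)
  moreover have "(\<Sum>b\<in>B. F b *s b) \<in> U" by (rule inU)
  ultimately obtain u where u: "u \<in> U" "(\<Sum>b\<in>B. F b *s b) = \<Phi> u" by blast
  show ?thesis
  proof (rule that[OF u(1)])
    fix v assume v: "v \<in> U"
    have "(\<Sum>b\<in>B. F b *s b) = (\<Sum>b\<in>B. \<beta> u b *s b)" using u by (simp add: \<Phi>_def p(3))
    then have "\<beta> u b = F b" if "b \<in> B" for b
      using coefficients_unique[OF B, of F "\<beta> u"] that by simp
    then show "\<beta> u v = F v" using ext[of "\<beta> u" F v] \<beta> u v F by (simp add: bilinear_form_def)
  qed
qed

lemma dual_basis:
  assumes U: "fd U" and \<beta>: "bilinear_form U \<beta>"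
    and nd: "nondegenerate U \<beta>"
    and B: "basis_of U B"
  obtains d where "\<And>b. b \<in> B \<Longrightarrow> d b \<in> U"
    "\<And>b c. b \<in> B \<Longrightarrow> c \<in> B \<Longrightarrow> \<beta> (d b) c = (if c = b then 1 else 0)"
proof -
  have "\<exists>u. u \<in> U \<and> (\<forall>c\<in>B. \<beta> u c = (if c = b then 1 else 0))" if b: "b \<in> B" for b
  proof -
    have iB: "independent B" "span B = U" using B by (simp_all add: basis_of_def)
    have lf: "linear_functional U (\<lambda>v. representation B v b)"
      unfolding linear_functional_def using iB by (simp add: representation_add representation_scale)
    obtain u where u: "u \<in> U" "\<And>v. v \<in> U \<Longrightarrow> \<beta> u v = representation B v b"
      by (rule riesz[OF U \<beta> nd lf]) (rule that)
    have "\<beta> u c = (if c = b then 1 else 0)" if "c \<in> B" for c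
      using u(2)[of c] that basis_of_subset[OF B] representation_basis[OF iB(1) that] by auto
    then show ?thesis using u(1) by blast
  qed
  then obtain d where "\<forall>b\<in>B. d b \<in> U \<and> (\<forall>c\<in>B. \<beta> (d b) c = (if c = b then 1 else 0))"
    by metis
  then show ?thesis using that[of d] by simp
qed

end

locale inv_lie_space = lie_space scale lb
  for scale :: "'k::{alg_closed_field, field_char_0} \<Rightarrow> 'v::ab_group_add \<Rightarrow> 'v" (infixr \<open>*s\<close> 75)
    and lb :: "'v \<Rightarrow> 'v \<Rightarrow> 'v" +
  fixes sg :: "'v \<Rightarrow> 'v"
  assumes lin_sg: "lin sg" and sg_sg: "sg (sg x) = x" and sg_lb: "sg (lb x y) = lb (sg x) (sg y)"
begin

lemmas sg_simps = lin_add[OF lin_sg] lin_diff[OF lin_sg] lin_scale[OF lin_sg] lin_0[OF lin_sg]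
  lin_neg[OF lin_sg] sg_lb sg_sg

section \<open>Subalgebras and ideals stable under the involution\<close>

definition salg :: "'v set \<Rightarrow> bool"
  where "salg h \<longleftrightarrow> subalg h \<and> (\<forall>x\<in>h. sg x \<in> h)"

definition sideal :: "'v set \<Rightarrow> 'v set \<Rightarrow> bool"
  where "sideal h I \<longleftrightarrow> stable h I \<and> I \<subseteq> h \<and> (\<forall>x\<in>I. sg x \<in> I)"

definition maximal :: "'v set \<Rightarrow> 'v set \<Rightarrow> bool"
  where "maximal h N \<longleftrightarrow> sideal h N \<and> (\<forall>J. sideal h J \<longrightarrow> N \<subseteq> J \<longrightarrow> J = N \<or> J = h)"

definition minimal :: "'v set \<Rightarrow> 'v set \<Rightarrow> bool"
  where "minimal h N \<longleftrightarrow> sideal h N \<and> (\<forall>J. sideal h J \<longrightarrow> J \<subseteq> N \<longrightarrow> J = {0} \<or> J = N)"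

definition complement :: "'v set \<Rightarrow> 'v set \<Rightarrow> 'v set \<Rightarrow> bool"
  where "complement h N T \<longleftrightarrow> salg T \<and> T \<subseteq> h \<and> T \<inter> N = {0} \<and> (\<forall>x\<in>h. \<exists>t\<in>T. \<exists>n\<in>N. x = t + n)"

lemma salgD: "salg h \<Longrightarrow> subalg h" "salg h \<Longrightarrow> fd h" "salg h \<Longrightarrow> subspace h"
    "salg h \<Longrightarrow> x \<in> h \<Longrightarrow> sg x \<in> h" "salg h \<Longrightarrow> x \<in> h \<Longrightarrow> y \<in> h \<Longrightarrow> lb x y \<in> h"
  by (simp_all add: salg_def subalg_def fd_def)

lemma sidealD: "sideal h I \<Longrightarrow> stable h I" "sideal h I \<Longrightarrow> subspace I" "sideal h I \<Longrightarrow> x \<in> I \<Longrightarrow> x \<in> h"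
    "sideal h I \<Longrightarrow> x \<in> I \<Longrightarrow> sg x \<in> I" "sideal h I \<Longrightarrow> y \<in> h \<Longrightarrow> x \<in> I \<Longrightarrow> lb y x \<in> I"
  by (auto simp: sideal_def stable_def)

lemma sideal_left: "sideal h I \<Longrightarrow> x \<in> I \<Longrightarrow> y \<in> h \<Longrightarrow> lb x y \<in> I"
  using lb_skew[of x y] sidealD(2,5)[of h I] subspace_neg by metis

lemma sidealI:
  assumes "subspace I" "I \<subseteq> h" "\<And>x y. y \<in> h \<Longrightarrow> x \<in> I \<Longrightarrow> lb y x \<in> I" "\<And>x. x \<in> I \<Longrightarrow> sg x \<in> I"
  shows "sideal h I"
  using assms by (auto simp: sideal_def stable_def)

lemma sideal_fd: "salg h \<Longrightarrow> sideal h I \<Longrightarrow> fd I"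
  using salgD(2) fd_subset sideal_def stable_subspace by blast

lemma sideal_self: "salg h \<Longrightarrow> sideal h h"
  using salgD by (intro sidealI) auto

lemma sideal_salg: "salg h \<Longrightarrow> sideal h I \<Longrightarrow> salg I"
  using sideal_fd sidealD[of h I] by (auto simp: salg_def subalg_def)

lemma sideal_plus:
  assumes "sideal h I" "sideal h J" "subspace h"
  shows "sideal h {u + v |u v. u \<in> I \<and> v \<in> J}"
proof (rule sidealI)
  show "subspace {u + v |u v. u \<in> I \<and> v \<in> J}" using assms sidealD(2) subspace_plus by blast
  show "{u + v |u v. u \<in> I \<and> v \<in> J} \<subseteq> h" using assms sidealD(3) subspace_add by blast
  fix x assume "x \<in> {u + v |u v. u \<in> I \<and> v \<in> J}"
  then obtain u v where uv: "x = u + v" "u \<in> I" "v \<in> J" by blast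
  then have "sg x = sg u + sg v" by (simp add: sg_simps)
  then show "sg x \<in> {u + v |u v. u \<in> I \<and> v \<in> J}" using uv assms sidealD(4) by blast
  fix y assume "y \<in> h"
  moreover have "lb y x = lb y u + lb y v" using uv by (simp add: lb_simps)
  ultimately show "lb y x \<in> {u + v |u v. u \<in> I \<and> v \<in> J}" using uv assms sidealD(5) by blast
qed

lemma sideal_derived:
  assumes I: "sideal h I"
  shows "sideal h (derived I)" "derived I \<subseteq> I"
proof -
  show sub: "derived I \<subseteq> I"
    unfolding derived_def
    by (rule span_minimal) (use sidealD[OF I] in auto)
  have gen: "lb a b \<in> derived I" if "a \<in> I" "b \<in> I" for a b
    unfolding derived_def using that by (intro span_base) blast
  have s: "subspace (derived I)" unfolding derived_def by (rule subspace_span)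
  show "sideal h (derived I)"
  proof (rule sidealI[OF s])
    show "derived I \<subseteq> h" using sub sidealD(3)[OF I] by blast
    fix x assume x: "x \<in> derived I"
    show "sg x \<in> derived I"
      using x unfolding derived_def
    proof (induction rule: span_induct_alt)
      case base
      show ?case by (simp add: sg_simps span_zero)
    next
      case (step c a y)
      then obtain p q where pq: "a = lb p q" "p \<in> I" "q \<in> I" by blast
      have "sg a \<in> derived I" using gen sidealD(4)[OF I] pq by (simp add: sg_simps)
      then show ?case using step(2) unfolding derived_def by (simp add: sg_simps span_add span_scale)
    qed
    fix y assume y: "y \<in> h"
    show "lb y x \<in> derived I"
      using x unfolding derived_def
    proof (induction rule: span_induct_alt)
      case base
      show ?case by (simp add: lb_simps span_zero)
    next
      case (step c a z)
      then obtain p q where pq: "a = lb p q" "p \<in> I" "q \<in> I" by blast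
      have "lb y a = lb (lb y p) q + lb p (lb y q)" unfolding pq(1) by (rule jacobi)
      then have "lb y a \<in> derived I"
        using gen sidealD(5)[OF I y] pq subspace_add[OF s] by simp
      then show ?case using step(2) unfolding derived_def by (simp add: lb_simps span_add span_scale)
    qed
  qed
qed

section \<open>Trace forms\<close>

lemma ad2:
  assumes W: "stable h W" and "x \<in> h" "y \<in> h"
  shows "lin (\<lambda>w. lb x (lb y w))" "(\<lambda>w. lb x (lb y w)) ` W \<subseteq> W"
  using lin_compose[OF lin_lb_right lin_lb_right] image_comp_subset[OF lb_image[OF W] lb_image[OF W]] assms by auto

lemma tform_sym:
  assumes "fd W" "stable h W" "x \<in> h" "y \<in> h"
  shows "tform W x y = tform W y x"
  unfolding tform_def
  using trace_commute[OF assms(1) lin_lb_right lb_image[OF assms(2,3)] lin_lb_right lb_image[OF assms(2,4)]] .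

lemma tform_bilinear:
  assumes h: "subspace h" and W: "fd W" "stable h W"
  shows "bilinear_form h (tform W)"
proof -
  have l: "linear_functional h (\<lambda>x. tform W x y)" if y: "y \<in> h" for y
    unfolding linear_functional_def
  proof (intro conjI ballI allI)
    fix x z assume xz: "x \<in> h" "z \<in> h"
    show "tform W (x + z) y = tform W x y + tform W z y"
      unfolding tform_def lb_add_left
      by (rule trace_add[OF W(1) ad2[OF W(2) xz(1) y] ad2[OF W(2) xz(2) y]])
  next
    fix c x assume x: "x \<in> h"
    show "tform W (c *s x) y = c * tform W x y"
      unfolding tform_def lb_scale_left by (rule trace_scale[OF W(1) ad2[OF W(2) x y]])
  qed
  moreover have "linear_functional h (tform W x)" if x: "x \<in> h" for x
  proof -
    have "tform W x y = tform W y x" if "y \<in> h" for y using tform_sym[OF W x that] .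
    then show ?thesis using l[OF x] h unfolding linear_functional_def
      by (simp add: subspace_add subspace_scale)
  qed
  ultimately show ?thesis by (simp add: bilinear_form_def)
qed

text \<open>Cyclicity of the trace gives the products \<open>y x z\<close> and \<open>x z y\<close>
  the same trace, which turns the left commutator into the right one.\<close>

lemma tform_invariant:
  assumes W: "fd W" "stable h W" and x: "x \<in> h" "y \<in> h" "z \<in> h"
  shows "tform W (lb x y) z = tform W x (lb y z)"
proof -
  have m3: "lin (\<lambda>w. lb a (lb b (lb c w)))" "(\<lambda>w. lb a (lb b (lb c w))) ` W \<subseteq> W"
    if "a \<in> h" "b \<in> h" "c \<in> h" for a b c
    using lin_compose[OF lin_lb_right ad2(1)[OF W(2) that(2,3)]]
      image_comp_subset[OF lb_image[OF W(2) that(1)] ad2(2)[OF W(2) that(2,3)]] by auto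
  have "tform W (lb x y) z = trace W (\<lambda>w. lb x (lb y (lb z w)) - lb y (lb x (lb z w)))"
    unfolding tform_def lb_lb_left ..
  also have "\<dots> = trace W (\<lambda>w. lb x (lb y (lb z w))) - trace W (\<lambda>w. lb y (lb x (lb z w)))"
    by (rule trace_diff[OF W(1) m3 m3]) (rule x)+
  also have "trace W (\<lambda>w. lb y (lb x (lb z w))) = trace W (\<lambda>w. lb x (lb z (lb y w)))"
    by (rule trace_commute[OF W(1) lin_lb_right lb_image[OF W(2) x(2)] ad2[OF W(2) x(1,3)]])
  also have "trace W (\<lambda>w. lb x (lb y (lb z w))) - trace W (\<lambda>w. lb x (lb z (lb y w)))
      = trace W (\<lambda>w. lb x (lb y (lb z w)) - lb x (lb z (lb y w)))"
    by (rule trace_diff[symmetric, OF W(1) m3 m3]) (rule x)+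
  also have "\<dots> = tform W x (lb y z)"
    unfolding tform_def by (simp add: lb_lb_left lb_simps)
  finally show ?thesis .
qed

text \<open>The operator of \<open>sg x\<close> is the conjugate by \<open>sg\<close> of that of
  \<open>x\<close>, and conjugation does not change traces.\<close>

lemma tform_sg:
  assumes h: "salg h" and W: "sideal h W" and x: "x \<in> h" "y \<in> h"
  shows "tform W (sg x) (sg y) = tform W x y"
proof -
  note fW = sideal_fd[OF h W] and sW = sidealD(1)[OF W]
  have sgW: "sg ` W \<subseteq> W" using sidealD(4)[OF W] by blast
  have l: "lin (\<lambda>w. lb x (lb y (sg w)))" by (rule lin_compose[OF ad2(1)[OF sW x] lin_sg])
  have "tform W (sg x) (sg y) = trace W (\<lambda>w. sg (lb x (lb y (sg w))))"
    unfolding tform_def by (simp add: sg_simps)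
  also have "\<dots> = trace W (\<lambda>w. lb x (lb y (sg (sg w))))"
    by (rule trace_commute[OF fW lin_sg sgW l image_comp_subset[OF ad2(2)[OF sW x] sgW]])
  finally show ?thesis by (simp add: sg_sg tform_def)
qed

lemma tform_orthogonal_sideal:
  assumes h: "salg h" and W: "sideal h W" and J: "sideal h J"
  shows "sideal h {x \<in> h. \<forall>n\<in>J. tform W x n = 0}" (is "sideal h ?T")
proof (rule sidealI)
  note fW = sideal_fd[OF h W] and sW = sidealD(1)[OF W]
  note bil = tform_bilinear[OF salgD(3)[OF h] fW sW]
  have lin: "tform W (x + y) n = tform W x n + tform W y n" "tform W (c *s x) n = c * tform W x n"
    if "x \<in> h" "y \<in> h" "n \<in> J" for x y n c
    using bil that sidealD(3)[OF J] unfolding bilinear_form_def linear_functional_def by blast+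
  have "tform W 0 n = 0" if "n \<in> J" for n
    unfolding tform_def by (rule trace_zero[OF fW]) (simp add: lb_simps)
  then show "subspace ?T"
    using salgD(3)[OF h] lin by (auto simp: subspace_def)
  show "?T \<subseteq> h" by blast
  fix x assume x: "x \<in> ?T"
  have "tform W (sg x) n = 0" if n: "n \<in> J" for n
  proof -
    have "tform W (sg x) (sg (sg n)) = tform W x (sg n)"
      by (rule tform_sg[OF h W]) (use x n sidealD(3,4)[OF J] in auto)
    then show ?thesis using x sidealD(4)[OF J n] by (simp add: sg_sg)
  qed
  then show "sg x \<in> ?T" using x salgD(4)[OF h] by blast
  fix y assume y: "y \<in> h"
  have "tform W (lb y x) n = 0" if n: "n \<in> J" for n
  proof -
    have nh: "n \<in> h" using sidealD(3)[OF J n] .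
    have xh: "x \<in> h" using x by blast
    have "tform W (lb x y) n = tform W x (lb y n)"
      by (rule tform_invariant[OF fW sW xh y nh])
    also have "\<dots> = 0" using x sidealD(5)[OF J y n] by blast
    finally have "tform W (-1 *s lb x y) n = 0"
      using lin(2)[OF salgD(5)[OF h xh y] xh n, of "-1"] by simp
    then show ?thesis using lb_skew[of y x] by simp
  qed
  then show "lb y x \<in> ?T" using salgD(5)[OF h y] x by blast
qed

text \<open>Bilinear maps on \<open>h / N\<close>.\<close>

definition bilinear_mod :: "'v set \<Rightarrow> 'v set \<Rightarrow> ('v \<Rightarrow> 'v \<Rightarrow> 'v) \<Rightarrow> bool"
  where "bilinear_mod h N \<Phi> \<longleftrightarrow> (\<forall>x. lin (\<Phi> x)) \<and> (\<forall>y. lin (\<lambda>x. \<Phi> x y)) \<and>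
    (\<forall>n\<in>N. \<forall>x\<in>h. \<Phi> n x = 0 \<and> \<Phi> x n = 0)"

definition casimir_op :: "'v set \<Rightarrow> ('v \<Rightarrow> 'v) \<Rightarrow> 'v \<Rightarrow> 'v"
  where "casimir_op B d w = (\<Sum>b\<in>B. lb b (lb (d b) w))"

text \<open>The last two conditions say that the element \<open>\<Sum>b\<in>B. b \<otimes> d b\<close> of
  \<open>h / N \<otimes> h / N\<close> is invariant under \<open>h\<close> and \<open>sg\<close>.\<close>

definition casimir :: "'v set \<Rightarrow> 'v set \<Rightarrow> 'v set \<Rightarrow> 'v set \<Rightarrow> ('v \<Rightarrow> 'v) \<Rightarrow> bool"
  where "casimir h N W B d \<longleftrightarrow> finite B \<and> B \<subseteq> h \<and> d ` B \<subseteq> h \<and> trace W (casimir_op B d) \<noteq> 0 \<and>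
    (\<forall>\<Phi>. bilinear_mod h N \<Phi> \<longrightarrow>
      (\<forall>z\<in>h. (\<Sum>b\<in>B. \<Phi> (lb z b) (d b)) = - (\<Sum>b\<in>B. \<Phi> b (lb z (d b)))) \<and>
      (\<Sum>b\<in>B. \<Phi> (sg b) (sg (d b))) = (\<Sum>b\<in>B. \<Phi> b (d b)))"

text \<open>The radical of the trace form of \<open>W\<close> is a stable ideal containing
  \<open>N\<close>, which acts by zero. Cartan's criterion shows that it is not \<open>h\<close>, so
  it is \<open>N\<close> by maximality. The form is therefore nondegenerate on the complement
  \<open>T\<close> that models \<open>h / N\<close>, and dual bases of \<open>T\<close> give the
  Casimir element.\<close>

lemma casimir_exists:
  assumes h: "salg h" and N: "maximal h N" and W: "sideal h W"
    and triv: "\<And>n w. n \<in> N \<Longrightarrow> w \<in> W \<Longrightarrow> lb n w = 0"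
    and p: "perfect_on W h" and nt: "x0 \<in> h" "w0 \<in> W" "lb x0 w0 \<noteq> 0"
  shows "\<exists>B d. casimir h N W B d"
proof -
  let ?\<beta> = "tform W"
  note fW = sideal_fd[OF h W] and sW = sidealD(1)[OF W] and sh = salgD(3)[OF h]
  note bil = tform_bilinear[OF sh fW sW]
  note sym = tform_sym[OF fW sW]
  have Ni: "sideal h N" using N by (simp add: maximal_def)
  note Nh = sidealD(3)[OF Ni]
  have lfr: "linear_functional h (?\<beta> x)" and lfl: "linear_functional h (\<lambda>y. ?\<beta> y x)" if "x \<in> h" for x
    using bil that unfolding bilinear_form_def by blast+
  define R where "R = {x \<in> h. \<forall>y\<in>h. ?\<beta> x y = 0}"
  have "sideal h R" unfolding R_def by (rule tform_orthogonal_sideal[OF h W sideal_self[OF h]])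
  moreover have "N \<subseteq> R"
  proof
    fix n assume n: "n \<in> N"
    have "?\<beta> n y = 0" if "y \<in> h" for y
      unfolding tform_def by (rule trace_zero[OF fW]) (use triv[OF n] sidealD(5)[OF W that] in auto)
    then show "n \<in> R" using Nh[OF n] by (simp add: R_def)
  qed
  moreover have "R \<noteq> h"
  proof
    assume "R = h"
    then have "lb x0 w0 = 0"
      by (intro cartan_criterion[OF salgD(1)[OF h] fW sW p _ nt(1,2)]) (auto simp: R_def)
    then show False using nt(3) by simp
  qed
  ultimately have RN: "R = N" using N by (auto simp: maximal_def)
  obtain r where r: "lin r" "\<And>x. r x \<in> h" "\<And>x. r (r x) = r x" "\<And>x. x \<in> N \<Longrightarrow> r x = 0" "\<And>x. x \<in> h \<Longrightarrow> x - r x \<in> N"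
    by (rule projection_exists[OF sh sidealD(2)[OF Ni]]) (use Nh in blast, rule that)
  define T where "T = r ` h"
  have Th: "T \<subseteq> h" using r(2) by (auto simp: T_def)
  have fT: "fd T" unfolding T_def by (rule fd_image[OF r(1) salgD(2)[OF h]])
  have N0: "?\<beta> x n = 0" "?\<beta> n x = 0" if "x \<in> h" "n \<in> N" for x n
  proof -
    show "?\<beta> n x = 0" using that RN by (auto simp: R_def)
    then show "?\<beta> x n = 0" using sym[OF that(1) Nh[OF that(2)]] by simp
  qed
  have br: "?\<beta> x y = ?\<beta> x (r y)" if "x \<in> h" "y \<in> h" for x y
    using linear_functional_diff[OF lfr[OF that(1)] sh that(2) r(2)[of y]] N0(1)[OF that(1) r(5)[OF that(2)]] by simp
  obtain B where B: "basis_of T B" using fd_basis[OF fT] by blast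
  have bT: "bilinear_form T ?\<beta>" by (rule bilinear_form_subset[OF bil Th])
  have nd: "nondegenerate T ?\<beta>"
  proof (rule nondegenerateI)
    fix u assume u: "u \<in> T" "\<And>v. v \<in> T \<Longrightarrow> ?\<beta> u v = 0"
    have uh: "u \<in> h" using u Th by blast
    have "?\<beta> u y = 0" if "y \<in> h" for y using br[OF uh that] u(2)[of "r y"] that by (simp add: T_def)
    then have "u \<in> N" using uh RN by (auto simp: R_def)
    then have "r u = 0" by (rule r(4))
    moreover have "r u = u" using u(1) r(3) by (auto simp: T_def)
    ultimately show "u = 0" by simp
  qed
  obtain d where d: "\<And>b. b \<in> B \<Longrightarrow> d b \<in> T" "\<And>b c. b \<in> B \<Longrightarrow> c \<in> B \<Longrightarrow> ?\<beta> (d b) c = (if c = b then 1 else 0)"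
    by (rule dual_basis[OF fT bT nd B]) (rule that)
  have fB: "finite B" using B by (simp add: basis_of_def)
  have Bh: "\<And>b. b \<in> B \<Longrightarrow> b \<in> h" and dh: "\<And>b. b \<in> B \<Longrightarrow> d b \<in> h"
    using basis_of_subset[OF B] Th d(1) by blast+
  have d': "?\<beta> c (d b) = (if c = b then 1 else 0)" if "b \<in> B" "c \<in> B" for b c
    using d(2)[OF that] sym[OF Bh[OF that(2)] dh[OF that(1)]] by simp
  have sumh: "(\<Sum>c\<in>B. a c *s f c) \<in> h" if "\<And>c. c \<in> B \<Longrightarrow> f c \<in> h" for a f
    using that sh by (intro subspace_sum subspace_scale) auto
  have inN: "z \<in> N" if z: "z \<in> h" "\<And>y. y \<in> h \<Longrightarrow> ?\<beta> z y = 0" for z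
    using z RN by (auto simp: R_def)
  \<comment> \<open>Modulo \<open>N\<close>, every element of \<open>h\<close> expands in the
    vectors \<open>d c\<close>, and in \<open>E1\<close> in those of \<open>B\<close>, with
    coefficients given by the form. As \<open>N\<close> is the radical, it is enough to test both
    against \<open>h\<close>.\<close>
  have E2: "z - (\<Sum>c\<in>B. ?\<beta> c z *s d c) \<in> N" if z: "z \<in> h" for z
  proof (rule inN)
    let ?z = "z - (\<Sum>c\<in>B. ?\<beta> c z *s d c)"
    show zh: "?z \<in> h" using z sumh[OF dh] sh by (intro subspace_diff) auto
    have zero: "?\<beta> ?z b = 0" if b: "b \<in> B" for b
    proof -
      have "?\<beta> ?z b = ?\<beta> z b - ?\<beta> (\<Sum>c\<in>B. ?\<beta> c z *s d c) b"
        by (rule linear_functional_diff[OF lfl[OF Bh[OF b]] sh z sumh[OF dh]])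
      also have "?\<beta> (\<Sum>c\<in>B. ?\<beta> c z *s d c) b = (\<Sum>c\<in>B. ?\<beta> c z * ?\<beta> (d c) b)"
        by (rule linear_functional_sum[OF lfl[OF Bh[OF b]] sh fB dh])
      also have "\<dots> = (\<Sum>c\<in>B. if c = b then ?\<beta> c z else 0)"
        by (rule sum.cong) (use d(2) b in auto)
      also have "\<dots> = ?\<beta> b z" using b fB by simp
      finally show ?thesis using sym[OF z Bh[OF b]] by simp
    qed
    fix y assume y: "y \<in> h"
    have "r y \<in> span B" using B y by (auto simp: basis_of_def T_def)
    then have "r y \<in> h \<and> ?\<beta> ?z (r y) = 0"
    proof (induction rule: span_induct_alt)
      case base
      show ?case using linear_functional_0[OF lfr[OF zh] sh] subspace_0[OF sh] by simp
    next
      case (step a b v)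
      have "a *s b \<in> h" using Bh[OF step(1)] sh subspace_scale by blast
      then show ?case using step zero[OF step(1)] Bh[OF step(1)] lfr[OF zh] subspace_add[OF sh]
        by (auto simp: linear_functional_def)
    qed
    then show "?\<beta> ?z y = 0" using br[OF zh y] by simp
  qed
  have E1: "z - (\<Sum>c\<in>B. ?\<beta> z (d c) *s c) \<in> N" if z: "z \<in> h" for z
  proof (rule inN)
    let ?z = "z - (\<Sum>c\<in>B. ?\<beta> z (d c) *s c)"
    show zh: "?z \<in> h" using z sumh[of "\<lambda>c. c"] Bh sh by (intro subspace_diff) auto
    have zero: "?\<beta> ?z (d b) = 0" if b: "b \<in> B" for b
    proof -
      have "?\<beta> ?z (d b) = ?\<beta> z (d b) - ?\<beta> (\<Sum>c\<in>B. ?\<beta> z (d c) *s c) (d b)"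
        by (rule linear_functional_diff[OF lfl[OF dh[OF b]] sh z sumh[OF Bh]])
      also have "?\<beta> (\<Sum>c\<in>B. ?\<beta> z (d c) *s c) (d b) = (\<Sum>c\<in>B. ?\<beta> z (d c) * ?\<beta> c (d b))"
        by (rule linear_functional_sum[OF lfl[OF dh[OF b]] sh fB Bh])
      also have "\<dots> = (\<Sum>c\<in>B. if c = b then ?\<beta> z (d c) else 0)"
        by (rule sum.cong) (use d' b in auto)
      also have "\<dots> = ?\<beta> z (d b)" using b fB by simp
      finally show ?thesis by simp
    qed
    fix y assume y: "y \<in> h"
    have "?\<beta> ?z y - ?\<beta> ?z (\<Sum>c\<in>B. ?\<beta> c y *s d c) = ?\<beta> ?z (y - (\<Sum>c\<in>B. ?\<beta> c y *s d c))"
      by (rule linear_functional_diff[symmetric, OF lfr[OF zh] sh y sumh[OF dh]])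
    also have "\<dots> = 0" by (rule N0(1)[OF zh E2[OF y]])
    also have "?\<beta> ?z (\<Sum>c\<in>B. ?\<beta> c y *s d c) = (\<Sum>c\<in>B. ?\<beta> c y * ?\<beta> ?z (d c))"
      by (rule linear_functional_sum[OF lfr[OF zh] sh fB dh])
    also have "\<dots> = 0" using zero by simp
    finally show "?\<beta> ?z y = 0" by simp
  qed
  have "trace W (casimir_op B d) \<noteq> 0"
  proof -
    have "B \<noteq> {}"
    proof
      assume "B = {}"
      then have "T = {0}" using B by (auto simp: basis_of_def)
      then have "r x0 = 0" using nt(1) by (auto simp: T_def)
      then have "x0 \<in> N" using r(5)[OF nt(1)] by simp
      then show False using triv nt by blast
    qed
    have "trace W (casimir_op B d) = (\<Sum>b\<in>B. trace W (\<lambda>w. lb b (lb (d b) w)))"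
      unfolding casimir_op_def[abs_def] by (rule trace_sum[OF fB fW]) (rule ad2[OF sW]; use Bh dh in auto)+
    also have "\<dots> = (\<Sum>b\<in>B. ?\<beta> b (d b))" by (simp add: tform_def)
    \<comment> \<open>The trace is the number of elements of \<open>B\<close>, which is nonzero in
      characteristic 0.\<close>
    also have "\<dots> = (\<Sum>b\<in>B. 1)" by (rule sum.cong) (use d' in auto)
    finally show ?thesis using \<open>B \<noteq> {}\<close> fB by simp
  qed
  moreover have "(\<Sum>b\<in>B. \<Phi> (lb z b) (d b)) = - (\<Sum>b\<in>B. \<Phi> b (lb z (d b)))"
    if bm: "bilinear_mod h N \<Phi>" and z: "z \<in> h" for \<Phi> z
  proof -
    have \<Phi>: "\<And>x. lin (\<Phi> x)" "\<And>y. lin (\<lambda>x. \<Phi> x y)" "\<And>n y. n \<in> N \<Longrightarrow> y \<in> h \<Longrightarrow> \<Phi> n y = 0"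
      "\<And>n x. n \<in> N \<Longrightarrow> x \<in> h \<Longrightarrow> \<Phi> x n = 0"
      using bm by (simp_all add: bilinear_mod_def)
    have e1: "\<Phi> x y = (\<Sum>c\<in>B. ?\<beta> x (d c) *s \<Phi> c y)" if "x \<in> h" "y \<in> h" for x y
      using \<Phi>(3)[OF E1[OF that(1)] that(2)]
      by (simp add: lin_diff[OF \<Phi>(2)] lin_sum[OF \<Phi>(2)] lin_scale[OF \<Phi>(2)])
    have e2: "\<Phi> x y = (\<Sum>c\<in>B. ?\<beta> c y *s \<Phi> x (d c))" if "x \<in> h" "y \<in> h" for x y
      using \<Phi>(4)[OF E2[OF that(2)] that(1)]
      by (simp add: lin_diff[OF \<Phi>(1)] lin_sum[OF \<Phi>(1)] lin_scale[OF \<Phi>(1)])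
    have inv: "?\<beta> (lb z b) (d c) = - ?\<beta> b (lb z (d c))" if "b \<in> B" "c \<in> B" for b c
    proof -
      have "?\<beta> (lb b z) (d c) = ?\<beta> b (lb z (d c))"
        by (rule tform_invariant[OF fW sW Bh[OF that(1)] z dh[OF that(2)]])
      moreover have "?\<beta> (-1 *s lb b z) (d c) = -1 * ?\<beta> (lb b z) (d c)"
        using lfl[OF dh[OF that(2)]] salgD(5)[OF h Bh[OF that(1)] z] unfolding linear_functional_def by blast
      ultimately show ?thesis using lb_skew[of z b] by simp
    qed
    \<comment> \<open>Expand the first argument in \<open>B\<close>, move \<open>z\<close> across
      the form by invariance, exchange the sums, and collapse the expansion of the second argument
      in the dual basis.\<close>
    have "(\<Sum>b\<in>B. \<Phi> (lb z b) (d b)) = (\<Sum>b\<in>B. \<Sum>c\<in>B. ?\<beta> (lb z b) (d c) *s \<Phi> c (d b))"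
      by (rule sum.cong[OF refl], rule e1) (use salgD(5)[OF h z] Bh dh in auto)
    also have "\<dots> = (\<Sum>b\<in>B. \<Sum>c\<in>B. - (?\<beta> b (lb z (d c)) *s \<Phi> c (d b)))"
      by (intro sum.cong refl) (simp add: inv)
    also have "\<dots> = (\<Sum>c\<in>B. \<Sum>b\<in>B. - (?\<beta> b (lb z (d c)) *s \<Phi> c (d b)))" by (rule sum.swap)
    also have "\<dots> = - (\<Sum>c\<in>B. \<Sum>b\<in>B. ?\<beta> b (lb z (d c)) *s \<Phi> c (d b))" by (simp add: sum_negf)
    also have "(\<Sum>c\<in>B. \<Sum>b\<in>B. ?\<beta> b (lb z (d c)) *s \<Phi> c (d b)) = (\<Sum>c\<in>B. \<Phi> c (lb z (d c)))"
      by (rule sum.cong[OF refl], rule e2[symmetric]) (use salgD(5)[OF h z] Bh dh in auto)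
    finally show ?thesis .
  qed
  moreover have "(\<Sum>b\<in>B. \<Phi> (sg b) (sg (d b))) = (\<Sum>b\<in>B. \<Phi> b (d b))"
    if bm: "bilinear_mod h N \<Phi>" for \<Phi>
  proof -
    have \<Phi>: "\<And>x. lin (\<Phi> x)" "\<And>y. lin (\<lambda>x. \<Phi> x y)" "\<And>n y. n \<in> N \<Longrightarrow> y \<in> h \<Longrightarrow> \<Phi> n y = 0"
      "\<And>n x. n \<in> N \<Longrightarrow> x \<in> h \<Longrightarrow> \<Phi> x n = 0"
      using bm by (simp_all add: bilinear_mod_def)
    have e1: "\<Phi> x y = (\<Sum>c\<in>B. ?\<beta> x (d c) *s \<Phi> c y)" if "x \<in> h" "y \<in> h" for x y
      using \<Phi>(3)[OF E1[OF that(1)] that(2)]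
      by (simp add: lin_diff[OF \<Phi>(2)] lin_sum[OF \<Phi>(2)] lin_scale[OF \<Phi>(2)])
    have inv: "?\<beta> (sg b) (d c) = ?\<beta> b (sg (d c))" if "b \<in> B" "c \<in> B" for b c
      using tform_sg[OF h W Bh[OF that(1)] salgD(4)[OF h dh[OF that(2)]]] by (simp add: sg_sg)
    have "(\<Sum>b\<in>B. \<Phi> (sg b) (sg (d b))) = (\<Sum>b\<in>B. \<Sum>c\<in>B. ?\<beta> (sg b) (d c) *s \<Phi> c (sg (d b)))"
      by (rule sum.cong[OF refl], rule e1) (use salgD(4)[OF h] Bh dh in auto)
    also have "\<dots> = (\<Sum>b\<in>B. \<Sum>c\<in>B. ?\<beta> b (sg (d c)) *s \<Phi> c (sg (d b)))"
      by (intro sum.cong refl) (simp add: inv)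
    also have "\<dots> = (\<Sum>c\<in>B. \<Sum>b\<in>B. ?\<beta> b (sg (d c)) *s \<Phi> c (sg (d b)))" by (rule sum.swap)
    also have "\<dots> = (\<Sum>c\<in>B. \<Phi> c (d c))"
    proof (rule sum.cong[OF refl])
      fix c assume c: "c \<in> B"
      have "sg (sg (d c) - (\<Sum>b\<in>B. ?\<beta> b (sg (d c)) *s d b)) \<in> N"
        by (rule sidealD(4)[OF Ni E2[OF salgD(4)[OF h dh[OF c]]]])
      then have "d c - (\<Sum>b\<in>B. ?\<beta> b (sg (d c)) *s sg (d b)) \<in> N"
        by (simp add: sg_simps lin_sum[OF lin_sg])
      from \<Phi>(4)[OF this Bh[OF c]] show "(\<Sum>b\<in>B. ?\<beta> b (sg (d c)) *s \<Phi> c (sg (d b))) = \<Phi> c (d c)"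
        by (simp add: lin_diff[OF \<Phi>(1)] lin_sum[OF \<Phi>(1)] lin_scale[OF \<Phi>(1)])
    qed
    finally show ?thesis .
  qed
  ultimately have "casimir h N W B d"
    unfolding casimir_def using fB Bh dh by auto
  then show ?thesis by blast
qed

end

section \<open>Levi's theorem with an involution\<close>

context inv_lie_space begin

lemma complement_sideal:
  assumes "salg h" "sideal h T" "T \<inter> N = {0}" "\<And>x. x \<in> h \<Longrightarrow> \<exists>t\<in>T. \<exists>n\<in>N. x = t + n"
  shows "complement h N T"
  unfolding complement_def using assms(3,4) sideal_salg[OF assms(1,2)] sidealD(3)[OF assms(2)] by auto

lemma minimal_exists:
  assumes h: "salg h" and N: "sideal h N" "N \<noteq> {0}"
  obtains M where "minimal h M" "M \<noteq> {0}" "M \<subseteq> N"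
proof -
  let ?P = "\<lambda>M. sideal h M \<and> M \<noteq> {0} \<and> M \<subseteq> N"
  obtain M where M: "?P M" "\<And>J. ?P J \<Longrightarrow> dim M \<le> dim J"
    using ex_has_least_nat[of ?P N dim] N by auto
  have "minimal h M"
    unfolding minimal_def
  proof (intro conjI allI impI)
    show "sideal h M" using M(1) by simp
    fix J assume J: "sideal h J" "J \<subseteq> M"
    show "J = {0} \<or> J = M"
    proof (rule disjCI)
      assume "J \<noteq> M"
      then have less: "dim J < dim M"
        using fd_dim_less[OF sideal_fd[OF h] sidealD(2)[OF J(1)] J(2)] M(1) by blast
      show "J = {0}"
      proof (rule ccontr)
        assume "J \<noteq> {0}"
        then have "dim M \<le> dim J" using J M(1) by (intro M(2)) blast
        then show False using less by simp
      qed
    qed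
  qed
  then show ?thesis using that M(1) by blast
qed

text \<open>The sum of \<open>derived h\<close> and \<open>N\<close> is a stable ideal, strictly
  larger than \<open>N\<close> because it contains \<open>lb x y\<close>.\<close>

lemma maximal_derived:
  assumes h: "salg h" and N: "maximal h N" and xy: "x \<in> h" "y \<in> h" "lb x y \<notin> N" and z: "z \<in> h"
  shows "\<exists>a\<in>derived h. \<exists>n\<in>N. z = a + n"
proof -
  have Ni: "sideal h N" using N by (simp add: maximal_def)
  let ?J = "{u + v |u v. u \<in> derived h \<and> v \<in> N}"
  have dd: "subspace (derived h)" unfolding derived_def by (rule subspace_span)
  have J: "sideal h ?J"
    by (rule sideal_plus[OF sideal_derived(1)[OF sideal_self[OF h]] Ni salgD(3)[OF h]])
  have "N \<subseteq> ?J"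
  proof
    fix n assume "n \<in> N"
    then have "n = 0 + n \<and> 0 \<in> derived h \<and> n \<in> N" using subspace_0[OF dd] by simp
    then show "n \<in> ?J" by blast
  qed
  moreover have "?J \<noteq> N"
  proof
    assume eq: "?J = N"
    have "lb x y \<in> derived h" unfolding derived_def using xy by (intro span_base) blast
    then have "lb x y = lb x y + 0 \<and> lb x y \<in> derived h \<and> 0 \<in> N"
      using subspace_0[OF sidealD(2)[OF Ni]] by simp
    then have "lb x y \<in> ?J" by blast
    then show False using eq xy(3) by simp
  qed
  ultimately have "?J = h" using N J unfolding maximal_def by blast
  then show ?thesis using z by blast
qed

lemma maximal_perfect_on:
  assumes h: "salg h" and N: "maximal h N" and xy: "x \<in> h" "y \<in> h" "lb x y \<notin> N"
    and triv: "\<And>n w. n \<in> N \<Longrightarrow> w \<in> W \<Longrightarrow> lb n w = 0"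
  shows "perfect_on W h"
  unfolding perfect_on_def
proof
  fix z assume "z \<in> h"
  then obtain a n where an: "a \<in> derived h" "n \<in> N" "z = a + n" using maximal_derived[OF h N xy] by blast
  then have "lb z w = lb a w" if "w \<in> W" for w using triv[OF an(2) that] by (simp add: lb_simps)
  then show "\<exists>x'\<in>derived h. \<forall>w\<in>W. lb z w = lb x' w" using an(1) by blast
qed

text \<open>By minimality \<open>derived N = N\<close>, so \<open>N\<close> acts perfectly on
  itself, and Cartan's criterion makes its trace form nonzero on \<open>N\<close>. The radical
  \<open>?T \<inter> N\<close> is then a proper stable subideal of the minimal \<open>N\<close>,
  hence zero, and nondegeneracy on \<open>N\<close> splits \<open>h\<close>.\<close>

lemma complement_nonabelian:
  assumes h: "salg h" and N: "minimal h N" and mn: "m0 \<in> N" "n0 \<in> N" "lb m0 n0 \<noteq> 0"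
  shows "\<exists>T. complement h N T"
proof -
  have Ni: "sideal h N" using N by (simp add: minimal_def)
  note fN = sideal_fd[OF h Ni] and sN = sidealD(1)[OF Ni] and Nh = sidealD(3)[OF Ni]
  let ?T = "{x \<in> h. \<forall>n\<in>N. tform N x n = 0}"
  have T: "sideal h ?T" by (rule tform_orthogonal_sideal[OF h Ni Ni])
  have "lb m0 n0 \<in> derived N" unfolding derived_def using mn by (intro span_base) blast
  then have "derived N \<noteq> {0}" using mn by blast
  then have dN: "derived N = N"
    using N sideal_derived[OF Ni] unfolding minimal_def by blast
  have sNN: "stable N N" using sN Nh by (auto simp: stable_def)
  have "sideal h (?T \<inter> N)"
  proof (rule sidealI)
    show "subspace (?T \<inter> N)" using sidealD(2)[OF T] sidealD(2)[OF Ni] by (rule subspace_inter)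
    show "?T \<inter> N \<subseteq> h" by blast
    fix x assume x: "x \<in> ?T \<inter> N"
    then show "sg x \<in> ?T \<inter> N" using sidealD(4)[OF T] sidealD(4)[OF Ni] by blast
    fix y assume "y \<in> h"
    then show "lb y x \<in> ?T \<inter> N" using sidealD(5)[OF T] sidealD(5)[OF Ni] x by blast
  qed
  moreover have "?T \<inter> N \<noteq> N"
  proof
    assume "?T \<inter> N = N"
    then have tf: "tform N x y = 0" if "x \<in> N" "y \<in> N" for x y using that by blast
    have "perfect_on N N" unfolding perfect_on_def dN by blast
    then have "lb m0 n0 = 0"
      by (rule cartan_criterion[OF salgD(1)[OF sideal_salg[OF h Ni]] fN sNN _ tf mn(1,2)])
    then show False using mn(3) by simp
  qed
  ultimately have int: "?T \<inter> N = {0}" using N unfolding minimal_def by blast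
  have bil: "bilinear_form h (tform N)" by (rule tform_bilinear[OF salgD(3)[OF h] fN sN])
  have bN: "bilinear_form N (tform N)" by (rule bilinear_form_subset[OF bil]) (use Nh in blast)
  have nd: "nondegenerate N (tform N)"
  proof (rule nondegenerateI)
    fix u assume "u \<in> N" "\<And>v. v \<in> N \<Longrightarrow> tform N u v = 0"
    then have "u \<in> ?T \<inter> N" using Nh by blast
    then show "u = 0" using int by blast
  qed
  have "\<exists>t\<in>?T. \<exists>n\<in>N. x = t + n" if x: "x \<in> h" for x
  proof -
    have lf: "linear_functional N (tform N x)"
      using bil x linear_functional_subset[of h _ N] Nh unfolding bilinear_form_def by blast
    obtain n where n: "n \<in> N" "\<And>v. v \<in> N \<Longrightarrow> tform N n v = tform N x v"
      by (rule riesz[OF fN bN nd lf]) (rule that)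
    have "tform N (x - n) v = 0" if v: "v \<in> N" for v
    proof -
      have lv: "linear_functional h (\<lambda>x. tform N x v)" using bil Nh[OF v] unfolding bilinear_form_def by blast
      show ?thesis
        using linear_functional_diff[OF lv salgD(3)[OF h] x Nh[OF n(1)]] n(2)[OF v] by simp
    qed
    then have "x - n \<in> ?T" using subspace_diff[OF salgD(3)[OF h] x Nh[OF n(1)]] by blast
    moreover have "x = (x - n) + n" by simp
    ultimately show ?thesis using n(1) by blast
  qed
  then show ?thesis using complement_sideal[OF h T int] by blast
qed

section \<open>The Casimir operator of a module and complements obtained from it\<close>

lemma lin_casimir_op: "lin (casimir_op B d)"
  unfolding casimir_op_def[abs_def] by (intro lin_sum_fun lin_compose[OF lin_lb_right lin_lb_right])

lemma casimirD:
  assumes "casimir h N W B d"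
  shows "finite B" "\<And>b. b \<in> B \<Longrightarrow> b \<in> h" "\<And>b. b \<in> B \<Longrightarrow> d b \<in> h" "trace W (casimir_op B d) \<noteq> 0"
    "\<And>\<Phi> z. bilinear_mod h N \<Phi> \<Longrightarrow> z \<in> h \<Longrightarrow> (\<Sum>b\<in>B. \<Phi> (lb z b) (d b)) = - (\<Sum>b\<in>B. \<Phi> b (lb z (d b)))"
    "\<And>\<Phi>. bilinear_mod h N \<Phi> \<Longrightarrow> (\<Sum>b\<in>B. \<Phi> (sg b) (sg (d b))) = (\<Sum>b\<in>B. \<Phi> b (d b))"
  using assms unfolding casimir_def by auto

lemma casimir_op_stable:
  assumes "casimir h N W B d" "stable h U" "w \<in> U"
  shows "casimir_op B d w \<in> U"
  unfolding casimir_op_def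
  using stableD[OF assms(2)] casimirD(2,3)[OF assms(1)] assms(3)
  by (intro subspace_sum[OF stable_subspace[OF assms(2)]]) auto

lemma bilinear_mod_lb:
  assumes "sideal h W" "\<And>n w. n \<in> N \<Longrightarrow> w \<in> W \<Longrightarrow> lb n w = 0" "w \<in> W"
  shows "bilinear_mod h N (\<lambda>u v. lb u (lb v w))"
  unfolding bilinear_mod_def
proof (intro conjI allI ballI)
  show "lin (\<lambda>v. lb u (lb v w))" for u by (rule lin_compose[OF lin_lb_right lin_lb_left])
  show "lin (\<lambda>u. lb u (lb v w))" for v by (rule lin_lb_left)
  fix n x assume n: "n \<in> N" and x: "x \<in> h"
  show "lb n (lb x w) = 0" using assms(2)[OF n sidealD(5)[OF assms(1) x assms(3)]] .
  show "lb x (lb n w) = 0" using assms(2)[OF n assms(3)] by (simp add: lb_simps)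
qed

text \<open>The Jacobi identity produces the two sums in the invariance of the Casimir element,
  which cancel, and the operator applied to \<open>lb z w\<close>.\<close>

lemma casimir_op_commute:
  assumes c: "casimir h N W B d" and W: "sideal h W"
    and triv: "\<And>n w. n \<in> N \<Longrightarrow> w \<in> W \<Longrightarrow> lb n w = 0" and z: "z \<in> h" and w: "w \<in> W"
  shows "lb z (casimir_op B d w) = casimir_op B d (lb z w)"
proof -
  have "lb z (casimir_op B d w) = (\<Sum>b\<in>B. lb z (lb b (lb (d b) w)))"
    unfolding casimir_op_def by (rule lb_sum_right)
  also have "\<dots> = (\<Sum>b\<in>B. lb (lb z b) (lb (d b) w) + (lb b (lb (lb z (d b)) w) + lb b (lb (d b) (lb z w))))"
  proof (rule sum.cong[OF refl])
    fix b
    have "lb z (lb b (lb (d b) w)) = lb (lb z b) (lb (d b) w) + lb b (lb z (lb (d b) w))" by (rule jacobi)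
    also have "lb z (lb (d b) w) = lb (lb z (d b)) w + lb (d b) (lb z w)" by (rule jacobi)
    finally show "lb z (lb b (lb (d b) w))
        = lb (lb z b) (lb (d b) w) + (lb b (lb (lb z (d b)) w) + lb b (lb (d b) (lb z w)))"
      by (simp only: lb_add_right)
  qed
  also have "\<dots> = (\<Sum>b\<in>B. lb (lb z b) (lb (d b) w)) + (\<Sum>b\<in>B. lb b (lb (lb z (d b)) w))
      + casimir_op B d (lb z w)"
    by (simp add: sum.distrib casimir_op_def)
  also have "(\<Sum>b\<in>B. lb (lb z b) (lb (d b) w)) = - (\<Sum>b\<in>B. lb b (lb (lb z (d b)) w))"
    using casimirD(5)[OF c bilinear_mod_lb[OF W triv w] z] by simp
  finally show ?thesis by simp
qed

lemma casimir_op_sg: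
  assumes c: "casimir h N W B d" and W: "sideal h W"
    and triv: "\<And>n w. n \<in> N \<Longrightarrow> w \<in> W \<Longrightarrow> lb n w = 0" and w: "w \<in> W"
  shows "sg (casimir_op B d w) = casimir_op B d (sg w)"
proof -
  have "sg (casimir_op B d w) = (\<Sum>b\<in>B. lb (sg b) (lb (sg (d b)) (sg w)))"
    unfolding casimir_op_def by (simp add: lin_sum[OF lin_sg] sg_simps)
  also have "\<dots> = casimir_op B d (sg w)"
    using casimirD(6)[OF c bilinear_mod_lb[OF W triv sidealD(4)[OF W w]]] by (simp add: casimir_op_def)
  finally show ?thesis .
qed

lemma casimir_kernel:
  assumes h: "salg h" and c: "casimir h N W B d" and W: "sideal h W"
    and triv: "\<And>n w. n \<in> N \<Longrightarrow> w \<in> W \<Longrightarrow> lb n w = 0"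
  shows "sideal h {w \<in> W. casimir_op B d w = 0}" "{w \<in> W. casimir_op B d w = 0} \<noteq> W"
proof -
  let ?K = "{w \<in> W. casimir_op B d w = 0}"
  note comm = casimir_op_commute[OF c W triv] and csg = casimir_op_sg[OF c W triv]
  show "sideal h ?K"
  proof (rule sidealI)
    show "subspace ?K" by (rule lin_subspace_kernel[OF lin_casimir_op sidealD(2)[OF W]])
    show "?K \<subseteq> h" using sidealD(3)[OF W] by blast
    fix x assume x: "x \<in> ?K"
    then show "sg x \<in> ?K" using csg[of x] sidealD(4)[OF W] by (simp add: sg_simps)
    fix y assume y: "y \<in> h"
    then show "lb y x \<in> ?K" using x comm[OF _ _ y, of x] sidealD(5)[OF W y] by (simp add: lb_simps)
  qed
  show "?K \<noteq> W"
  proof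
    assume "?K = W"
    then have "trace W (casimir_op B d) = 0" by (intro trace_zero sideal_fd[OF h W]) blast
    then show False using casimirD(4)[OF c] by simp
  qed
qed

text \<open>As \<open>N\<close> is central, it acts on \<open>h\<close> by zero, and the Casimir
  operator of \<open>h\<close> itself is available. Its kernel is a proper stable ideal containing
  \<open>N\<close>, hence \<open>N\<close>. Its image plus \<open>N\<close> is all of
  \<open>h\<close>: otherwise the image lies in \<open>N\<close>, the operator squares to zero and
  its trace vanishes. So the image is an ideal complementing \<open>N\<close>.\<close>

lemma complement_central:
  assumes h: "salg h" and N: "maximal h N" and xy: "x0 \<in> h" "y0 \<in> h" "lb x0 y0 \<notin> N"
    and cen: "\<And>x n. x \<in> h \<Longrightarrow> n \<in> N \<Longrightarrow> lb x n = 0"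
  shows "\<exists>T. complement h N T"
proof -
  have Ni: "sideal h N" using N by (simp add: maximal_def)
  note sh = salgD(3)[OF h] and Nh = sidealD(3)[OF Ni]
  have triv: "lb n x = 0" if "n \<in> N" "x \<in> h" for n x
    using cen[OF that(2,1)] lb_skew[of n x] by simp
  have hh: "sideal h h" by (rule sideal_self[OF h])
  have nt: "lb x0 y0 \<noteq> 0" using xy(3) subspace_0[OF sidealD(2)[OF Ni]] by metis
  have "perfect_on h h" using maximal_perfect_on[OF h N xy triv] .
  then obtain B d where c: "casimir h N h B d" using casimir_exists[OF h N hh triv _ xy(1,2) nt] by blast
  let ?C = "casimir_op B d"
  let ?K = "{w \<in> h. ?C w = 0}"
  have KN: "?K = N"
  proof -
    have "N \<subseteq> ?K"
    proof
      fix n assume n: "n \<in> N"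
      have "lb b (lb (d b) n) = 0" if "b \<in> B" for b
        using cen[OF casimirD(3)[OF c that] n] by (simp add: lb_simps)
      then show "n \<in> ?K" using Nh[OF n] by (simp add: casimir_op_def)
    qed
    then show ?thesis using N casimir_kernel[OF h c hh triv] unfolding maximal_def by blast
  qed
  have Ch: "?C ` h \<subseteq> h" using casimir_op_stable[OF c sidealD(1)[OF hh]] by blast
  have I: "sideal h (?C ` h)"
  proof (rule sidealI)
    show "subspace (?C ` h)" by (rule lin_subspace_image[OF lin_casimir_op sh])
    show "?C ` h \<subseteq> h" by (rule Ch)
    fix x assume "x \<in> ?C ` h"
    then obtain w where w: "w \<in> h" "x = ?C w" by blast
    have "sg x = ?C (sg w)" using casimir_op_sg[OF c hh triv] w by blast
    then show "sg x \<in> ?C ` h" using salgD(4)[OF h w(1)] by blast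
    fix y assume y: "y \<in> h"
    have "lb y x = ?C (lb y w)" using casimir_op_commute[OF c hh triv y] w by blast
    then show "lb y x \<in> ?C ` h" using salgD(5)[OF h y w(1)] by blast
  qed
  let ?J = "{u + v |u v. u \<in> ?C ` h \<and> v \<in> N}"
  have J: "sideal h ?J" by (rule sideal_plus[OF I Ni sh])
  have sub: "N \<subseteq> ?J" "?C ` h \<subseteq> ?J"
  proof
    fix n assume "n \<in> N"
    then have "n = 0 + n \<and> 0 \<in> ?C ` h \<and> n \<in> N" using subspace_0[OF sidealD(2)[OF I]] by simp
    then show "n \<in> ?J" by blast
  next
    show "?C ` h \<subseteq> ?J"
    proof
      fix n assume "n \<in> ?C ` h"
      then have "n = n + 0 \<and> n \<in> ?C ` h \<and> 0 \<in> N" using subspace_0[OF sidealD(2)[OF Ni]] by simp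
      then show "n \<in> ?J" by blast
    qed
  qed
  have "?J \<noteq> N"
  proof
    assume "?J = N"
    have "?C (?C w) = 0" if "w \<in> h" for w
    proof -
      have "?C w \<in> ?J" by (rule subsetD[OF sub(2) imageI[OF that]])
      then have "?C w \<in> ?K" unfolding \<open>?J = N\<close> KN .
      then show ?thesis by simp
    qed
    then have "trace h ?C = 0"
      by (intro trace_nilpotent[OF salgD(2)[OF h] lin_casimir_op Ch, of 2]) (simp add: numeral_2_eq_2)
    then show False using casimirD(4)[OF c] by simp
  qed
  then have Jh: "?J = h" using N J sub(1) unfolding maximal_def by blast
  have dec: "\<exists>t\<in>?C ` h. \<exists>n\<in>N. x = t + n" if "x \<in> h" for x
  proof -
    have "x \<in> ?J" unfolding Jh by (rule that)
    then show ?thesis by blast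
  qed
  have "?C ` (?C ` h) = ?C ` h"
  proof
    show "?C ` (?C ` h) \<subseteq> ?C ` h" using Ch by blast
    show "?C ` h \<subseteq> ?C ` (?C ` h)"
    proof
      fix y assume "y \<in> ?C ` h"
      then obtain x where x: "x \<in> h" "y = ?C x" by blast
      then obtain t n where tn: "t \<in> ?C ` h" "n \<in> N" "x = t + n" using dec by blast
      have "?C n = 0" using KN tn(2) by blast
      then have "y = ?C t" using x tn(3) by (simp add: lin_add[OF lin_casimir_op])
      then show "y \<in> ?C ` (?C ` h)" using tn(1) by blast
    qed
  qed
  then have inj: "x = 0" if "x \<in> ?C ` h" "?C x = 0" for x
    by (rule onto_imp_inj[OF lin_casimir_op _ sideal_fd[OF h I] that])
  have "?C ` h \<inter> N = {0}"
  proof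
    show "?C ` h \<inter> N \<subseteq> {0}"
    proof
      fix x assume x: "x \<in> ?C ` h \<inter> N"
      then have "x \<in> ?K" unfolding KN by blast
      then have "?C x = 0" by (rule CollectE) (erule conjunct2)
      then have "x = 0" by (rule inj[OF IntD1[OF x]])
      then show "x \<in> {0}" by simp
    qed
    show "{0} \<subseteq> ?C ` h \<inter> N" using subspace_0[OF sidealD(2)[OF I]] subspace_0[OF sidealD(2)[OF Ni]] by blast
  qed
  then have "complement h N (?C ` h)" by (rule complement_sideal[OF h I _ dec])
  then show ?thesis by blast
qed

text \<open>Whitehead's second lemma: \<open>F\<close> is the coboundary of a projection \<open>P\<close> onto \<open>N\<close>, hence a
  2-cocycle of \<open>h / N\<close>; the Casimir operator \<open>C\<close> makes \<open>C \<circ> F\<close> the coboundary of \<open>g\<close>, so that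
  \<open>C \<circ> P - g\<close> is a derivation \<open>h \<rightarrow> N\<close> extending \<open>C\<close>, and its kernel is a complement.\<close>

lemma complement_abelian:
  assumes h: "salg h" and N: "maximal h N" "minimal h N" and xy: "x0 \<in> h" "y0 \<in> h" "lb x0 y0 \<notin> N"
    and ab: "\<And>m n. m \<in> N \<Longrightarrow> n \<in> N \<Longrightarrow> lb m n = 0" and nt: "x1 \<in> h" "n1 \<in> N" "lb x1 n1 \<noteq> 0"
  shows "\<exists>T. complement h N T"
proof -
  have Ni: "sideal h N" using N by (simp add: maximal_def)
  note sh = salgD(3)[OF h] and Nh = sidealD(3)[OF Ni] and sN = sidealD(2)[OF Ni]
  have "perfect_on N h" using maximal_perfect_on[OF h N(1) xy ab] .
  then obtain B d where c: "casimir h N N B d" using casimir_exists[OF h N(1) Ni ab _ nt] by blast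
  let ?C = "casimir_op B d"
  note Bh = casimirD(2)[OF c] and dh = casimirD(3)[OF c]
  note linC = lin_casimir_op[of B d]
  note comm = casimir_op_commute[OF c Ni ab] and csg = casimir_op_sg[OF c Ni ab]
  have CN: "?C n \<in> N" if "n \<in> N" for n using casimir_op_stable[OF c sidealD(1)[OF Ni] that] .
  have inj: "n = 0" if "n \<in> N" "?C n = 0" for n
  proof -
    have "{w \<in> N. ?C w = 0} = {0}"
      using N(2) casimir_kernel[OF h c Ni ab] unfolding minimal_def by blast
    then show ?thesis using that by blast
  qed
  obtain r where r: "lin r" "\<And>x. r x \<in> h" "\<And>x. r (r x) = r x" "\<And>x. x \<in> N \<Longrightarrow> r x = 0" "\<And>x. x \<in> h \<Longrightarrow> x - r x \<in> N"
    by (rule projection_exists[OF sh sN]) (use Nh in blast, rule that)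
  define P where "P x = x - r x" for x
  have linP: "lin P" unfolding P_def[abs_def] by (rule lin_minus[OF lin_ident r(1)])
  note P_simps = lin_add[OF linP] lin_diff[OF linP] lin_neg[OF linP] lin_0[OF linP]
  have PN: "P x \<in> N" if "x \<in> h" for x using r(5)[OF that] by (simp add: P_def)
  have Pn: "P n = n" if "n \<in> N" for n using r(4)[OF that] by (simp add: P_def)
  define F where "F v z = lb v (P z) - lb z (P v) - P (lb v z)" for v z
  have FN: "F v z \<in> N" if "v \<in> h" "z \<in> h" for v z
    unfolding F_def using that PN salgD(5)[OF h] sidealD(5)[OF Ni] sN by (intro subspace_diff) auto
  have Fskew: "F v z = - F z v" for v z
    using lb_skew[of v z] by (simp add: F_def P_simps)
  have F0: "F n z = 0" if n: "n \<in> N" and z: "z \<in> h" for n z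
    using Pn[OF n] Pn[OF sideal_left[OF Ni n z]] ab[OF n PN[OF z]] lb_skew[of n z] by (simp add: F_def)
  have F0': "F z n = 0" if "n \<in> N" "z \<in> h" for n z using F0[OF that] Fskew[of z n] by simp
  have linFr: "lin (F v)" for v
    unfolding F_def[abs_def]
    by (intro lin_minus lin_compose[OF lin_lb_right linP] lin_lb_left lin_compose[OF linP lin_lb_right])
  have linFl: "lin (\<lambda>v. F v z)" for z
    unfolding F_def[abs_def]
    by (intro lin_minus lin_lb_left lin_compose[OF lin_lb_right linP] lin_compose[OF linP lin_lb_left])
  \<comment> \<open>The coboundary of a coboundary vanishes; the terms with \<open>P\<close> applied
    to a double bracket cancel by the Jacobi identity.\<close>
  have cocycle: "lb u (F z w) = lb z (F u w) - lb w (F u z) + F (lb u z) w - F (lb u w) z + F (lb z w) u"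
    for u z w
  proof -
    have "P (lb (lb u z) w) - P (lb (lb u w) z) + P (lb (lb z w) u)
        = P (lb (lb u z) w - lb (lb u w) z + lb (lb z w) u)" by (simp add: P_simps)
    also have "lb (lb u z) w - lb (lb u w) z + lb (lb z w) u = 0"
    proof -
      have "lb (lb z w) u = - (lb (lb u z) w + lb z (lb u w))"
        using lb_skew[of "lb z w" u] jacobi[of u z w] by simp
      then show ?thesis using lb_skew[of "lb u w" z] by simp
    qed
    finally have J: "P (lb (lb u z) w) - P (lb (lb u w) z) + P (lb (lb z w) u) = 0" by (simp add: P_simps)
    show ?thesis
      using J unfolding F_def by (simp add: lb_simps lb_lb_left algebra_simps)
  qed
  \<comment> \<open>The Casimir element contracted with the first argument of
    \<open>F\<close>.\<close>
  define g where "g z = (\<Sum>b\<in>B. lb b (F (d b) z))" for z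
  have bmF: "bilinear_mod h N (\<lambda>u v. lb u (F v w))" if w: "w \<in> h" for w
    unfolding bilinear_mod_def
  proof (intro conjI allI ballI)
    show "lin (\<lambda>v. lb u (F v w))" for u by (rule lin_compose[OF lin_lb_right linFl])
    show "lin (\<lambda>u. lb u (F v w))" for v by (rule lin_lb_left)
    fix n x assume n: "n \<in> N" and x: "x \<in> h"
    show "lb n (F x w) = 0" by (rule ab[OF n FN[OF x w]])
    show "lb x (F n w) = 0" using F0[OF n w] by (simp add: lb_simps)
  qed
  \<comment> \<open>Invariance of the Casimir element trades a bracket with \<open>z\<close> outside
    \<open>F\<close> for one inside its first argument.\<close>
  have push: "(\<Sum>b\<in>B. lb b (lb z (F (d b) w))) = lb z (g w) - (\<Sum>b\<in>B. lb b (F (lb (d b) z) w))"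
    if z: "z \<in> h" and w: "w \<in> h" for z w
  proof -
    have "lb z (g w) = (\<Sum>b\<in>B. lb (lb z b) (F (d b) w) + lb b (lb z (F (d b) w)))"
      unfolding g_def lb_sum_right by (rule sum.cong[OF refl]) (rule jacobi)
    also have "\<dots> = (\<Sum>b\<in>B. lb (lb z b) (F (d b) w)) + (\<Sum>b\<in>B. lb b (lb z (F (d b) w)))"
      by (rule sum.distrib)
    also have "(\<Sum>b\<in>B. lb (lb z b) (F (d b) w)) = - (\<Sum>b\<in>B. lb b (F (lb z (d b)) w))"
      using casimirD(5)[OF c bmF[OF w] z] by simp
    also have "\<dots> = (\<Sum>b\<in>B. lb b (F (lb (d b) z) w))"
      unfolding sum_negf[symmetric]
    proof (rule sum.cong[OF refl])
      fix b
      have "F (lb z (d b)) w = F (- lb (d b) z) w" using lb_skew[of z "d b"] by simp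
      then show "- lb b (F (lb z (d b)) w) = lb b (F (lb (d b) z) w)"
        by (simp add: lin_neg[OF linFl] lb_simps)
    qed
    finally show ?thesis by simp
  qed
  have CF: "?C (F z w) = lb z (g w) - lb w (g z) - g (lb z w)" if z: "z \<in> h" and w: "w \<in> h" for z w
  proof -
    \<comment> \<open>The cocycle identity at each \<open>d b\<close> yields five sums. By
      \<open>push\<close>, the third and fourth cancel, and the last is \<open>- g (lb z w)\<close>
      by skew symmetry.\<close>
    have "?C (F z w) = (\<Sum>b\<in>B. lb b (lb z (F (d b) w) - lb w (F (d b) z) + F (lb (d b) z) w
        - F (lb (d b) w) z + F (lb z w) (d b)))"
      unfolding casimir_op_def by (rule sum.cong[OF refl]) (simp only: cocycle[symmetric])
    also have "\<dots> = (\<Sum>b\<in>B. lb b (lb z (F (d b) w))) - (\<Sum>b\<in>B. lb b (lb w (F (d b) z)))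
        + (\<Sum>b\<in>B. lb b (F (lb (d b) z) w)) - (\<Sum>b\<in>B. lb b (F (lb (d b) w) z))
        + (\<Sum>b\<in>B. lb b (F (lb z w) (d b)))"
      by (simp add: lb_add_right lb_diff_right sum.distrib sum_subtractf)
    also have "(\<Sum>b\<in>B. lb b (F (lb z w) (d b))) = - g (lb z w)"
      unfolding g_def sum_negf[symmetric]
      by (rule sum.cong[OF refl]) (subst Fskew, simp add: lb_simps)
    finally show ?thesis using push[OF z w] push[OF w z] by simp
  qed
  define Q where "Q z = ?C (P z) - g z" for z
  have linQ: "lin Q"
    unfolding Q_def[abs_def] g_def[abs_def]
    by (intro lin_minus lin_compose[OF linC linP] lin_sum_fun lin_compose[OF lin_lb_right linFr])
  have der: "Q (lb z w) = lb z (Q w) - lb w (Q z)" if z: "z \<in> h" and w: "w \<in> h" for z w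
  proof -
    have "?C (F z w) = ?C (lb z (P w)) - ?C (lb w (P z)) - ?C (P (lb z w))"
      unfolding F_def by (simp add: lin_diff[OF linC])
    also have "\<dots> = lb z (?C (P w)) - lb w (?C (P z)) - ?C (P (lb z w))"
      using comm[OF _ _ z PN[OF w]] comm[OF _ _ w PN[OF z]] by simp
    finally show ?thesis using CF[OF z w] by (simp add: Q_def lb_simps algebra_simps)
  qed
  have gN: "g z \<in> N" if "z \<in> h" for z
    unfolding g_def using Bh dh FN[OF _ that] sidealD(5)[OF Ni] by (intro subspace_sum[OF sN]) auto
  have QN: "Q z \<in> N" if "z \<in> h" for z
    unfolding Q_def using CN[OF PN[OF that]] gN[OF that] by (rule subspace_diff[OF sN])
  have Qn: "Q n = ?C n" if n: "n \<in> N" for n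
    unfolding Q_def g_def using Pn[OF n] F0'[OF n dh] by (simp add: lb_simps)
  \<comment> \<open>Adding the conjugate of \<open>Q\<close> under \<open>sg\<close> makes the
    kernel stable under the involution. Since the Casimir operator commutes with \<open>sg\<close>,
    the sum acts on \<open>N\<close> as twice that operator and stays injective there.\<close>
  define D where "D z = Q z + sg (Q (sg z))" for z
  have linD: "lin D"
    unfolding D_def[abs_def] by (intro lin_plus linQ lin_compose[OF lin_sg lin_compose[OF linQ lin_sg]])
  have DN: "D z \<in> N" if "z \<in> h" for z
    unfolding D_def
    using QN[OF that] sidealD(4)[OF Ni QN[OF salgD(4)[OF h that]]] by (rule subspace_add[OF sN])
  have derD: "D (lb z w) = lb z (D w) - lb w (D z)" if z: "z \<in> h" and w: "w \<in> h" for z w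
    using der[OF z w] der[OF salgD(4)[OF h z] salgD(4)[OF h w]]
    by (simp add: D_def sg_simps lb_simps)
  have Dsg: "D (sg z) = sg (D z)" for z by (simp add: D_def sg_simps add.commute)
  have Dn: "D n = 2 *s ?C n" if n: "n \<in> N" for n
  proof -
    have e: "sg (?C n) = ?C (sg n)" by (rule csg[OF _ _ n])
    have "sg (Q (sg n)) = ?C n" unfolding Qn[OF sidealD(4)[OF Ni n]] e[symmetric] by (rule sg_sg)
    then show ?thesis using Qn[OF n] scale_left_distrib[of 1 1 "?C n"] by (simp add: D_def)
  qed
  have injD: "n = 0" if "n \<in> N" "D n = 0" for n using inj[OF that(1)] Dn[OF that(1)] that(2) by simp
  have DNN: "D ` N = N"
    by (rule inj_imp_onto[OF linD _ sideal_fd[OF h Ni] injD]) (use DN Nh in auto)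
  let ?T = "{x \<in> h. D x = 0}"
  have sT: "subspace ?T" by (rule lin_subspace_kernel[OF linD sh])
  have "complement h N ?T"
    unfolding complement_def
  proof (intro conjI ballI)
    have "lb x y \<in> ?T" if "x \<in> ?T" "y \<in> ?T" for x y
      using that derD[of x y] salgD(5)[OF h] by (simp add: lb_simps)
    moreover have "sg x \<in> ?T" if "x \<in> ?T" for x
      using that salgD(4)[OF h] by (simp add: Dsg sg_simps)
    moreover have "fd ?T" by (rule fd_subset[OF salgD(2)[OF h] sT]) blast
    ultimately show "salg ?T" by (simp add: salg_def subalg_def)
    show "?T \<subseteq> h" by blast
    show "?T \<inter> N = {0}" using injD subspace_0[OF sT] subspace_0[OF sN] by blast
    fix x assume x: "x \<in> h"
    have "D x \<in> D ` N" unfolding DNN by (rule DN[OF x])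
    then obtain n where n: "n \<in> N" "D x = D n" by blast
    have "x - n \<in> ?T" using n x subspace_diff[OF sh x Nh[OF n(1)]] by (simp add: lin_diff[OF linD])
    moreover have "x = (x - n) + n" by simp
    ultimately show "\<exists>t\<in>?T. \<exists>n\<in>N. x = t + n" using n(1) by blast
  qed
  then show ?thesis by blast
qed

lemma complement_minimal:
  assumes h: "salg h" and N: "maximal h N" "minimal h N" and xy: "x0 \<in> h" "y0 \<in> h" "lb x0 y0 \<notin> N"
  shows "\<exists>T. complement h N T"
proof (cases "\<exists>m\<in>N. \<exists>n\<in>N. lb m n \<noteq> 0")
  case True
  then show ?thesis using complement_nonabelian[OF h N(2)] by blast
next
  case False
  then have ab: "lb m n = 0" if "m \<in> N" "n \<in> N" for m n using that by blast
  show ?thesis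
  proof (cases "\<exists>x\<in>h. \<exists>n\<in>N. lb x n \<noteq> 0")
    case True
    then obtain x n where "x \<in> h" "n \<in> N" "lb x n \<noteq> 0" by blast
    then show ?thesis by (intro complement_abelian[OF h N xy ab])
  next
    case False
    then have "lb x n = 0" if "x \<in> h" "n \<in> N" for x n using that by blast
    then show ?thesis by (intro complement_central[OF h N(1) xy])
  qed
qed

end

section \<open>Reduction of Levi's theorem to minimal ideals\<close>

context alg_closed_space begin

text \<open>If \<open>N\<close> properly contains a nonzero minimal ideal \<open>M\<close>,
  complement \<open>N / M\<close> in \<open>h / M\<close>, let \<open>T\<close> be the preimage,
  which meets \<open>N\<close> in \<open>M\<close>, and complement \<open>M\<close> in
  \<open>T\<close>. The induction generalises over \<open>lb\<close> and \<open>sg\<close> because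
  \<open>h / M\<close> is realised in the same type with other operations.\<close>

theorem levi_complement:
  assumes "inv_lie_space scale lb sg" "inv_lie_space.salg scale lb sg h"
    "inv_lie_space.maximal scale lb sg h N" "x \<in> h" "y \<in> h" "lb x y \<notin> N"
  shows "\<exists>T. inv_lie_space.complement scale lb sg h N T"
  using assms
proof (induction "dim N" arbitrary: lb sg h N x y rule: less_induct)
  case less
  interpret inv_lie_space scale lb sg by (rule less(2))
  note h = less(3) and N = less(4) and xy = less(5-7)
  have Ni: "sideal h N" using N by (simp add: maximal_def)
  note sh = salgD(3)[OF h] and Nh = sidealD(3)[OF Ni] and sN = sidealD(2)[OF Ni]
  show ?case
  proof (cases "N = {0}")
    case True
    have "complement h N h"
      by (rule complement_sideal[OF h sideal_self[OF h]]) (use True subspace_0[OF sh] in auto)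
    then show ?thesis by blast
  next
    case False
    obtain M where M: "minimal h M" "M \<noteq> {0}" "M \<subseteq> N" using minimal_exists[OF h Ni False] .
    have Mi: "sideal h M" using M(1) by (simp add: minimal_def)
    note sM = sidealD(2)[OF Mi] and Mh = sidealD(3)[OF Mi]
    show ?thesis
    proof (cases "M = N")
      case True
      then show ?thesis using complement_minimal[OF h N _ xy] M(1) by blast
    next
      case MN: False
      have dimM: "dim M < dim N" by (rule fd_dim_less[OF sideal_fd[OF h Ni] sM M(3) MN])
      obtain r where r: "lin r" "\<And>x. r x \<in> h" "\<And>x. r (r x) = r x" "\<And>x. x \<in> M \<Longrightarrow> r x = 0" "\<And>x. x \<in> h \<Longrightarrow> x - r x \<in> M"
        by (rule projection_exists[OF sh sM]) (use Mh in blast, rule that)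
      note r_simps = lin_add[OF r(1)] lin_diff[OF r(1)] lin_scale[OF r(1)] lin_0[OF r(1)] lin_neg[OF r(1)]
      have rM: "r u = r v" if "u - v \<in> M" for u v using r(4)[OF that] by (simp add: r_simps)
      have q: "r (lb u (r w)) = r (lb u w)" if "u \<in> h" "w \<in> h" for u w
      proof -
        have "lb u w - lb u (r w) \<in> M"
          using sidealD(5)[OF Mi that(1) r(5)[OF that(2)]] by (simp add: lb_simps)
        then show ?thesis using rM by metis
      qed
      have q': "r (lb (r w) u) = r (lb w u)" if "u \<in> h" "w \<in> h" for u w
        using q[OF that] lb_skew[of "r w" u] lb_skew[of w u] by (simp add: r_simps)
      have qs: "r (sg (r w)) = r (sg w)" if "w \<in> h" for w
      proof -
        have "sg w - sg (r w) \<in> M" using sidealD(4)[OF Mi r(5)[OF that]] by (simp add: sg_simps)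
        then show ?thesis using rM by metis
      qed
      define lb' where "lb' x y = r (lb (r x) (r y))" for x y
      \<comment> \<open>The summand \<open>x - r x\<close> makes \<open>sg'\<close> an involution of
        the whole type, not only of the range of \<open>r\<close>.\<close>
      define sg' where "sg' x = r (sg (r x)) + (x - r x)" for x
      have rh: "lb (r x) (r y) \<in> h" "sg (r x) \<in> h" for x y
        using salgD(4,5)[OF h] r(2) by auto
      have r_lb: "lb' (r a) (r b) = r (lb a b)" if "a \<in> h" "b \<in> h" for a b
        using q[OF r(2) that(2), of a] q'[OF that(2,1)] by (simp add: lb'_def r(3))
      have r_sg: "sg' (r a) = r (sg a)" if "a \<in> h" for a
        using qs[OF that] by (simp add: sg'_def r(3))
      have "inv_lie_space scale lb' sg'"
      proof (intro inv_lie_space.intro inv_lie_space_axioms.intro lie_space.intro lie_space_axioms.intro alg_closed_space_axioms)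
        show "lin (lb' x)" for x
          unfolding lb'_def[abs_def] by (rule lin_compose[OF r(1) lin_compose[OF lin_lb_right r(1)]])
        show "lin (\<lambda>x. lb' x y)" for y
          unfolding lb'_def by (rule lin_compose[OF r(1) lin_compose[OF lin_lb_left r(1)]])
        show "lb' x y = - lb' y x" for x y
          unfolding lb'_def using lb_skew[of "r x" "r y"] by (simp add: r_simps)
        show "lb' x (lb' y z) = lb' (lb' x y) z + lb' y (lb' x z)" for x y z
        proof -
          have 1: "lb' u (lb' v w) = r (lb (r u) (lb (r v) (r w)))" for u v w
            unfolding lb'_def r(3) by (rule q[OF r(2) rh(1)])
          have 2: "lb' (lb' u v) w = r (lb (lb (r u) (r v)) (r w))" for u v w
            unfolding lb'_def r(3) by (rule q'[OF r(2) rh(1)])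
          show ?thesis unfolding 1 2 using jacobi[of "r x" "r y" "r z"] by (simp add: r_simps)
        qed
        show "lin sg'"
          unfolding sg'_def[abs_def]
          by (intro lin_plus lin_minus lin_ident r(1) lin_compose[OF r(1) lin_compose[OF lin_sg r(1)]])
        have rs: "r (sg' x) = r (sg (r x))" for x by (simp add: sg'_def r_simps r(3))
        show "sg' (sg' x) = x" for x
        proof -
          have "r (sg (r (sg' x))) = r (sg (sg (r x)))" unfolding rs by (rule qs[OF rh(2)])
          then show ?thesis unfolding sg'_def[of "sg' x"] rs by (simp add: sg_sg r(3)) (simp add: sg'_def)
        qed
        show "sg' (lb' x y) = lb' (sg' x) (sg' y)" for x y
        proof -
          have "sg' (lb' x y) = r (sg (lb (r x) (r y)))"
            unfolding lb'_def by (rule r_sg[OF rh(1)])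
          also have "\<dots> = r (lb (sg (r x)) (sg (r y)))" by (simp add: sg_lb)
          also have "\<dots> = r (lb (r (sg (r x))) (r (sg (r y))))"
            using q[OF r(2) rh(2), of "sg (r x)" y] q'[OF rh(2) rh(2), of x y] by simp
          finally show ?thesis by (simp add: lb'_def rs)
        qed
      qed
      then interpret Q: inv_lie_space scale lb' sg' .
      let ?h = "r ` h" and ?N = "r ` N"
      have rN: "r n \<in> N" if "n \<in> N" for n
      proof -
        have "n - (n - r n) \<in> N" by (rule subspace_diff[OF sN that subsetD[OF M(3) r(5)[OF Nh[OF that]]]])
        then show ?thesis by simp
      qed
      have hQ: "Q.salg ?h"
        unfolding Q.salg_def Q.subalg_def
        using fd_image[OF r(1) salgD(2)[OF h]] r_lb r_sg salgD(4,5)[OF h] by auto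
      have NQ: "Q.sideal ?h ?N"
      proof (rule Q.sidealI)
        show "subspace ?N" by (rule lin_subspace_image[OF r(1) sN])
        show "?N \<subseteq> ?h" using Nh by blast
        fix a assume "a \<in> ?N"
        then obtain n where n: "n \<in> N" "a = r n" by blast
        show "sg' a \<in> ?N" using r_sg[OF Nh[OF n(1)]] sidealD(4)[OF Ni n(1)] n(2) by simp
        fix b assume "b \<in> ?h"
        then obtain w where w: "w \<in> h" "b = r w" by blast
        show "lb' b a \<in> ?N" using r_lb[OF w(1) Nh[OF n(1)]] sidealD(5)[OF Ni w(1) n(1)] n(2) w(2) by simp
      qed
      have maxQ: "Q.maximal ?h ?N"
        unfolding Q.maximal_def
      proof (intro conjI allI impI NQ)
        fix J assume J: "Q.sideal ?h J" "?N \<subseteq> J"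
        let ?J = "{x \<in> h. r x \<in> J}"
        have "sideal h ?J"
        proof (rule sidealI)
          show "subspace ?J" by (rule lin_subspace_preimage[OF r(1) sh Q.sidealD(2)[OF J(1)]])
          show "?J \<subseteq> h" by blast
          fix a assume a: "a \<in> ?J"
          then show "sg a \<in> ?J" using Q.sidealD(4)[OF J(1), of "r a"] r_sg salgD(4)[OF h] by simp
          fix b assume b: "b \<in> h"
          then show "lb b a \<in> ?J"
            using a Q.sidealD(5)[OF J(1), of "r b" "r a"] r_lb salgD(5)[OF h] by simp
        qed
        moreover have "N \<subseteq> ?J" using Nh J(2) by blast
        ultimately have "?J = N \<or> ?J = h" using N unfolding maximal_def by blast
        moreover have "J = r ` ?J" using Q.sidealD(3)[OF J(1)] by blast
        ultimately show "J = ?N \<or> J = ?h" by metis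
      qed
      have "?N \<noteq> N"
      proof
        assume eq: "?N = N"
        have "m = 0" if m: "m \<in> M" for m
        proof -
          have "m \<in> ?N" using m M(3) eq by blast
          then have "r m = m" using r(3) by auto
          then show ?thesis using r(4)[OF m] by simp
        qed
        then show False using M(2) subspace_0[OF sM] by blast
      qed
      then have dimN: "dim ?N < dim N"
        using rN by (intro fd_dim_less[OF sideal_fd[OF h Ni] lin_subspace_image[OF r(1) sN]]) auto
      have "lb' (r x) (r y) \<notin> ?N"
      proof
        assume "lb' (r x) (r y) \<in> ?N"
        then have "r (lb x y) \<in> N" using r_lb[OF xy(1,2)] rN by auto
        moreover have "lb x y - r (lb x y) \<in> N" using r(5)[OF salgD(5)[OF h xy(1,2)]] M(3) by blast
        ultimately have "(lb x y - r (lb x y)) + r (lb x y) \<in> N" by (intro subspace_add[OF sN])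
        then show False using xy(3) by simp
      qed
      then obtain T' where T': "Q.complement ?h ?N T'"
        using less(1)[OF dimN Q.inv_lie_space_axioms hQ maxQ imageI[OF xy(1)] imageI[OF xy(2)]] by blast
      have T's: "Q.salg T'" "T' \<subseteq> ?h" "T' \<inter> ?N = {0}" using T' by (simp_all add: Q.complement_def)
      define T where "T = {x \<in> h. r x \<in> T'}"
      have sT: "subspace T" unfolding T_def by (rule lin_subspace_preimage[OF r(1) sh Q.salgD(3)[OF T's(1)]])
      have T: "salg T"
        unfolding salg_def subalg_def
      proof (intro conjI ballI)
        show "fd T" by (rule fd_subset[OF salgD(2)[OF h] sT]) (auto simp: T_def)
        fix a assume a: "a \<in> T"
        then show "sg a \<in> T"
          using Q.salgD(4)[OF T's(1), of "r a"] r_sg salgD(4)[OF h] by (simp add: T_def)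
        fix b assume "b \<in> T"
        then show "lb a b \<in> T"
          using a Q.salgD(5)[OF T's(1), of "r a" "r b"] r_lb salgD(5)[OF h] by (simp add: T_def)
      qed
      have Th: "x \<in> h" if "x \<in> T" for x using that by (simp add: T_def)
      have MT: "M \<subseteq> T"
        using Mh r(4) subspace_0[OF Q.salgD(3)[OF T's(1)]] by (auto simp: T_def)
      have TN: "x \<in> M" if "x \<in> T" "x \<in> N" for x
      proof -
        have "r x \<in> T' \<inter> ?N" using that by (auto simp: T_def)
        then have "r x = 0" using T's(3) by blast
        then show ?thesis using r(5)[OF Th[OF that(1)]] by simp
      qed
      have dec: "\<exists>t\<in>T. \<exists>n\<in>N. x = t + n" if x: "x \<in> h" for x
      proof -
        have "\<forall>x\<in>?h. \<exists>t\<in>T'. \<exists>n\<in>?N. x = t + n" using T' by (simp add: Q.complement_def)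
        then obtain t n where tn: "t \<in> T'" "n \<in> N" "r x = t + r n" using x by blast
        then have "r (x - n) = t" by (simp add: r_simps)
        then have "x - n \<in> T" using tn(1) subspace_diff[OF sh x Nh[OF tn(2)]] by (simp add: T_def)
        moreover have "x = (x - n) + n" by simp
        ultimately show ?thesis using tn(2) by blast
      qed
      have MiT: "sideal T M"
        by (rule sidealI[OF sM MT]) (use sidealD(4,5)[OF Mi] Th in auto)
      have maxT: "maximal T M"
        unfolding maximal_def
      proof (intro conjI allI impI MiT)
        fix J assume J: "sideal T J" "M \<subseteq> J"
        let ?J = "{u + v |u v. u \<in> J \<and> v \<in> N}"
        have Jh: "u \<in> h" if "u \<in> J" for u using Th[OF sidealD(3)[OF J(1) that]] .
        have "sideal h ?J"
        proof (rule sidealI)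
          show "subspace ?J" by (rule subspace_plus[OF sidealD(2)[OF J(1)] sN])
          show "?J \<subseteq> h" using Jh Nh subspace_add[OF sh] by blast
          fix a assume "a \<in> ?J"
          then obtain u v where uv: "u \<in> J" "v \<in> N" "a = u + v" by blast
          have "sg a = sg u + sg v" using uv by (simp add: sg_simps)
          then show "sg a \<in> ?J" using sidealD(4)[OF J(1) uv(1)] sidealD(4)[OF Ni uv(2)] by blast
          fix b assume "b \<in> h"
          then obtain t n where tn: "t \<in> T" "n \<in> N" "b = t + n" using dec by blast
          have "lb b a = lb t u + (lb n u + lb b v)" using uv(3) tn(3) by (simp add: lb_simps)
          moreover have "lb n u + lb b v \<in> N"
            using sideal_left[OF Ni tn(2) Jh[OF uv(1)]] sidealD(5)[OF Ni \<open>b \<in> h\<close> uv(2)]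
            by (rule subspace_add[OF sN])
          ultimately show "lb b a \<in> ?J" using sidealD(5)[OF J(1) tn(1) uv(1)] by blast
        qed
        moreover have "N \<subseteq> ?J"
        proof
          fix n assume "n \<in> N"
          then have "n = 0 + n \<and> 0 \<in> J \<and> n \<in> N" using subspace_0[OF sidealD(2)[OF J(1)]] by simp
          then show "n \<in> ?J" by blast
        qed
        ultimately consider "?J = N" | "?J = h" using N unfolding maximal_def by blast
        then show "J = M \<or> J = T"
        proof cases
          case 1
          have "J \<subseteq> M"
          proof
            fix j assume j: "j \<in> J"
            then have "j = j + 0 \<and> j \<in> J \<and> 0 \<in> N" using subspace_0[OF sN] by simp
            then have "j \<in> ?J" by blast
            then have "j \<in> N" unfolding 1 .
            then show "j \<in> M" using TN sidealD(3)[OF J(1) j] by blast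
          qed
          then show ?thesis using J(2) by blast
        next
          case 2
          have "T \<subseteq> J"
          proof
            fix t assume t: "t \<in> T"
            then have "t \<in> ?J" unfolding 2 by (rule Th)
            then obtain j n where jn: "j \<in> J" "n \<in> N" "t = j + n" by blast
            have "n = t - j" using jn(3) by simp
            then have "n \<in> T" using subspace_diff[OF sT t sidealD(3)[OF J(1) jn(1)]] by simp
            then have "n \<in> J" using TN jn(2) J(2) by blast
            then show "t \<in> J" unfolding jn(3) using jn(1) by (intro subspace_add[OF sidealD(2)[OF J(1)]])
          qed
          then show ?thesis using sidealD(3)[OF J(1)] by blast
        qed
      qed
      \<comment> \<open>The second use of the induction hypothesis requires a nonabelian quotient
        \<open>T / M\<close>. If it were abelian, decomposing \<open>x\<close> and \<open>y\<close>
        along \<open>T\<close> and \<open>N\<close> would put \<open>lb x y\<close> into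
        \<open>N\<close>.\<close>
      have "\<exists>a\<in>T. \<exists>b\<in>T. lb a b \<notin> M"
      proof (rule ccontr)
        assume "\<not> (\<exists>a\<in>T. \<exists>b\<in>T. lb a b \<notin> M)"
        then have TM: "lb a b \<in> M" if "a \<in> T" "b \<in> T" for a b using that by blast
        obtain t n t' n' where tn: "t \<in> T" "n \<in> N" "x = t + n" "t' \<in> T" "n' \<in> N" "y = t' + n'"
          using dec[OF xy(1)] dec[OF xy(2)] by blast
        have "lb x y = lb t t' + (lb t n' + lb n y)" using tn(3,6) by (simp add: lb_simps)
        moreover have "lb t t' \<in> N" using TM tn(1,4) M(3) by blast
        moreover have "lb t n' \<in> N" by (rule sidealD(5)[OF Ni Th[OF tn(1)] tn(5)])
        moreover have "lb n y \<in> N" by (rule sideal_left[OF Ni tn(2) xy(2)])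
        ultimately show False using xy(3) subspace_add[OF sN] by simp
      qed
      then obtain a b where ab: "a \<in> T" "b \<in> T" "lb a b \<notin> M" by blast
      obtain S where S: "complement T M S"
        using less(1)[OF dimM less(2) T maxT ab] by blast
      have SD: "salg S" "S \<subseteq> T" "S \<inter> M = {0}" "\<forall>x\<in>T. \<exists>t\<in>S. \<exists>n\<in>M. x = t + n"
        using S by (simp_all add: complement_def)
      have "complement h N S"
        unfolding complement_def
      proof (intro conjI ballI)
        show "salg S" by (rule SD)
        show "S \<subseteq> h" using SD(2) Th by blast
        show "S \<inter> N = {0}" using SD(2,3) TN subspace_0[OF sN] by blast
        fix x assume "x \<in> h"
        then obtain t n where tn: "t \<in> T" "n \<in> N" "x = t + n" using dec by blast
        then obtain s m where sm: "s \<in> S" "m \<in> M" "t = s + m" using SD(4) by blast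
        have "x = s + (m + n)" using tn(3) sm(3) by (simp add: add.assoc)
        moreover have "m + n \<in> N" using sm(2) M(3) tn(2) by (intro subspace_add[OF sN]) auto
        ultimately show "\<exists>t\<in>S. \<exists>n\<in>N. x = t + n" using sm(1) by blast
      qed
      then show ?thesis by blast
    qed
  qed
qed

end

section \<open>Quadratic algebras and their reductions\<close>

locale fd_iqh = iqh_lie_algebra G
  for G :: "('k::{alg_closed_field, field_char_0}, 'v::ab_group_add) quad_hom_alg" +
  assumes finite_dim_G: "finite_dim G"
begin

sublocale alg_closed_space "scal G" ..

abbreviation "g \<equiv> carr G"
abbreviation "br \<equiv> brk G"
abbreviation "al \<equiv> twist G"
abbreviation "bf \<equiv> form G"

lemma fd_carr: "fd g"
  using finite_dim_G subspace_carr unfolding finite_dim_def fd_def by auto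

lemma carr_closed [simp]:
  "0 \<in> g" "x \<in> g \<Longrightarrow> y \<in> g \<Longrightarrow> x + y \<in> g" "x \<in> g \<Longrightarrow> y \<in> g \<Longrightarrow> x - y \<in> g" "x \<in> g \<Longrightarrow> - x \<in> g"
  "x \<in> g \<Longrightarrow> scal G c x \<in> g"
  using subspace_carr subspace_0 subspace_add subspace_diff subspace_neg subspace_scale by auto

lemma br_right:
  assumes "x \<in> g"
  shows "y \<in> g \<Longrightarrow> br x y \<in> g" "y \<in> g \<Longrightarrow> z \<in> g \<Longrightarrow> br x (y + z) = br x y + br x z"
    "y \<in> g \<Longrightarrow> br x (scal G c y) = scal G c (br x y)"
  using brk_bilinear assms unfolding bilinear_on_def linear_on_def by blast+

lemma br_left:
  assumes "z \<in> g"
  shows "x \<in> g \<Longrightarrow> y \<in> g \<Longrightarrow> br (x + y) z = br x z + br y z"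
    "x \<in> g \<Longrightarrow> br (scal G c x) z = scal G c (br x z)"
  using brk_bilinear assms unfolding bilinear_on_def linear_on_def by blast+

lemma br_neg:
  assumes "x \<in> g" "y \<in> g"
  shows "br x (- y) = - br x y" "br (- x) y = - br x y"
  using br_right(3)[OF assms, of "-1"] br_left(2)[OF assms(2,1), of "-1"] by simp_all

lemma br_diff:
  assumes "x \<in> g" "y \<in> g" "z \<in> g"
  shows "br x (y - z) = br x y - br x z" "br (x - y) z = br x z - br y z"
  using br_right(2)[OF assms(1,2), of "- z"] br_left(1)[OF assms(3,1), of "- y"] br_neg assms
  by simp_all

lemma br_zero [simp]:
  assumes "x \<in> g" shows "br x 0 = 0" "br 0 x = 0"
  using br_diff[of x 0 0] br_diff[of 0 0 x] assms by simp_all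

lemma al_simps:
  shows "x \<in> g \<Longrightarrow> al x \<in> g" "x \<in> g \<Longrightarrow> y \<in> g \<Longrightarrow> al (x + y) = al x + al y"
    "x \<in> g \<Longrightarrow> al (scal G c x) = scal G c (al x)"
  using twist_linear unfolding linear_on_def by blast+

lemma al_neg: "x \<in> g \<Longrightarrow> al (- x) = - al x"
  using al_simps(3)[of x "-1"] by simp

lemma al_diff: "x \<in> g \<Longrightarrow> y \<in> g \<Longrightarrow> al (x - y) = al x - al y"
  using al_simps(2)[of x "- y"] al_neg by simp

lemma al_zero [simp]: "al 0 = 0"
  using al_diff[of 0 0] by simp

lemma bf_right:
  assumes "x \<in> g"
  shows "y \<in> g \<Longrightarrow> z \<in> g \<Longrightarrow> bf x (y + z) = bf x y + bf x z"
    "y \<in> g \<Longrightarrow> bf x (scal G c y) = c * bf x y"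
  using form_bilinear assms unfolding bilinear_on_def linear_on_def by blast+

lemma bf_left:
  assumes "z \<in> g"
  shows "x \<in> g \<Longrightarrow> y \<in> g \<Longrightarrow> bf (x + y) z = bf x z + bf y z"
    "x \<in> g \<Longrightarrow> bf (scal G c x) z = c * bf x z"
  using form_bilinear assms unfolding bilinear_on_def linear_on_def by blast+

lemma bf_neg:
  assumes "x \<in> g" "y \<in> g"
  shows "bf x (- y) = - bf x y" "bf (- x) y = - bf x y"
  using bf_right(2)[OF assms, of "-1"] bf_left(2)[OF assms(2,1), of "-1"] by simp_all

lemma bf_diff:
  assumes "x \<in> g" "y \<in> g" "z \<in> g"
  shows "bf x (y - z) = bf x y - bf x z" "bf (x - y) z = bf x z - bf y z"
  using bf_right(1)[OF assms(1,2), of "- z"] bf_left(1)[OF assms(3,1), of "- y"] bf_neg assms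
  by simp_all

lemma bf_zero [simp]:
  assumes "x \<in> g" shows "bf x 0 = 0" "bf 0 x = 0"
  using bf_diff[of x 0 0] bf_diff[of 0 0 x] assms by simp_all

lemmas g_simps = br_right br_left br_neg br_diff al_simps al_neg al_diff bf_right bf_left bf_neg bf_diff

lemma bilinear_bf: "bilinear_form g bf"
  unfolding bilinear_form_def linear_functional_def by (simp add: g_simps)

lemma nondegenerate_bf: "nondegenerate g bf"
  by (rule nondegenerateI) (rule form_nondegenerate)

lemma bf_br:
  assumes "x \<in> g" "y \<in> g" "z \<in> g"
  shows "bf (br x y) z = - bf y (br x z)"
proof -
  have "bf (br x y) z = - bf (br y x) z"
    using brk_skew[OF assms(1,2)] assms by (simp add: g_simps)
  then show ?thesis using form_invariant[OF assms(2,1,3)] by simp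
qed

lemma hom_idealD:
  assumes "hom_ideal G I"
  shows "subspace I" "x \<in> I \<Longrightarrow> x \<in> g" "x \<in> I \<Longrightarrow> y \<in> g \<Longrightarrow> br x y \<in> I" "x \<in> I \<Longrightarrow> al x \<in> I"
    "x \<in> I \<Longrightarrow> y \<in> g \<Longrightarrow> br y x \<in> I" "fd I"
proof -
  show s: "subspace I" "x \<in> I \<Longrightarrow> x \<in> g" and a: "x \<in> I \<Longrightarrow> y \<in> g \<Longrightarrow> br x y \<in> I"
    and "x \<in> I \<Longrightarrow> al x \<in> I"
    using assms unfolding hom_ideal_def by auto
  show "br y x \<in> I" if "x \<in> I" "y \<in> g"
    using assms that brk_skew[of y x] subspace_neg[OF s(1)] unfolding hom_ideal_def by fastforce
  show "fd I" using assms fd_subset[OF fd_carr s(1)] unfolding hom_ideal_def by blast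
qed

section \<open>Orthogonal complements for the invariant form\<close>

definition perp :: "'v set \<Rightarrow> 'v set"
  where "perp U = {x \<in> g. \<forall>u\<in>U. bf x u = 0}"

lemma perpD: "x \<in> perp U \<Longrightarrow> x \<in> g" "x \<in> perp U \<Longrightarrow> u \<in> U \<Longrightarrow> bf x u = 0"
  by (simp_all add: perp_def)

lemma subspace_perp: "U \<subseteq> g \<Longrightarrow> subspace (perp U)"
  unfolding subspace_def perp_def by (auto simp: g_simps subset_iff)

lemma perp_ideal:
  assumes I: "hom_ideal G I"
  shows "hom_ideal G (perp I)"
proof -
  note Ig = hom_idealD(2)[OF I]
  have "br x y \<in> perp I" if x: "x \<in> perp I" and y: "y \<in> g" for x y
    unfolding perp_def
  proof (intro CollectI conjI ballI)
    show "br x y \<in> g" using perpD(1)[OF x] y by (simp add: g_simps)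
    fix u assume u: "u \<in> I"
    show "bf (br x y) u = 0"
      using form_invariant[OF perpD(1)[OF x] y Ig[OF u]] perpD(2)[OF x hom_idealD(5)[OF I u y]] by simp
  qed
  moreover have "al x \<in> perp I" if x: "x \<in> perp I" for x
    unfolding perp_def
  proof (intro CollectI conjI ballI)
    show "al x \<in> g" using perpD(1)[OF x] by (simp add: g_simps)
    fix u assume u: "u \<in> I"
    show "bf (al x) u = 0"
      using form_twist[OF perpD(1)[OF x] Ig[OF u]] perpD(2)[OF x hom_idealD(4)[OF I u]] by simp
  qed
  moreover have "subspace (perp I)" using Ig by (intro subspace_perp) blast
  ultimately show ?thesis unfolding hom_ideal_def using perpD(1) by blast
qed

lemma riesz_g:
  assumes "linear_functional g F"
  obtains y where "y \<in> g" "\<And>x. x \<in> g \<Longrightarrow> bf y x = F x"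
  by (rule riesz[OF fd_carr bilinear_bf nondegenerate_bf assms]) (rule that)

text \<open>For a projection \<open>r\<close> with kernel \<open>U\<close> on \<open>g\<close>, the
  coordinates of \<open>r x\<close> are pairings of \<open>x\<close> with vectors of
  \<open>perp U\<close>. They vanish if \<open>x\<close> is orthogonal to \<open>perp U\<close>, and
  then \<open>x\<close> lies in \<open>U\<close>.\<close>

lemma perp_perp:
  assumes U: "subspace U" "U \<subseteq> g"
  shows "perp (perp U) = U"
proof
  show "U \<subseteq> perp (perp U)"
  proof
    fix u assume u: "u \<in> U"
    have "bf u x = 0" if "x \<in> perp U" for x
      using perpD[OF that] u form_sym[of u x] U(2) by auto
    then show "u \<in> perp (perp U)" using u U(2) by (auto simp: perp_def)
  qed
  show "perp (perp U) \<subseteq> U"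
  proof
    fix x assume x: "x \<in> perp (perp U)"
    have xg: "x \<in> g" by (rule perpD(1)[OF x])
    obtain r where r: "lin r" "\<And>x. r x \<in> g" "\<And>x. r (r x) = r x" "\<And>x. x \<in> U \<Longrightarrow> r x = 0" "\<And>x. x \<in> g \<Longrightarrow> x - r x \<in> U"
      by (rule projection_exists[OF subspace_carr U]) (rule that)
    obtain B where B: "basis_of (r ` g) B" using fd_basis[OF fd_image[OF r(1) fd_carr]] by blast
    then have iB: "independent B" "span B = r ` g" "finite B" by (simp_all add: basis_of_def)
    have 0: "representation B (r x) b = 0" for b
    proof -
      have "linear_functional g (\<lambda>x. representation B (r x) b)"
        unfolding linear_functional_def using iB
        by (simp add: lin_add[OF r(1)] lin_scale[OF r(1)] representation_add representation_scale)
      then obtain y where y: "y \<in> g" "\<And>x. x \<in> g \<Longrightarrow> bf y x = representation B (r x) b"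
        by (rule riesz_g) (rule that)
      have "y \<in> perp U"
        using y U(2) r(4) by (auto simp: perp_def representation_zero)
      then have "bf x y = 0" using perpD(2)[OF x] by blast
      then show ?thesis using y(2)[OF xg] form_sym[OF xg y(1)] by simp
    qed
    have "r x \<in> span B" using iB(2) xg by blast
    then have "r x = (\<Sum>b\<in>B. scal G (representation B (r x) b) b)"
      using sum_representation_eq[of B "r x" B] iB by simp
    also have "\<dots> = 0" unfolding 0 by simp
    finally have "r x = 0" .
    then show "x \<in> U" using r(5)[OF xg] by simp
  qed
qed

lemma decompose:
  assumes U: "subspace U" "U \<subseteq> g" and nd: "nondegenerate U bf" and x: "x \<in> g"
  obtains u w where "u \<in> U" "w \<in> perp U" "x = u + w"
proof -
  have bU: "bilinear_form U bf" by (rule bilinear_form_subset[OF bilinear_bf U(2)])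
  have fU: "fd U" by (rule fd_subset[OF fd_carr U])
  have "linear_functional g (bf x)" using bilinear_bf x unfolding bilinear_form_def by blast
  then have lf: "linear_functional U (bf x)" using linear_functional_subset U(2) by blast
  obtain u where u: "u \<in> U" "\<And>v. v \<in> U \<Longrightarrow> bf u v = bf x v"
    by (rule riesz[OF fU bU nd lf]) (rule that)
  have ug: "u \<in> g" using u U by blast
  have "bf (x - u) v = 0" if "v \<in> U" for v
    using u(2)[OF that] that U(2) x ug by (auto simp: g_simps)
  then have "x - u \<in> perp U" using x ug by (simp add: perp_def)
  then show ?thesis using that[of u "x - u"] u(1) by simp
qed

lemma perp_nondegenerate:
  assumes U: "subspace U" "U \<subseteq> g" and nd: "nondegenerate U bf"
  shows "nondegenerate (perp U) bf" "U \<inter> perp U = {0}"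
proof -
  show "U \<inter> perp U = {0}"
    using nondegenerateD[OF nd] subspace_0[OF U(1)] subspace_0[OF subspace_perp[OF U(2)]]
    by (auto dest: perpD)
  show "nondegenerate (perp U) bf"
  proof (rule nondegenerateI)
    fix w assume w: "w \<in> perp U" "\<And>v. v \<in> perp U \<Longrightarrow> bf w v = 0"
    have wg: "w \<in> g" by (rule perpD(1)[OF w(1)])
    show "w = 0"
    proof (rule form_nondegenerate[OF wg])
      fix x assume "x \<in> g"
      then obtain u v where uv: "u \<in> U" "v \<in> perp U" "x = u + v" using decompose[OF U nd] by blast
      then have "bf w x = bf w u + bf w v" using wg U(2) perpD(1)[OF uv(2)] by (auto simp: g_simps)
      then show "bf w x = 0" using w(2)[OF uv(2)] perpD(2)[OF w(1) uv(1)] by simp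
    qed
  qed
qed

definition red :: "'v set \<Rightarrow> ('v \<Rightarrow> 'v) \<Rightarrow> ('k, 'v) quad_hom_alg"
  where "red W p = \<lparr>carr = W, scal = scal G, brk = (\<lambda>x y. p (br x y)), twist = (\<lambda>x. p (al x)), form = bf\<rparr>"

lemma red_simps [simp]:
  "carr (red W p) = W" "scal (red W p) = scal G" "brk (red W p) = (\<lambda>x y. p (br x y))"
  "twist (red W p) = (\<lambda>x. p (al x))" "form (red W p) = bf"
  by (simp_all add: red_def)

text \<open>\<open>red W p\<close> realises the quotient \<open>R / I\<close> on a complement \<open>W\<close> of \<open>I\<close> in \<open>R\<close>.\<close>

lemma red_iqh:
  assumes W: "subspace W" "W \<subseteq> R" and R: "R \<subseteq> g"
    and RR: "\<And>x y. x \<in> R \<Longrightarrow> y \<in> R \<Longrightarrow> br x y \<in> R" "\<And>x. x \<in> R \<Longrightarrow> al x \<in> R"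
    and RI: "\<And>x y. x \<in> R \<Longrightarrow> y \<in> I \<Longrightarrow> br x y \<in> I" "\<And>x. x \<in> I \<Longrightarrow> al x \<in> I"
    and perp: "\<And>x y. x \<in> R \<Longrightarrow> y \<in> I \<Longrightarrow> bf x y = 0"
    and p: "lin p" "\<And>x. x \<in> R \<Longrightarrow> p x \<in> W" "\<And>x. x \<in> R \<Longrightarrow> x - p x \<in> I" "\<And>x. x \<in> I \<Longrightarrow> p x = 0"
      "\<And>x. x \<in> W \<Longrightarrow> p x = x"
    and nd: "nondegenerate W bf"
  shows "iqh_lie_algebra (red W p)" "finite_dim (red W p)"
proof -
  note p_simps = lin_add[OF p(1)] lin_diff[OF p(1)] lin_neg[OF p(1)] lin_scale[OF p(1)] lin_0[OF p(1)]
  have Wg: "x \<in> g" if "x \<in> W" for x using that W R by blast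
  have WR: "x \<in> R" if "x \<in> W" for x using that W by blast
  have Rg: "x \<in> g" if "x \<in> R" for x using that R by blast
  have pg: "p x \<in> g" "p x \<in> R" if "x \<in> R" for x using p(2)[OF that] Wg WR by auto
  have pI: "p u = p v" if "u - v \<in> I" for u v using p(4)[OF that] by (simp add: p_simps)
  \<comment> \<open>Under \<open>p\<close>, arguments may be changed modulo \<open>I\<close>; this
    is how the laws of \<open>G\<close> descend to \<open>W\<close>.\<close>
  have q: "p (br x (p y)) = p (br x y)" if "x \<in> R" "y \<in> R" for x y
  proof -
    have "br x y - br x (p y) \<in> I"
      using RI(1)[OF that(1) p(3)[OF that(2)]] Rg that pg by (simp add: g_simps)
    then show ?thesis using pI by metis
  qed
  have q': "p (br (p y) x) = p (br y x)" if "x \<in> R" "y \<in> R" for x y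
    using q[OF that] brk_skew[of "p y" x] brk_skew[of y x] Rg that pg by (simp add: p_simps)
  have qa: "p (al (p x)) = p (al x)" if "x \<in> R" for x
  proof -
    have "al x - al (p x) \<in> I" using RI(2)[OF p(3)[OF that]] Rg that pg by (simp add: g_simps)
    then show ?thesis using pI by metis
  qed
  \<comment> \<open>As \<open>I\<close> is orthogonal to \<open>R\<close>, the form does not see the
    projection.\<close>
  have fr: "bf (p x) y = bf x y" if "x \<in> R" "y \<in> R" for x y
  proof -
    have "bf y (x - p x) = 0" by (rule perp[OF that(2) p(3)[OF that(1)]])
    then have "bf y x = bf y (p x)" using Rg that pg by (simp add: g_simps)
    then show ?thesis using form_sym Rg that pg by metis
  qed
  note mem = Wg WR p(2) RR
  show "iqh_lie_algebra (red W p)"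
  proof (intro iqh_lie_algebra.intro involutive_hom_lie_algebra.intro hom_lie_algebra.intro
      iqh_lie_algebra_axioms.intro involutive_hom_lie_algebra_axioms.intro hom_lie_algebra_axioms.intro)
    show "vector_space (scal (red W p))" using vector_space_axioms by simp
    show "module.subspace (scal (red W p)) (carr (red W p))" using W by simp
    show "bilinear_on (scal (red W p)) (scal (red W p)) (carr (red W p)) (carr (red W p)) (brk (red W p))"
      unfolding bilinear_on_def linear_on_def using mem by (auto simp: g_simps p_simps)
    show "linear_on (scal (red W p)) (scal (red W p)) (carr (red W p)) (carr (red W p)) (twist (red W p))"
      unfolding linear_on_def using mem by (auto simp: g_simps p_simps)
    show "bilinear_on (scal (red W p)) (*) (carr (red W p)) UNIV (form (red W p))"
      unfolding bilinear_on_def linear_on_def using mem by (auto simp: g_simps)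
  next
    fix x y assume "x \<in> carr (red W p)" "y \<in> carr (red W p)"
    then have xy: "x \<in> W" "y \<in> W" by simp_all
    show "brk (red W p) x y = - brk (red W p) y x"
      using brk_skew[OF Wg[OF xy(1)] Wg[OF xy(2)]] by (simp add: p_simps)
    show "twist (red W p) (brk (red W p) x y) = brk (red W p) (twist (red W p) x) (twist (red W p) y)"
      using xy mem twist_brk[OF Wg[OF xy(1)] Wg[OF xy(2)]] by (simp add: qa q q')
    show "form (red W p) x y = form (red W p) y x" using form_sym[OF Wg[OF xy(1)] Wg[OF xy(2)]] by simp
    have "bf x (p (al y)) = bf (p (al y)) x" using xy mem by (intro form_sym) auto
    also have "\<dots> = bf (al y) x" using xy mem by (intro fr) auto
    also have "\<dots> = bf x (al y)" using xy mem by (intro form_sym) (auto simp: g_simps)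
    also have "\<dots> = bf (al x) y" using form_twist[OF Wg[OF xy(1)] Wg[OF xy(2)]] by simp
    also have "\<dots> = bf (p (al x)) y" using xy mem by (intro fr[symmetric]) auto
    finally show "form (red W p) (twist (red W p) x) y = form (red W p) x (twist (red W p) y)" by simp
    show "twist (red W p) (twist (red W p) x) = x"
      using xy mem twist_twist[OF Wg[OF xy(1)]] by (simp add: qa p(5))
    fix z assume "z \<in> carr (red W p)"
    then have z: "z \<in> W" by simp
    have h: "br (al x) (br y z) + br (al y) (br z x) + br (al z) (br x y) = 0"
      using xy z Wg by (intro hom_jacobi) auto
    have "p (br (al x) (br y z)) + p (br (al y) (br z x)) + p (br (al z) (br x y)) = 0"
      using arg_cong[OF h, of p] by (simp add: p_simps)
    then show "brk (red W p) (twist (red W p) x) (brk (red W p) y z) + brk (red W p) (twist (red W p) y) (brk (red W p) z x)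
        + brk (red W p) (twist (red W p) z) (brk (red W p) x y) = 0"
      using xy z mem by (simp add: q q')
    have "bf (p (br x y)) z = bf (br x y) z" using xy z mem by (intro fr) auto
    also have "\<dots> = bf x (br y z)" using xy z Wg by (intro form_invariant) auto
    also have "\<dots> = bf (br y z) x" using xy z Wg by (intro form_sym) (auto simp: g_simps)
    also have "\<dots> = bf (p (br y z)) x" using xy z mem by (intro fr[symmetric]) auto
    also have "\<dots> = bf x (p (br y z))" using xy z mem by (intro form_sym) auto
    finally show "form (red W p) (brk (red W p) x y) z = form (red W p) x (brk (red W p) y z)" by simp
  next
    fix x assume "x \<in> carr (red W p)" "\<And>y. y \<in> carr (red W p) \<Longrightarrow> form (red W p) x y = 0"
    then show "x = 0" using nondegenerateD[OF nd, of x] by simp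
  qed
  have "fd W" using fd_subset[OF fd_carr W(1)] Wg by blast
  then obtain B where "basis_of W B" using fd_basis by blast
  then show "finite_dim (red W p)" unfolding finite_dim_def basis_of_def by auto
qed

section \<open>Orthogonal sums and one-dimensional double extensions\<close>

lemma iqh_G: "iqh_lie_algebra G"
  by (rule iqh_lie_algebra_axioms)

text \<open>Fixing the scalar multiplication keeps the smaller algebras in the same vector space, so
  that \<open>dim\<close> compares like with like.\<close>

definition induction_hyp :: bool
  where "induction_hyp \<longleftrightarrow> (\<forall>V :: ('k, 'v) quad_hom_alg. iqh_lie_algebra V \<longrightarrow> finite_dim V \<longrightarrow>
    scal V = scal G \<longrightarrow> dim (carr V) < dim g \<longrightarrow> obtained V)"

lemma obtained_red:
  assumes "induction_hyp" "iqh_lie_algebra (red W p)" "finite_dim (red W p)" "subspace W" "W \<subseteq> g" "W \<noteq> g"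
  shows "obtained (red W p)"
  using assms fd_dim_less[OF fd_carr assms(4-6)] unfolding induction_hyp_def by simp

text \<open>Nondegeneracy on \<open>I\<close> makes \<open>g\<close> the direct sum of the ideals
  \<open>I\<close> and \<open>perp I\<close>. Brackets between them lie in the intersection and
  vanish.\<close>

lemma obtained_orth_sum:
  assumes ih: induction_hyp and I: "hom_ideal G I" "I \<noteq> {0}" "I \<noteq> g" and nd: "nondegenerate I bf"
  shows "obtained G"
proof -
  note Ig = hom_idealD(2)[OF I(1)] and sI = hom_idealD(1)[OF I(1)]
  have subI: "I \<subseteq> g" using Ig by blast
  let ?J = "perp I"
  have J: "hom_ideal G ?J" by (rule perp_ideal[OF I(1)])
  have Jg: "x \<in> g" if "x \<in> ?J" for x using perpD(1)[OF that] .
  note int = perp_nondegenerate(2)[OF sI subI nd]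
  \<comment> \<open>An ideal with nondegenerate form is its own reduction by the zero ideal, with
    the identity as projection.\<close>
  have red_id: "iqh_lie_algebra (red K (\<lambda>x. x))" "finite_dim (red K (\<lambda>x. x))"
    if K: "hom_ideal G K" and nK: "nondegenerate K bf" for K
  proof -
    have 1: "subspace K" "K \<subseteq> K" "K \<subseteq> g"
      using hom_idealD(1,2)[OF K] by auto
    show "iqh_lie_algebra (red K (\<lambda>x. x))" "finite_dim (red K (\<lambda>x. x))"
      by (rule red_iqh[where I = "{0}", OF 1 _ _ _ _ _ lin_ident _ _ _ _ nK]; use hom_idealD(2-5)[OF K] in auto)+
  qed
  have "?J \<noteq> g" using int I(2) subI by blast
  then have oJ: "obtained (red ?J (\<lambda>x. x))"
    using obtained_red[OF ih red_id[OF J perp_nondegenerate(1)[OF sI subI nd]] hom_idealD(1)[OF J]] Jg by blast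
  have oI: "obtained (red I (\<lambda>x. x))" by (rule obtained_red[OF ih red_id[OF I(1) nd] sI subI I(3)])
  have br0: "br x y = 0" "br y x = 0" if "x \<in> I" "y \<in> ?J" for x y
  proof -
    have "br x y \<in> I \<inter> ?J" "br y x \<in> I \<inter> ?J"
      using hom_idealD(3,5)[OF I(1) that(1) Jg[OF that(2)]] hom_idealD(3,5)[OF J that(2) Ig[OF that(1)]] by blast+
    then show "br x y = 0" "br y x = 0" using int by blast+
  qed
  have bf0: "bf x y = 0" "bf y x = 0" if "x \<in> I" "y \<in> ?J" for x y
    using perpD(2)[OF that(2,1)] form_sym[OF Ig[OF that(1)] Jg[OF that(2)]] by simp_all
  let ?h = "\<lambda>(x, y). x + y"
  have "orth_sum (red I (\<lambda>x. x)) (red ?J (\<lambda>x. x)) \<simeq> G"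
    unfolding iqh_isomorphic_def
  proof (intro exI[of _ ?h] conjI ballI)
    let ?S = "orth_sum (red I (\<lambda>x. x)) (red ?J (\<lambda>x. x))"
    have c: "carr ?S = I \<times> ?J" by (simp add: orth_sum_def)
    show "linear_on (scal ?S) (scal G) (carr ?S) g ?h"
      unfolding linear_on_def orth_sum_def using Ig Jg by (auto simp: scale_right_distrib)
    show "bij_betw ?h (carr ?S) g"
      unfolding bij_betw_def c
    proof
      show "inj_on ?h (I \<times> ?J)"
      proof (rule inj_onI, clarsimp)
        fix x y x' y' assume xy: "x \<in> I" "y \<in> ?J" "x' \<in> I" "y' \<in> ?J" "x + y = x' + y'"
        have "x - x' = y' - y" using xy(5) by (simp add: algebra_simps)
        moreover have "x - x' \<in> I" using xy(1,3) by (rule subspace_diff[OF sI])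
        moreover have "y' - y \<in> ?J" using xy(4,2) by (rule subspace_diff[OF hom_idealD(1)[OF J]])
        ultimately have "x - x' = 0" using int by (metis IntI singletonD)
        then show "x = x' \<and> y = y'" using xy(5) by simp
      qed
      show "?h ` (I \<times> ?J) = g"
      proof
        show "?h ` (I \<times> ?J) \<subseteq> g" using Ig Jg by auto
        show "g \<subseteq> ?h ` (I \<times> ?J)"
        proof
          fix x assume "x \<in> g"
          then obtain u w where "u \<in> I" "w \<in> ?J" "x = u + w" using decompose[OF sI subI nd] by blast
          then show "x \<in> ?h ` (I \<times> ?J)" by (intro image_eqI[of _ _ "(u, w)"]) auto
        qed
      qed
    qed
    fix s assume s: "s \<in> carr ?S"
    then obtain x y where xy: "s = (x, y)" "x \<in> I" "y \<in> ?J" unfolding c by blast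
    show "?h (twist ?S s) = al (?h s)"
      using xy Ig Jg by (simp add: orth_sum_def g_simps)
    fix s' assume s': "s' \<in> carr ?S"
    then obtain x' y' where xy': "s' = (x', y')" "x' \<in> I" "y' \<in> ?J" unfolding c by blast
    show "?h (brk ?S s s') = br (?h s) (?h s')"
      using xy xy' Ig Jg br0 by (simp add: orth_sum_def g_simps)
    show "form ?S s s' = bf (?h s) (?h s')"
      using xy xy' Ig Jg bf0 by (simp add: orth_sum_def g_simps)
  qed
  then show ?thesis by (rule obtained.orthogonal_sum[OF oI oJ iqh_G])
qed

text \<open>The isotropic \<open>I\<close> is paired nondegenerately with \<open>A\<close>, so the
  form is nondegenerate on \<open>I + A\<close>. The orthogonal of this sum is a complement
  \<open>W\<close> of \<open>I\<close> in \<open>perp I\<close>, so that \<open>red W p\<close>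
  realises \<open>perp I / I\<close>. \<open>A\<close> may fail to be isotropic: in the
  one-dimensional case it is chosen isotropic, and in the simple case the form on it becomes
  \<open>\<gamma>\<close>.\<close>

lemma hyperbolic_complement:
  assumes I: "subspace I" "I \<subseteq> perp I" and A: "subspace A" "A \<subseteq> g" "A \<inter> perp I = {0}"
    and dec: "\<And>x. x \<in> g \<Longrightarrow> \<exists>r\<in>perp I. \<exists>a\<in>A. x = r + a"
  obtains W p where "subspace W" "W \<subseteq> perp I" "nondegenerate W bf" "I \<inter> W = {0}"
    "\<And>x. x \<in> W \<longleftrightarrow> x \<in> g \<and> (\<forall>i\<in>I. bf x i = 0) \<and> (\<forall>a\<in>A. bf x a = 0)"
    "lin p" "\<And>x. p x \<in> W" "\<And>x. x \<in> W \<Longrightarrow> p x = x" "\<And>x. x \<in> I \<Longrightarrow> p x = 0" "\<And>x. x \<in> perp I \<Longrightarrow> x - p x \<in> I"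
    "\<forall>i\<in>I. (\<forall>a\<in>A. bf i a = 0) \<longrightarrow> i = 0"
proof -
  have Ig: "i \<in> g" if "i \<in> I" for i using that I(2) perpD(1) by blast
  have Ag: "a \<in> g" if "a \<in> A" for a using that A(2) by blast
  have II: "bf i j = 0" if "i \<in> I" "j \<in> I" for i j using that I(2) perpD(2) by blast
  have uniq: "i = 0" if i: "i \<in> I" "\<And>a. a \<in> A \<Longrightarrow> bf i a = 0" for i
  proof (rule form_nondegenerate[OF Ig[OF i(1)]])
    fix x assume "x \<in> g"
    then obtain r a where ra: "r \<in> perp I" "a \<in> A" "x = r + a" using dec by blast
    have "bf i r = 0" using perpD[OF ra(1)] i(1) form_sym[OF Ig[OF i(1)] perpD(1)[OF ra(1)]] by simp
    then show "bf i x = 0" using ra i Ig perpD(1)[OF ra(1)] Ag by (simp add: g_simps)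
  qed
  let ?U = "{u + v |u v. u \<in> I \<and> v \<in> A}"
  have sU: "subspace ?U" by (rule subspace_plus[OF I(1) A(1)])
  have Ug: "?U \<subseteq> g" using Ig Ag carr_closed by blast
  have IU: "i \<in> ?U" if "i \<in> I" for i
  proof -
    have "i = i + 0 \<and> i \<in> I \<and> 0 \<in> A" using that subspace_0[OF A(1)] by simp
    then show ?thesis by blast
  qed
  have AU: "a \<in> ?U" if "a \<in> A" for a
  proof -
    have "a = 0 + a \<and> 0 \<in> I \<and> a \<in> A" using that subspace_0[OF I(1)] by simp
    then show ?thesis by blast
  qed
  have nd: "nondegenerate ?U bf"
  proof (rule nondegenerateI)
    fix u assume "u \<in> ?U" and 0: "\<And>v. v \<in> ?U \<Longrightarrow> bf u v = 0"
    then obtain i a where ia: "i \<in> I" "a \<in> A" "u = i + a" by blast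
    have "bf a j = 0" if j: "j \<in> I" for j
      using 0[OF IU[OF j]] II[OF ia(1) j] ia Ig Ag j by (simp add: g_simps)
    then have "a \<in> A \<inter> perp I" using ia(2) Ag by (simp add: perp_def)
    then have a: "a = 0" using A(3) by blast
    have "i = 0"
      by (rule uniq[OF ia(1)]) (use 0[OF AU] ia(3) a in simp)
    then show "u = 0" using a ia by simp
  qed
  let ?W = "perp ?U"
  have Wiff: "x \<in> ?W \<longleftrightarrow> x \<in> g \<and> (\<forall>i\<in>I. bf x i = 0) \<and> (\<forall>a\<in>A. bf x a = 0)" for x
  proof
    assume x: "x \<in> ?W"
    show "x \<in> g \<and> (\<forall>i\<in>I. bf x i = 0) \<and> (\<forall>a\<in>A. bf x a = 0)"
      by (intro conjI ballI) (erule perpD(1)[OF x] perpD(2)[OF x IU] perpD(2)[OF x AU] | rule perpD(1)[OF x])+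
  next
    assume x: "x \<in> g \<and> (\<forall>i\<in>I. bf x i = 0) \<and> (\<forall>a\<in>A. bf x a = 0)"
    have "bf x u = 0" if u: "u \<in> ?U" for u
    proof -
      obtain i a where "i \<in> I" "a \<in> A" "u = i + a" using u by blast
      then show ?thesis using x Ig Ag by (simp add: g_simps)
    qed
    then show "x \<in> ?W" using x by (simp add: perp_def)
  qed
  have sW: "subspace ?W" by (rule subspace_perp[OF Ug])
  have IW: "I \<inter> ?W = {0}"
  proof
    show "I \<inter> ?W \<subseteq> {0}"
    proof
      fix i assume i: "i \<in> I \<inter> ?W"
      have "i = 0"
      proof (rule uniq)
        show "i \<in> I" using i by (rule IntD1)
        show "bf i a = 0" if "a \<in> A" for a using Wiff[THEN iffD1, OF IntD2[OF i]] that by (elim conjE) (rule bspec)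
      qed
      then show "i \<in> {0}" by simp
    qed
    show "{0} \<subseteq> I \<inter> ?W" using subspace_0[OF I(1)] subspace_0[OF sW] by blast
  qed
  have WI: "?W \<subseteq> perp I"
  proof
    fix w assume "w \<in> ?W"
    from Wiff[THEN iffD1, OF this] show "w \<in> perp I" unfolding perp_def by (elim conjE) (intro CollectI conjI)
  qed
  have int': "?W \<inter> I = {0}" using IW by blast
  obtain p where p: "lin p" "\<And>x. p x \<in> ?W" "\<And>x. x \<in> ?W \<Longrightarrow> p x = x" "\<And>x. x \<in> I \<Longrightarrow> p x = 0"
    by (rule direct_projection[OF sW I(1) int']) (rule that)
  have pR: "x - p x \<in> I" if x: "x \<in> perp I" for x
  proof -
    obtain u w where uw: "u \<in> ?U" "w \<in> ?W" "x = u + w" using decompose[OF sU Ug nd perpD(1)[OF x]] by blast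
    then obtain i a where ia: "i \<in> I" "a \<in> A" "u = i + a" by blast
    have sR: "subspace (perp I)" using Ig by (intro subspace_perp) blast
    \<comment> \<open>This difference is \<open>a\<close>, so the component of \<open>x\<close> in
      \<open>A\<close> lies in \<open>perp I\<close> as well and vanishes.\<close>
    have "x - w - i \<in> perp I" using x uw(2) ia(1) WI I(2) by (intro subspace_diff[OF sR]) auto
    then have "a \<in> A \<inter> perp I" using ia uw(3) by simp
    then have "a = 0" using A(3) by blast
    then have xi: "x = i + w" using ia uw by simp
    then have "p x = w" using p(3)[OF uw(2)] p(4)[OF ia(1)] by (simp add: lin_add[OF p(1)])
    then show ?thesis using xi ia(1) by simp
  qed
  show ?thesis
  proof (rule that[OF sW WI perp_nondegenerate(1)[OF sU Ug nd] IW Wiff p pR])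
    show "\<forall>i\<in>I. (\<forall>a\<in>A. bf i a = 0) \<longrightarrow> i = 0"
      by (intro ballI impI) (rule uniq, assumption, erule bspec)
  qed
qed

lemma red_perp_iqh:
  assumes I: "hom_ideal G I" and W: "subspace W" "W \<subseteq> perp I" "nondegenerate W bf"
    and p: "lin p" "\<And>x. p x \<in> W" "\<And>x. x \<in> W \<Longrightarrow> p x = x" "\<And>x. x \<in> I \<Longrightarrow> p x = 0" "\<And>x. x \<in> perp I \<Longrightarrow> x - p x \<in> I"
    and iso: "I \<subseteq> perp I"
  shows "iqh_lie_algebra (red W p)" "finite_dim (red W p)"
proof -
  have R: "perp I \<subseteq> g" using perpD(1) by blast
  note J = hom_idealD[OF perp_ideal[OF I]]
  have a: "br x y \<in> perp I" if "x \<in> perp I" "y \<in> perp I" for x y using J(3) that perpD(1) by blast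
  have b: "br x y \<in> I" if "x \<in> perp I" "y \<in> I" for x y using hom_idealD(5)[OF I that(2)] that(1) perpD(1) by blast
  show "iqh_lie_algebra (red W p)" "finite_dim (red W p)"
    by (rule red_iqh[OF W(1,2) R a J(4) b hom_idealD(4)[OF I] perpD(2) p(1) p(2) p(5) p(4) p(3) W(3)]; assumption)+
qed

lemma central_line_ideal:
  assumes e: "e \<in> center G" and lam: "al e = scal G lam e"
  shows "hom_ideal G (span {e})"
  unfolding hom_ideal_def
proof (intro conjI ballI)
  have eg: "e \<in> g" and e0: "\<And>y. y \<in> g \<Longrightarrow> br e y = 0" using e by (simp_all add: center_def)
  show "subspace (span {e})" by (rule subspace_span)
  show "span {e} \<subseteq> g" using eg by (intro span_minimal subspace_carr) simp
  fix x assume "x \<in> span {e}"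
  then obtain c where c: "x = scal G c e" by (auto simp: span_singleton)
  then show "al x \<in> span {e}" using lam eg by (auto simp: g_simps span_singleton)
  fix y assume "y \<in> g"
  then show "br x y \<in> span {e}" using c eg e0 span_zero by (simp add: g_simps)
qed

text \<open>Complete \<open>e\<close> to a hyperbolic plane by an isotropic \<open>b\<close>, and
  let \<open>W\<close> be its orthogonal. The map \<open>\<delta>\<close> is the bracket with
  \<open>b\<close>, the vector \<open>x0\<close> is the component of \<open>al b\<close> in
  \<open>W\<close>, and \<open>lam\<close> is the eigenvalue of \<open>e\<close>.\<close>

lemma obtained_one_dim:
  assumes ih: induction_hyp and e: "e \<in> center G" "e \<noteq> 0" "bf e e = 0"
    and lam: "al e = scal G lam e" "lam \<in> {-1, 1}"
  shows "obtained G"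
proof -
  have eg: "e \<in> g" using e(1) by (simp add: center_def)
  have e0: "br e x = 0" "br x e = 0" if "x \<in> g" for x
    using e(1) brk_skew[OF that eg] that unfolding center_def by auto
  have "\<exists>y\<in>g. bf e y \<noteq> 0" using form_nondegenerate[OF eg] e(2) by blast
  then obtain y where y: "y \<in> g" "bf e y \<noteq> 0" by blast
  define b0 where "b0 = scal G (1 / bf e y) y"
  have b0: "b0 \<in> g" "bf b0 e = 1" "bf e b0 = 1"
    using y eg form_sym[OF y(1) eg] by (simp_all add: b0_def g_simps)
  \<comment> \<open>Because \<open>e\<close> is isotropic and pairs to 1 with \<open>b0\<close>,
    subtracting this multiple of \<open>e\<close> makes \<open>b\<close> isotropic and keeps the
    pairing 1.\<close>
  define b where "b = b0 - scal G (bf b0 b0 / 2) e"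
  have bg: "b \<in> g" and be: "bf b e = 1" "bf e b = 1" and bb: "bf b b = 0"
    using b0 eg e(3) by (simp_all add: b_def g_simps)
  have brbb: "br b b = 0"
  proof -
    have "br b b + br b b = 0" using brk_skew[OF bg bg] by (simp add: eq_neg_iff_add_eq_0)
    then have "scal G 2 (br b b) = 0" using scale_left_distrib[of 1 1 "br b b"] by simp
    then show ?thesis by simp
  qed
  let ?I = "span {e}" and ?A = "span {b}"
  have I: "x \<in> ?I \<longleftrightarrow> (\<exists>c. x = scal G c e)" and A: "x \<in> ?A \<longleftrightarrow> (\<exists>c. x = scal G c b)" for x
    by (auto simp: span_singleton)
  have hI: "hom_ideal G ?I" by (rule central_line_ideal[OF e(1) lam(1)])
  have Rin: "x \<in> perp ?I \<longleftrightarrow> x \<in> g \<and> bf x e = 0" for x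
  proof
    assume x: "x \<in> perp ?I"
    have "e \<in> ?I" by (simp add: span_base)
    then show "x \<in> g \<and> bf x e = 0" using perpD(1)[OF x] perpD(2)[OF x] by blast
  next
    assume x: "x \<in> g \<and> bf x e = 0"
    then have "bf x u = 0" if "u \<in> ?I" for u using that I eg by (auto simp: g_simps)
    then show "x \<in> perp ?I" using x by (simp add: perp_def)
  qed
  have iso: "?I \<subseteq> perp ?I" using I Rin eg e(3) by (auto simp: g_simps)
  have Ag: "?A \<subseteq> g" using A bg by auto
  have Aint: "?A \<inter> perp ?I = {0}"
  proof
    show "?A \<inter> perp ?I \<subseteq> {0}"
    proof
      fix x assume x: "x \<in> ?A \<inter> perp ?I"
      then obtain c where c: "x = scal G c b" using A by blast
      have "bf x e = 0" using x Rin by blast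
      then have "c = 0" using c be bg eg by (simp add: g_simps)
      then show "x \<in> {0}" using c by simp
    qed
    show "{0} \<subseteq> ?A \<inter> perp ?I" using Rin eg span_zero by simp
  qed
  have dec: "\<exists>r\<in>perp ?I. \<exists>a\<in>?A. x = r + a" if x: "x \<in> g" for x
  proof (intro bexI)
    show "x = (x - scal G (bf x e) b) + scal G (bf x e) b" by simp
    show "x - scal G (bf x e) b \<in> perp ?I" using Rin x bg eg be by (simp add: g_simps)
    show "scal G (bf x e) b \<in> ?A" using A by blast
  qed
  obtain W p where W: "subspace W" "W \<subseteq> perp ?I" "nondegenerate W bf" "?I \<inter> W = {0}"
    and Wiff: "\<And>x. x \<in> W \<longleftrightarrow> x \<in> g \<and> (\<forall>i\<in>?I. bf x i = 0) \<and> (\<forall>a\<in>?A. bf x a = 0)"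
    and p: "lin p" "\<And>x. p x \<in> W" "\<And>x. x \<in> W \<Longrightarrow> p x = x" "\<And>x. x \<in> ?I \<Longrightarrow> p x = 0" "\<And>x. x \<in> perp ?I \<Longrightarrow> x - p x \<in> ?I"
    by (rule hyperbolic_complement[OF subspace_span iso subspace_span Ag Aint dec]) (assumption, rule that)
  note p_simps = lin_add[OF p(1)] lin_diff[OF p(1)] lin_neg[OF p(1)] lin_scale[OF p(1)] lin_0[OF p(1)]
  have Win: "x \<in> W \<longleftrightarrow> x \<in> g \<and> bf x e = 0 \<and> bf x b = 0" for x
  proof
    assume "x \<in> W"
    moreover have "e \<in> ?I" "b \<in> ?A" by (simp_all add: span_base)
    ultimately show "x \<in> g \<and> bf x e = 0 \<and> bf x b = 0" using Wiff by blast
  next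
    assume "x \<in> g \<and> bf x e = 0 \<and> bf x b = 0"
    then show "x \<in> W" using Wiff I A eg bg by (auto simp: g_simps)
  qed
  have Wg: "w \<in> g" and We: "bf w e = 0" "bf e w = 0" and Wb: "bf w b = 0" "bf b w = 0" if "w \<in> W" for w
    using that Win[of w] form_sym[OF eg, of w] form_sym[OF bg, of w] by auto
  have pe: "p e = 0" by (rule p(4)) (simp add: span_base)
  have split: "z = p z + scal G (bf z b) e" if z: "z \<in> g" "bf z e = 0" for z
  proof -
    obtain c where c: "z - p z = scal G c e" using p(5)[of z] z Rin I by blast
    have "bf (z - p z) b = bf z b" using z bg Wg[OF p(2)] Wb[OF p(2)] by (simp add: g_simps)
    then have "c = bf z b" unfolding c using eg bg be by (simp add: g_simps)
    then show ?thesis using c by (simp add: algebra_simps)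
  qed
  have brp: "br u (p z) = br u z" "br (p z) u = br z u" if "u \<in> g" "z \<in> g" "bf z e = 0" for u z
  proof -
    have "br u z = br u (p z + scal G (bf z b) e)" "br z u = br (p z + scal G (bf z b) e) u"
      using split[OF that(2,3)] by simp_all
    then show "br u (p z) = br u z" "br (p z) u = br z u"
      using that Wg[OF p(2)] eg e0 by (simp_all add: g_simps)
  qed
  have bre: "bf (br x y) e = 0" if "x \<in> g" "y \<in> g" for x y
    using form_invariant[OF that eg] e0 that by simp
  have ale: "bf (al x) e = lam * bf x e" if "x \<in> g" for x
    using form_twist[OF that eg] lam(1) that eg by (simp add: g_simps)
  have lam2: "lam * lam = 1" "lam \<noteq> 0" using lam(2) by auto
  define x0 where "x0 = al b - scal G lam b - scal G (bf (al b) b) e"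
  have x0W: "x0 \<in> W"
    unfolding Win using bg eg ale[OF bg] be bb e(3) by (simp add: x0_def g_simps)
  note x0g = Wg[OF x0W]
  have alb: "al b = scal G lam b + x0 + scal G (bf (al b) b) e" by (simp add: x0_def)
  \<comment> \<open>The twist is an isometry, so \<open>al b\<close> is isotropic like
    \<open>b\<close>; expanding its square along \<open>b\<close>, \<open>x0\<close> and
    \<open>e\<close> forces the value of the last coefficient.\<close>
  have l0: "bf (al b) b = - (1 / (2 * lam)) * bf x0 x0"
  proof -
    have "bf (al b) (al b) = 0" using form_twist[OF bg al_simps(1)[OF bg]] twist_twist[OF bg] bb by simp
    moreover have "bf (al b) (al b) = bf (scal G lam b + x0 + scal G (bf (al b) b) e) (scal G lam b + x0 + scal G (bf (al b) b) e)"
      using alb by simp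
    moreover have "\<dots> = 2 * lam * bf (al b) b + bf x0 x0"
      using bg eg x0g We[OF x0W] Wb[OF x0W] be bb e(3) by (simp add: g_simps)
    ultimately have "2 * lam * bf (al b) b + bf x0 x0 = 0" by simp
    then have "2 * lam * bf (al b) b = - bf x0 x0" by (simp add: add_eq_0_iff2)
    then show ?thesis using lam2(2) by (simp add: field_simps)
  qed
  \<comment> \<open>Brackets are orthogonal to the central \<open>e\<close>, and those with
    \<open>b\<close> are orthogonal to \<open>b\<close> because \<open>br b b = 0\<close>. So
    \<open>br b\<close> itself is an endomorphism of \<open>W\<close>.\<close>
  have brW: "br b x \<in> W" if x: "x \<in> g" for x
    unfolding Win using bre[OF bg x] bf_br[OF bg x bg] brbb bg x by (simp add: g_simps)
  have albr: "br (al b) x = scal G lam (br b x) + br x0 x" if "x \<in> g" for x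
    by (subst alb) (use that bg eg x0g e0 in \<open>simp add: g_simps\<close>)
  have alW: "al x = p (al x) + scal G (bf x0 x) e" if x: "x \<in> W" for x
  proof -
    have "bf (al x) b = bf x (al b)" by (rule form_twist[OF Wg[OF x] bg])
    also have "\<dots> = bf x (scal G lam b + x0 + scal G (bf (al b) b) e)" using alb by simp
    also have "\<dots> = bf x x0" using Wg[OF x] We[OF x] Wb[OF x] bg eg x0g by (simp add: g_simps)
    finally have "bf (al x) b = bf x0 x" using form_sym[OF Wg[OF x] x0g] by simp
    moreover have "bf (al x) e = 0" using ale[OF Wg[OF x]] We[OF x] by simp
    ultimately show ?thesis using split[OF al_simps(1)[OF Wg[OF x]]] by simp
  qed
  have brWW: "br x y = p (br x y) + scal G (bf (br b x) y) e" if xy: "x \<in> W" "y \<in> W" for x y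
  proof -
    have "bf (br x y) b = bf b (br x y)" using Wg xy bg by (intro form_sym) (auto simp: g_simps)
    also have "\<dots> = bf (br b x) y" using form_invariant[OF bg Wg[OF xy(1)] Wg[OF xy(2)]] by simp
    finally show ?thesis using split[OF _ bre[OF Wg[OF xy(1)] Wg[OF xy(2)]]] Wg xy by (simp add: g_simps)
  qed
  have sub: "W \<subseteq> g" using Wg by blast
  have "W \<noteq> g" using eg Win[of e] be by auto
  note redV = red_perp_iqh[OF hI W(1-3) p iso]
  have oV: "obtained (red W p)" by (rule obtained_red[OF ih redV W(1) sub \<open>W \<noteq> g\<close>])
  have data: "one_dim_extension_data (red W p) (br b) x0 lam"
  proof (intro one_dim_extension_data.intro one_dim_extension_data_axioms.intro redV(1))
    show "linear_on (scal (red W p)) (scal (red W p)) (carr (red W p)) (carr (red W p)) (br b)"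
      unfolding linear_on_def using brW Wg bg by (auto simp: g_simps)
    show "x0 \<in> carr (red W p)" using x0W by simp
    show "lam \<in> {-1, 1}" by (rule lam(2))
    \<comment> \<open>Applying the involution to the decomposition of \<open>al b\<close> returns
      \<open>b\<close>. Modulo \<open>e\<close> this says that the twist of \<open>x0\<close> is
      \<open>- lam\<close> times \<open>x0\<close>.\<close>
    have "al (scal G lam b + x0 + scal G (bf (al b) b) e) = b"
      using twist_twist[OF bg] alb by simp
    then have "scal G lam (al b) + al x0 + scal G (bf (al b) b) (scal G lam e) = b"
      using bg x0g eg lam(1) by (simp add: g_simps)
    then have "scal G lam (scal G lam b + x0 + scal G (bf (al b) b) e) + al x0
        + scal G (bf (al b) b) (scal G lam e) = b"
      using alb by simp
    then have "al x0 + (scal G lam x0 + scal G (2 * (lam * bf (al b) b)) e) = 0"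
      using lam2(1) scale_left_distrib[of 1 1 "scal G (lam * bf (al b) b) e"]
      by (simp add: scale_right_distrib algebra_simps)
    from arg_cong[OF this, of p] have "p (al x0) + scal G lam x0 = 0"
      by (simp add: p_simps pe p(3)[OF x0W])
    then show "twist (red W p) x0 = scal (red W p) (- lam) x0"
      by (simp add: eq_neg_iff_add_eq_0)
  next
    fix x assume "x \<in> carr (red W p)"
    then have x: "x \<in> W" by simp
    have axg: "al x \<in> g" "bf (al x) e = 0" using Wg[OF x] ale[OF Wg[OF x]] We[OF x] by (simp_all add: g_simps)
    have 1: "br b (p (al x)) = br b (al x)" by (rule brp(1)[OF bg axg])
    have "al (br b (al x)) = br (al b) x"
      using twist_brk[OF bg axg(1)] twist_twist[OF Wg[OF x]] by simp
    also have "\<dots> = scal G lam (br b x) + br x0 x" by (rule albr[OF Wg[OF x]])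
    finally have "p (al (br b (al x))) = scal G lam (br b x) + p (br x0 x)"
      by (simp add: p_simps p(3)[OF brW[OF Wg[OF x]]])
    then show "twist (red W p) (br b (twist (red W p) x)) - scal (red W p) lam (br b x) = brk (red W p) x0 x"
      using 1 by simp
    have xg: "x \<in> g" by (rule Wg[OF x])
    have albb: "br (al b) b = - br b x0"
      using albr[OF bg] brbb brk_skew[OF x0g bg] by simp
    \<comment> \<open>The condition on the square of \<open>\<delta>\<close> is the hom-Jacobi
      identity for \<open>al b\<close>, \<open>b\<close> and \<open>al x\<close>.\<close>
    have j: "br (al (al b)) (br b (al x)) + br (al b) (br (al x) (al b)) + br (al (al x)) (br (al b) b) = 0"
      using bg axg(1) by (intro hom_jacobi) (simp_all add: g_simps)
    have "br (al b) (br (al x) (al b)) = al (br b (br x b))"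
      using twist_brk[OF bg, of "br x b"] twist_brk[OF xg bg] xg bg by (simp add: g_simps)
    also have "br x b = - br b x" by (rule brk_skew[OF xg bg])
    also have "al (br b (- br b x)) = - al (br b (br b x))" using bg xg by (simp add: g_simps)
    finally have "br b (br b (al x)) - al (br b (br b x)) - br x (br b x0) = 0"
      using j twist_twist[OF bg] twist_twist[OF xg] albb xg bg x0g by (simp add: g_simps)
    moreover have "br x (br b x0) = - br (br b x0) x" using xg bg x0g by (intro brk_skew) (simp_all add: g_simps)
    ultimately have "al (br b (br b x)) - br b (br b (al x)) = br (br b x0) x" by (simp add: algebra_simps)
    from arg_cong[OF this, of p]
    have "p (al (br b (br b x))) - br b (br b (al x)) = p (br (br b x0) x)"
      by (simp add: p_simps p(3)[OF brW[OF br_right(1)[OF bg axg(1)]]])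
    then show "twist (red W p) (br b (br b x)) - br b (br b (twist (red W p) x)) = brk (red W p) (br b x0) x"
      using 1 by simp
    fix y assume "y \<in> carr (red W p)"
    then have y: "y \<in> W" by simp
    have yg: "y \<in> g" by (rule Wg[OF y])
    have ayg: "al y \<in> g" "bf (al y) e = 0" using yg ale[OF yg] We[OF y] by (simp_all add: g_simps)
    show "form (red W p) (br b x) y = - form (red W p) x (br b y)"
      using bf_br[OF bg xg yg] by simp
    have rg: "br x y \<in> g" using xg yg by (simp add: g_simps)
    \<comment> \<open>The condition on \<open>\<delta>\<close> of a bracket is the hom-Jacobi
      identity for \<open>b\<close>, \<open>x\<close> and \<open>y\<close>.\<close>
    have j: "br (al b) (br x y) + br (al x) (br y b) + br (al y) (br b x) = 0"
      using bg xg yg by (intro hom_jacobi)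
    have "br (al x) (br y b) = - br (al x) (br b y)"
      using brk_skew[OF yg bg] axg yg bg by (simp add: g_simps)
    moreover have "br (al y) (br b x) = - br (br b x) (al y)"
      using ayg xg bg by (intro brk_skew) (simp_all add: g_simps)
    ultimately have "scal G lam (br b (br x y)) + br x0 (br x y) = br (br b x) (al y) + br (al x) (br b y)"
      using j albr[OF rg] by (simp add: algebra_simps)
    from arg_cong[OF this, of p]
    have "scal G lam (br b (br x y)) + p (br x0 (br x y)) = p (br (br b x) (al y)) + p (br (al x) (br b y))"
      by (simp add: p_simps p(3)[OF brW[OF rg]])
    then show "scal (red W p) lam (br b (brk (red W p) x y)) + brk (red W p) x0 (brk (red W p) x y)
        = brk (red W p) (br b x) (twist (red W p) y) + brk (red W p) (twist (red W p) x) (br b y)"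
      using brp(1)[OF bg rg bre[OF xg yg]] brp(1)[OF x0g rg bre[OF xg yg]]
        brp(1)[OF br_right(1)[OF bg xg] ayg] brp(2)[OF br_right(1)[OF bg yg] axg] by simp
  qed
  let ?E = "one_dim_extension (red W p) (br b) x0 lam"
  let ?h = "\<lambda>(\<beta>, x, \<epsilon>). scal G \<beta> b + x + scal G \<epsilon> e"
  have E: "carr ?E = UNIV \<times> W \<times> UNIV" "scal ?E = (\<lambda>c (\<beta>, x, \<epsilon>). (c * \<beta>, scal G c x, c * \<epsilon>))"
    "brk ?E = (\<lambda>(\<beta>, x, \<epsilon>) (\<beta>', x', \<epsilon>').
        (0, p (br x x') + scal G \<beta> (br b x') - scal G \<beta>' (br b x), bf (br b x) x'))"
    "twist ?E = (\<lambda>(\<beta>, x, \<epsilon>). (lam * \<beta>, p (al x) + scal G \<beta> x0, \<beta> * bf (al b) b + bf x0 x + lam * \<epsilon>))"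
    "form ?E = (\<lambda>(\<beta>, x, \<epsilon>) (\<beta>', x', \<epsilon>'). bf x x' + \<beta> * \<epsilon>' + \<epsilon> * \<beta>')"
    unfolding one_dim_extension_def l0 by (simp_all add: Let_def)
  have "?E \<simeq> G"
    unfolding iqh_isomorphic_def
  proof (intro exI[of _ ?h] conjI ballI)
    show "linear_on (scal ?E) (scal G) (carr ?E) g ?h"
      unfolding linear_on_def E using Wg bg eg
      by (auto simp: scale_left_distrib scale_right_distrib algebra_simps)
    show "bij_betw ?h (carr ?E) g"
    proof (rule bij_betw_byWitness)
      let ?k = "\<lambda>z. (bf z e, p (z - scal G (bf z e) b), bf z b)"
      have k: "?k (scal G \<beta> b + x + scal G \<epsilon> e) = (\<beta>, x, \<epsilon>)" if x: "x \<in> W" for \<beta> x \<epsilon>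
      proof -
        have 1: "bf (scal G \<beta> b + x + scal G \<epsilon> e) e = \<beta>" "bf (scal G \<beta> b + x + scal G \<epsilon> e) b = \<epsilon>"
          using Wg[OF x] We[OF x] Wb[OF x] bg eg be bb e(3) by (simp_all add: g_simps)
        have "p (x + scal G \<epsilon> e) = x" by (simp add: p_simps pe p(3)[OF x])
        then show ?thesis unfolding 1 by (simp add: algebra_simps)
      qed
      show "\<forall>s\<in>carr ?E. ?k (?h s) = s"
      proof
        fix s assume "s \<in> carr ?E"
        then obtain \<beta> x \<epsilon> where s: "s = (\<beta>, x, \<epsilon>)" "x \<in> W" unfolding E by auto
        show "?k (?h s) = s" unfolding s(1) prod.case by (rule k[OF s(2)])
      qed
      show "\<forall>z\<in>g. ?h (?k z) = z"
      proof
        fix z assume z: "z \<in> g"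
        let ?z = "z - scal G (bf z e) b"
        have "?z = p ?z + scal G (bf ?z b) e"
          by (rule split) (use z bg eg be in \<open>simp_all add: g_simps\<close>)
        moreover have "bf ?z b = bf z b" using z bg bb by (simp add: g_simps)
        ultimately have "?z = p ?z + scal G (bf z b) e" by simp
        then have "scal G (bf z e) b + (p ?z + scal G (bf z b) e) = z" by (metis add_diff_cancel_left' diff_add_cancel add.commute)
        then show "?h (?k z) = z" by (simp add: add.assoc)
      qed
      show "?h ` carr ?E \<subseteq> g" unfolding E using Wg bg eg by auto
      show "?k ` g \<subseteq> carr ?E" unfolding E using p(2) by auto
    qed
    fix s assume "s \<in> carr ?E"
    then obtain \<beta> x \<epsilon> where s: "s = (\<beta>, x, \<epsilon>)" "x \<in> W" unfolding E by auto
    have xg: "x \<in> g" by (rule Wg[OF s(2)])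
    have "al (?h s) = scal G \<beta> (al b) + al x + scal G \<epsilon> (scal G lam e)"
      using s bg eg xg lam(1) by (simp add: g_simps)
    also have "\<dots> = scal G \<beta> (scal G lam b + x0 + scal G (bf (al b) b) e) + (p (al x) + scal G (bf x0 x) e)
        + scal G \<epsilon> (scal G lam e)"
      using alb alW[OF s(2)] by simp
    also have "\<dots> = ?h (twist ?E s)"
      unfolding E s by (simp add: scale_right_distrib scale_left_distrib algebra_simps)
    finally show "?h (twist ?E s) = al (?h s)" by simp
    fix s' assume "s' \<in> carr ?E"
    then obtain \<beta>' x' \<epsilon>' where s': "s' = (\<beta>', x', \<epsilon>')" "x' \<in> W" unfolding E by auto
    have xg': "x' \<in> g" by (rule Wg[OF s'(2)])
    show "form ?E s s' = bf (?h s) (?h s')"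
      unfolding E s s' using xg xg' bg eg We[OF s(2)] We[OF s'(2)] Wb[OF s(2)] Wb[OF s'(2)] be bb e(3)
      by (simp add: g_simps)
    have "br (?h s) (?h s') = scal G \<beta> (br b x') + scal G \<beta>' (br x b) + br x x'"
      unfolding s s' using xg xg' bg eg e0 brbb by (simp add: g_simps)
    also have "br x b = - br b x" by (rule brk_skew[OF xg bg])
    also have "br x x' = p (br x x') + scal G (bf (br b x) x') e" by (rule brWW[OF s(2) s'(2)])
    finally show "?h (brk ?E s s') = br (?h s) (?h s')"
      unfolding E s s' by (simp add: algebra_simps)
  qed
  then show ?thesis by (rule obtained.one_dim_ext[OF oV data iqh_G])
qed

section \<open>Double extensions by simple algebras\<close>

text \<open>On \<open>g\<close>, \<open>lb x (lb y z) = br (al x) (br y z)\<close>, so hom-Jacobi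
  for \<open>br\<close> is Jacobi for \<open>lb\<close>. Twist-stable subspaces are closed under one
  bracket exactly when they are closed under the other, so ideals and subalgebras agree and a Levi
  complement can be carried back.\<close>

lemma levi_hom:
  assumes R: "hom_ideal G R" and max: "\<And>J. hom_ideal G J \<Longrightarrow> R \<subseteq> J \<Longrightarrow> J = R \<or> J = g"
    and xy: "x1 \<in> g" "y1 \<in> g" "br x1 y1 \<notin> R"
  obtains S where "subspace S" "S \<subseteq> g" "\<And>x y. x \<in> S \<Longrightarrow> y \<in> S \<Longrightarrow> br x y \<in> S"
    "\<And>x. x \<in> S \<Longrightarrow> al x \<in> S" "S \<inter> R = {0}" "\<And>x. x \<in> g \<Longrightarrow> \<exists>r\<in>R. \<exists>a\<in>S. x = r + a"
proof -
  have "g \<inter> {0} = {0}" by auto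
  then obtain q where q: "lin q" "\<And>x. q x \<in> g" "\<And>x. x \<in> g \<Longrightarrow> q x = x" "\<And>x. x \<in> {0} \<Longrightarrow> q x = 0"
    by (rule direct_projection[OF subspace_carr subspace_single_0]) (rule that)
  note q_simps = lin_add[OF q(1)] lin_diff[OF q(1)] lin_scale[OF q(1)]
  define lb where "lb x y = al (br (q x) (q y))" for x y
  \<comment> \<open>The twist on \<open>g\<close> and the identity on the kernel of
    \<open>q\<close>, hence an involution of the whole type.\<close>
  define sg where "sg x = al (q x) + (x - q x)" for x
  have lbg: "lb x y \<in> g" for x y using q(2) by (simp add: lb_def g_simps)
  have qsg: "q (sg x) = al (q x)" for x
    using q(2) by (simp add: sg_def q_simps q(3) g_simps)
  have al2: "lb x (lb y z) = br (al (q x)) (br (q y) (q z))" for x y z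
  proof -
    have "lb x (lb y z) = al (br (q x) (al (br (q y) (q z))))"
      using lbg[of y z] by (simp add: lb_def q(3))
    also have "\<dots> = br (al (q x)) (br (q y) (q z))"
      using q(2) by (simp add: twist_brk twist_twist g_simps)
    finally show ?thesis .
  qed
  have skew: "lb x y = - lb y x" for x y
    using brk_skew[OF q(2)[of x] q(2)[of y]] q(2) by (simp add: lb_def g_simps)
  have "inv_lie_space (scal G) lb sg"
  proof (intro inv_lie_space.intro inv_lie_space_axioms.intro lie_space.intro lie_space_axioms.intro alg_closed_space_axioms)
    show "lin (lb x)" for x by (rule linI) (use q(2) in \<open>simp_all add: lb_def q_simps g_simps\<close>)
    show "lin (\<lambda>x. lb x y)" for y by (rule linI) (use q(2) in \<open>simp_all add: lb_def q_simps g_simps\<close>)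
    show "lb x y = - lb y x" for x y by (rule skew)
    show "lb x (lb y z) = lb (lb x y) z + lb y (lb x z)" for x y z
    proof -
      have "br (al (q x)) (br (q y) (q z)) + br (al (q y)) (br (q z) (q x)) + br (al (q z)) (br (q x) (q y)) = 0"
        using q(2) by (intro hom_jacobi)
      then have 1: "lb x (lb y z) + lb y (lb z x) + lb z (lb x y) = 0" unfolding al2 .
      have "lb y (lb z x) = br (al (q y)) (- br (q x) (q z))"
        unfolding al2 using brk_skew[OF q(2)[of z] q(2)[of x]] by simp
      also have "\<dots> = - lb y (lb x z)" unfolding al2 using q(2) by (simp add: g_simps)
      finally show ?thesis using 1 skew[of z "lb x y"] by (simp add: algebra_simps)
    qed
    show "lin sg" by (rule linI) (use q(2) in \<open>simp_all add: sg_def q_simps g_simps algebra_simps\<close>)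
    show "sg (sg x) = x" for x
      unfolding sg_def[of "sg x"] qsg by (simp add: sg_def twist_twist[OF q(2)])
    show "sg (lb x y) = lb (sg x) (sg y)" for x y
    proof -
      have "sg (lb x y) = al (lb x y)" using lbg[of x y] by (simp add: sg_def q(3))
      also have "\<dots> = lb (sg x) (sg y)"
        using q(2) by (simp add: lb_def qsg twist_brk twist_twist g_simps)
      finally show ?thesis .
    qed
  qed
  then interpret L: inv_lie_space "scal G" lb sg .
  have sgg: "sg x = al x" if "x \<in> g" for x using that by (simp add: sg_def q(3))
  have lbb: "lb x y = al (br x y)" if "x \<in> g" "y \<in> g" for x y using that by (simp add: lb_def q(3))
  have brl: "br x y = sg (lb x y)" if "x \<in> g" "y \<in> g" for x y
    using that sgg[OF lbg[of x y]] by (simp add: lbb twist_twist g_simps)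
  have sal: "L.salg g"
    unfolding L.salg_def L.subalg_def using fd_carr lbg sgg by (auto simp: g_simps)
  have id: "L.sideal g J \<longleftrightarrow> hom_ideal G J" for J
  proof
    assume J: "L.sideal g J"
    have "br x y \<in> J" if "x \<in> J" "y \<in> g" for x y
      using brl[of x y] L.sidealD(3,4)[OF J] L.sideal_left[OF J that] that by simp
    moreover have "al x \<in> J" if "x \<in> J" for x
      using sgg[of x] L.sidealD(3,4)[OF J that] by simp
    ultimately show "hom_ideal G J"
      unfolding hom_ideal_def using L.sidealD(2,3)[OF J] by blast
  next
    assume J: "hom_ideal G J"
    show "L.sideal g J"
    proof (rule L.sidealI[OF hom_idealD(1)[OF J]])
      show "J \<subseteq> g" using hom_idealD(2)[OF J] by blast
      fix x assume x: "x \<in> J"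
      then show "sg x \<in> J" using sgg hom_idealD(2,4)[OF J] by simp
      fix y assume y: "y \<in> g"
      show "lb y x \<in> J" using lbb[OF y hom_idealD(2)[OF J x]] hom_idealD(4)[OF J hom_idealD(5)[OF J x y]] by simp
    qed
  qed
  have "L.maximal g R" unfolding L.maximal_def id using R max by blast
  moreover have "lb x1 y1 \<notin> R"
  proof
    assume "lb x1 y1 \<in> R"
    then have "sg (lb x1 y1) \<in> R" using R unfolding id[symmetric] by (rule L.sidealD(4)[rotated])
    then show False using brl[OF xy(1,2)] xy(3) by simp
  qed
  ultimately obtain S where S: "L.complement g R S"
    using levi_complement[OF L.inv_lie_space_axioms sal _ xy(1,2)] by blast
  then have S': "L.salg S" "S \<subseteq> g" "S \<inter> R = {0}" "\<forall>x\<in>g. \<exists>t\<in>S. \<exists>n\<in>R. x = t + n"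
    by (simp_all add: L.complement_def)
  have Sg: "x \<in> g" if "x \<in> S" for x using that S'(2) by blast
  show ?thesis
  proof (rule that[of S])
    show "subspace S" by (rule L.salgD(3)[OF S'(1)])
    show "S \<subseteq> g" "S \<inter> R = {0}" by (rule S')+
    show "al x \<in> S" if "x \<in> S" for x using sgg[OF Sg[OF that]] L.salgD(4)[OF S'(1) that] by simp
    show "br x y \<in> S" if "x \<in> S" "y \<in> S" for x y
      using brl[OF Sg[OF that(1)] Sg[OF that(2)]] L.salgD(4)[OF S'(1) L.salgD(5)[OF S'(1) that]] by simp
    fix x assume "x \<in> g"
    then obtain t n where "t \<in> S" "n \<in> R" "x = t + n" using S'(4) by blast
    then have "n \<in> R \<and> t \<in> S \<and> x = n + t" by (simp add: add.commute)
    then show "\<exists>r\<in>R. \<exists>a\<in>S. x = r + a" by blast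
  qed
qed

lemma perp_carr: "perp g = {0}" "perp {0} = g"
proof -
  show "perp g = {0}"
  proof
    show "perp g \<subseteq> {0}"
    proof
      fix x assume x: "x \<in> perp g"
      have "x = 0" by (rule form_nondegenerate[OF perpD(1)[OF x] perpD(2)[OF x]])
      then show "x \<in> {0}" by simp
    qed
    show "{0} \<subseteq> perp g" by (simp add: perp_def)
  qed
  show "perp {0} = g" by (auto simp: perp_def)
qed

lemma perp_antimono: "U \<subseteq> V \<Longrightarrow> perp V \<subseteq> perp U"
  unfolding perp_def by blast

text \<open>\<open>perp\<close> reverses inclusions and is its own inverse on ideals, so minimality
  of \<open>I\<close> becomes maximality of \<open>perp I\<close>.\<close>

lemma perp_maximal:
  assumes I: "hom_ideal G I" and min: "\<And>J. hom_ideal G J \<Longrightarrow> J \<subseteq> I \<Longrightarrow> J = {0} \<or> J = I"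
    and J: "hom_ideal G J" "perp I \<subseteq> J"
  shows "J = perp I \<or> J = g"
proof -
  have Ig: "I \<subseteq> g" and Jg: "J \<subseteq> g" using hom_idealD(2)[OF I] hom_idealD(2)[OF J(1)] by blast+
  have pp: "perp (perp I) = I" "perp (perp J) = J"
    using perp_perp[OF hom_idealD(1)[OF I] Ig] perp_perp[OF hom_idealD(1)[OF J(1)] Jg] by simp_all
  have "perp J \<subseteq> I" using perp_antimono[OF J(2)] pp by simp
  then have "perp J = {0} \<or> perp J = I" using min[OF perp_ideal[OF J(1)]] by blast
  then show ?thesis using pp perp_carr by metis
qed

text \<open>The data of the extension: \<open>A\<close> is the Levi complement \<open>S\<close> of
  \<open>perp I\<close>, \<open>V\<close> is \<open>perp I / I\<close> realised on \<open>W\<close>,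
  \<open>\<phi>\<close> is the bracket action of \<open>S\<close> on \<open>W\<close>, and
  \<open>\<gamma>\<close> is the form on \<open>S\<close>. The form identifies \<open>I\<close> with
  the dual of \<open>S\<close>.\<close>

lemma obtained_simple_ext:
  assumes ih: induction_hyp and cen: "center G = {0}"
    and I: "hom_ideal G I" "I \<noteq> {0}" "I \<subseteq> perp I"
    and min: "\<And>J. hom_ideal G J \<Longrightarrow> J \<subseteq> I \<Longrightarrow> J = {0} \<or> J = I"
  shows "obtained G"
proof -
  let ?R = "perp I"
  have R: "hom_ideal G ?R" by (rule perp_ideal[OF I(1)])
  note Ig = hom_idealD(2)[OF I(1)] and sI = hom_idealD(1)[OF I(1)]
  note Rg = hom_idealD(2)[OF R] and sR = hom_idealD(1)[OF R]
  have max: "J = ?R \<or> J = g" if "hom_ideal G J" "?R \<subseteq> J" for J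
    using perp_maximal[OF I(1) min that] .
  obtain i0 where i0: "i0 \<in> I" "i0 \<noteq> 0" using I(2) subspace_0[OF sI] by blast
  \<comment> \<open>If all brackets were orthogonal to \<open>I\<close>, invariance of the form
    would make \<open>I\<close> central.\<close>
  have "\<exists>x\<in>g. \<exists>y\<in>g. br x y \<notin> ?R"
  proof (rule ccontr)
    assume "\<not> (\<exists>x\<in>g. \<exists>y\<in>g. br x y \<notin> ?R)"
    then have all: "br x y \<in> ?R" if "x \<in> g" "y \<in> g" for x y using that by blast
    have "br i0 y = 0" if y: "y \<in> g" for y
    proof (rule form_nondegenerate)
      show "br i0 y \<in> g" using Ig[OF i0(1)] y by (simp add: g_simps)
      fix x assume x: "x \<in> g"
      have "bf i0 (br y x) = 0"
        using perpD(2)[OF all[OF y x] i0(1)] form_sym[OF Ig[OF i0(1)] br_right(1)[OF y x]] by simp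
      then show "bf (br i0 y) x = 0" using form_invariant[OF Ig[OF i0(1)] y x] by simp
    qed
    then have "i0 \<in> center G" using Ig[OF i0(1)] by (simp add: center_def)
    then show False using cen i0(2) by simp
  qed
  then obtain x1 y1 where xy: "x1 \<in> g" "y1 \<in> g" "br x1 y1 \<notin> ?R" by blast
  obtain S where S: "subspace S" "S \<subseteq> g" "\<And>x y. x \<in> S \<Longrightarrow> y \<in> S \<Longrightarrow> br x y \<in> S"
    "\<And>x. x \<in> S \<Longrightarrow> al x \<in> S" "S \<inter> ?R = {0}" "\<And>x. x \<in> g \<Longrightarrow> \<exists>r\<in>?R. \<exists>a\<in>S. x = r + a"
    by (rule levi_hom[OF R max xy]) (assumption+, rule that)
  have Sg: "a \<in> g" if "a \<in> S" for a using that S(2) by blast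
  obtain W p where W: "subspace W" "W \<subseteq> ?R" "nondegenerate W bf" "I \<inter> W = {0}"
    and Wiff: "\<And>x. x \<in> W \<longleftrightarrow> x \<in> g \<and> (\<forall>i\<in>I. bf x i = 0) \<and> (\<forall>a\<in>S. bf x a = 0)"
    and p: "lin p" "\<And>x. p x \<in> W" "\<And>x. x \<in> W \<Longrightarrow> p x = x" "\<And>x. x \<in> I \<Longrightarrow> p x = 0" "\<And>x. x \<in> ?R \<Longrightarrow> x - p x \<in> I"
    and uniq': "\<forall>i\<in>I. (\<forall>a\<in>S. bf i a = 0) \<longrightarrow> i = 0"
    by (rule hyperbolic_complement[OF sI I(3) S(1,2,5,6)]) (assumption, rule that)
  have uniq: "i = 0" if "i \<in> I" "\<And>a. a \<in> S \<Longrightarrow> bf i a = 0" for i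
    using uniq' that by simp
  note p_simps = lin_add[OF p(1)] lin_diff[OF p(1)] lin_neg[OF p(1)] lin_scale[OF p(1)] lin_0[OF p(1)]
  have WR: "w \<in> ?R" if "w \<in> W" for w using that W(2) by blast
  have Wg: "w \<in> g" if "w \<in> W" for w using Rg[OF WR[OF that]] .
  have WI: "bf w i = 0" "bf i w = 0" if "w \<in> W" "i \<in> I" for w i
  proof -
    show "bf w i = 0" by (rule perpD(2)[OF WR[OF that(1)] that(2)])
    then show "bf i w = 0" using form_sym[OF Ig[OF that(2)] Wg[OF that(1)]] by simp
  qed
  have WS: "bf w a = 0" "bf a w = 0" if "w \<in> W" "a \<in> S" for w a
  proof -
    show "bf w a = 0" using Wiff[THEN iffD1, OF that(1)] that(2) by (elim conjE) (rule bspec)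
    then show "bf a w = 0" using form_sym[OF Sg[OF that(2)] Wg[OF that(1)]] by simp
  qed
  have WinI: "w \<in> W" if "w \<in> g" "\<And>i. i \<in> I \<Longrightarrow> bf w i = 0" "\<And>a. a \<in> S \<Longrightarrow> bf w a = 0" for w
    using that Wiff[of w] by simp
  have II: "bf i j = 0" if "i \<in> I" "j \<in> I" for i j using perpD(2) I(3) that by blast
  \<comment> \<open>By invariance, pairing \<open>br r i\<close> with any \<open>x\<close> gives the
    pairing of \<open>r\<close> with an element of the ideal \<open>I\<close>, which is
    zero.\<close>
  have RI: "br r i = 0" "br i r = 0" if r: "r \<in> ?R" and i: "i \<in> I" for r i
  proof -
    show 0: "br r i = 0"
    proof (rule form_nondegenerate)
      show "br r i \<in> g" using Rg[OF r] Ig[OF i] by (simp add: g_simps)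
      fix x assume x: "x \<in> g"
      show "bf (br r i) x = 0"
        using form_invariant[OF Rg[OF r] Ig[OF i] x] perpD(2)[OF r hom_idealD(3)[OF I(1) i x]] by simp
    qed
    show "br i r = 0" using brk_skew[OF Ig[OF i] Rg[OF r]] 0 by simp
  qed
  \<comment> \<open>\<open>W\<close> is the orthogonal of the twist-stable sum of \<open>I\<close>
    and the subalgebra \<open>S\<close>, so it is preserved by the action of \<open>S\<close> and by
    the twist.\<close>
  have brSW: "br a w \<in> W" if a: "a \<in> S" and w: "w \<in> W" for a w
  proof (rule WinI)
    show "br a w \<in> g" using Sg[OF a] Wg[OF w] by (simp add: g_simps)
    show "bf (br a w) i = 0" if i: "i \<in> I" for i
      using form_invariant[OF Sg[OF a] Wg[OF w] Ig[OF i]] RI(1)[OF WR[OF w] i] Sg[OF a] by simp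
    show "bf (br a w) c = 0" if c: "c \<in> S" for c
      using bf_br[OF Sg[OF a] Wg[OF w] Sg[OF c]] WS(1)[OF w S(3)[OF a c]] by simp
  qed
  have alW: "al w \<in> W" if w: "w \<in> W" for w
  proof (rule WinI)
    show "al w \<in> g" using Wg[OF w] by (simp add: g_simps)
    show "bf (al w) i = 0" if i: "i \<in> I" for i
      using form_twist[OF Wg[OF w] Ig[OF i]] WI(1)[OF w hom_idealD(4)[OF I(1) i]] by simp
    show "bf (al w) c = 0" if c: "c \<in> S" for c
      using form_twist[OF Wg[OF w] Sg[OF c]] WS(1)[OF w S(4)[OF c]] by simp
  qed
  have sub: "W \<subseteq> g" using Wg by blast
  have "W \<noteq> g" using W(4) I(2) Ig by blast
  note redV = red_perp_iqh[OF I(1) W(1-3) p I(3)]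
  have oV: "obtained (red W p)" by (rule obtained_red[OF ih redV W(1) sub \<open>W \<noteq> g\<close>])
  define A :: "('k, 'v) hom_alg" where "A = \<lparr>carr = S, scal = scal G, brk = br, twist = al\<rparr>"
  have A: "carr A = S" "scal A = scal G" "brk A = br" "twist A = al" by (simp_all add: A_def)
  have simple: "simple_alg A"
    unfolding simple_alg_def A
  proof (intro conjI allI impI)
    show "\<exists>x\<in>S. \<exists>y\<in>S. br x y \<noteq> 0"
    proof (rule ccontr)
      assume "\<not> (\<exists>x\<in>S. \<exists>y\<in>S. br x y \<noteq> 0)"
      then have S0: "br a c = 0" if "a \<in> S" "c \<in> S" for a c using that by blast
      obtain r a where ra: "r \<in> ?R" "a \<in> S" "x1 = r + a" using S(6)[OF xy(1)] by blast
      obtain s c where sc: "s \<in> ?R" "c \<in> S" "y1 = s + c" using S(6)[OF xy(2)] by blast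
      have "br x1 y1 = br r (s + c) + br a s"
        using ra sc Rg Sg S0 by (simp add: g_simps)
      moreover have "br r (s + c) \<in> ?R"
        by (rule hom_idealD(3)[OF R ra(1) carr_closed(2)[OF Rg[OF sc(1)] Sg[OF sc(2)]]])
      moreover have "br a s \<in> ?R" by (rule hom_idealD(5)[OF R sc(1) Sg[OF ra(2)]])
      ultimately show False using xy(3) subspace_add[OF sR] by simp
    qed
    fix J assume "hom_ideal A J"
    then have J: "subspace J" "J \<subseteq> S" "\<And>x y. x \<in> J \<Longrightarrow> y \<in> S \<Longrightarrow> br x y \<in> J" "\<And>x. x \<in> J \<Longrightarrow> al x \<in> J"
      unfolding hom_ideal_def A by auto
    have Jg: "x \<in> g" if "x \<in> J" for x using that J(2) Sg by blast
    let ?J = "{u + v |u v. u \<in> J \<and> v \<in> ?R}"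
    have "hom_ideal G ?J"
      unfolding hom_ideal_def
    proof (intro conjI ballI)
      show "subspace ?J" by (rule subspace_plus[OF J(1) sR])
      show "?J \<subseteq> g" using Jg Rg carr_closed(2) by blast
      fix x assume "x \<in> ?J"
      then obtain u v where uv: "u \<in> J" "v \<in> ?R" "x = u + v" by blast
      have "al x = al u + al v" using uv Jg Rg by (simp add: g_simps)
      then show "al x \<in> ?J" using J(4)[OF uv(1)] hom_idealD(4)[OF R uv(2)] by blast
      fix y assume y: "y \<in> g"
      then obtain r a where ra: "r \<in> ?R" "a \<in> S" "y = r + a" using S(6) by blast
      have "br x y = br u a + (br u r + br v y)" using uv ra Jg Rg Sg by (simp add: g_simps)
      moreover have "br u r + br v y \<in> ?R"
        using hom_idealD(5)[OF R ra(1) Jg[OF uv(1)]] hom_idealD(3)[OF R uv(2) y] by (rule subspace_add[OF sR])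
      ultimately show "br x y \<in> ?J" using J(3)[OF uv(1) ra(2)] by blast
    qed
    moreover have "?R \<subseteq> ?J"
    proof
      fix n assume "n \<in> ?R"
      then have "n = 0 + n \<and> 0 \<in> J \<and> n \<in> ?R" using subspace_0[OF J(1)] by simp
      then show "n \<in> ?J" by blast
    qed
    ultimately consider "?J = ?R" | "?J = g" using max by blast
    then show "J = {0} \<or> J = S"
    proof cases
      case 1
      have "J \<subseteq> {0}"
      proof
        fix j assume j: "j \<in> J"
        then have "j = j + 0 \<and> j \<in> J \<and> 0 \<in> ?R" using subspace_0[OF sR] by simp
        then have "j \<in> ?J" by blast
        then have "j \<in> ?R" unfolding 1 .
        then show "j \<in> {0}" using S(5) J(2) j by blast
      qed
      then show ?thesis using subspace_0[OF J(1)] by blast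
    next
      case 2
      have "S \<subseteq> J"
      proof
        fix t assume t: "t \<in> S"
        then have "t \<in> ?J" unfolding 2 by (rule Sg)
        then obtain j n where jn: "j \<in> J" "n \<in> ?R" "t = j + n" by blast
        have "t - j \<in> S" using t jn(1) J(2) by (intro subspace_diff[OF S(1)]) auto
        then have "n \<in> S \<inter> ?R" using jn by simp
        then have "n = 0" using S(5) by blast
        then show "t \<in> J" using jn by simp
      qed
      then show ?thesis using J(2) by blast
    qed
  qed
  have data: "double_extension_data (red W p) A br bf"
  proof (intro double_extension_data.intro double_extension_data_axioms.intro redV(1))
    show "involutive_hom_lie_algebra A"
    proof (intro involutive_hom_lie_algebra.intro hom_lie_algebra.intro
        involutive_hom_lie_algebra_axioms.intro hom_lie_algebra_axioms.intro, unfold A)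
      show "vector_space (scal G)" by (rule vector_space_axioms)
      show "subspace S" by (rule S(1))
      show "bilinear_on (scal G) (scal G) S S br"
        unfolding bilinear_on_def linear_on_def using Sg S(3) by (auto simp: g_simps)
      show "linear_on (scal G) (scal G) S S al"
        unfolding linear_on_def using Sg S(4) by (auto simp: g_simps)
      show "br x y = - br y x" if "x \<in> S" "y \<in> S" for x y using that Sg by (intro brk_skew)
      show "br (al x) (br y z) + br (al y) (br z x) + br (al z) (br x y) = 0" if "x \<in> S" "y \<in> S" "z \<in> S" for x y z
        using that Sg by (intro hom_jacobi)
      show "al (al x) = x" if "x \<in> S" for x using that Sg by (intro twist_twist)
      show "al (br x y) = br (al x) (al y)" if "x \<in> S" "y \<in> S" for x y using that Sg by (intro twist_brk)
    qed
    show "bilinear_on (scal A) (*) (carr A) UNIV bf"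
      unfolding bilinear_on_def linear_on_def A using Sg by (auto simp: g_simps)
    show "linear_on (scal (red W p)) (scal (red W p)) (carr (red W p)) (carr (red W p)) (br a)" if "a \<in> carr A" for a
      using that unfolding linear_on_def A using Sg Wg brSW by (auto simp: g_simps)
    show "linear_on (scal A) (scal (red W p)) (carr A) (carr (red W p)) (\<lambda>a. br a x)" if "x \<in> carr (red W p)" for x
      using that unfolding linear_on_def A using Sg Wg brSW by (auto simp: g_simps)
  next
    fix a c x assume "a \<in> carr A" "c \<in> carr A" "x \<in> carr (red W p)"
    then have ac: "a \<in> S" "c \<in> S" and x: "x \<in> W" by (simp_all add: A)
    note gs = Sg[OF ac(1)] Sg[OF ac(2)] Wg[OF x]
    have j: "br (al a) (br c x) + br (al c) (br x a) + br (al x) (br a c) = 0" by (rule hom_jacobi[OF gs])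
    have "br (al c) (br x a) = - br (al c) (br a x)" using brk_skew[OF gs(3,1)] gs by (simp add: g_simps)
    moreover have "br (al x) (br a c) = - br (br a c) (al x)" using gs by (intro brk_skew) (simp_all add: g_simps)
    ultimately have "br (br a c) (al x) = br (al a) (br c x) - br (al c) (br a x)" using j by (simp add: algebra_simps)
    then show "br (brk A a c) (twist (red W p) x) = br (twist A a) (br c x) - br (twist A c) (br a x)"
      by (simp add: A p(3)[OF alW[OF x]])
  next
    fix a x y assume "a \<in> carr A" "x \<in> carr (red W p)" "y \<in> carr (red W p)"
    then have a: "a \<in> S" and x: "x \<in> W" and y: "y \<in> W" by (simp_all add: A)
    note gs = Sg[OF a] Wg[OF x] Wg[OF y]
    have xyR: "br x y \<in> ?R" by (rule hom_idealD(3)[OF R WR[OF x] gs(3)])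
    have pg: "p (br x y) \<in> g" by (rule Wg[OF p(2)])
    \<comment> \<open>The bracket of \<open>red W p\<close> differs from that of \<open>g\<close> by
      an element of the ideal \<open>I\<close>, which remains in \<open>I\<close> under
      \<open>br a\<close> and the twist and is then killed by \<open>p\<close>.\<close>
    have "br a (br x y) - br a (p (br x y)) = br a (br x y - p (br x y))"
      using gs pg by (simp add: g_simps)
    then have "al (br a (br x y)) - al (br a (p (br x y))) \<in> I"
      using hom_idealD(4)[OF I(1) hom_idealD(5)[OF I(1) p(5)[OF xyR] gs(1)]] gs pg by (simp add: g_simps)
    then have 1: "p (al (br a (p (br x y)))) = p (al (br a (br x y)))"
      using p(4) by (fastforce simp: p_simps)
    \<comment> \<open>The derivation rule is the hom-Jacobi identity for \<open>a\<close>,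
      \<open>al x\<close> and \<open>al y\<close>, with double twists removed.\<close>
    have j: "br (al a) (br (al x) (al y)) + br (al (al x)) (br (al y) a) + br (al (al y)) (br a (al x)) = 0"
      using gs by (intro hom_jacobi) (simp_all add: g_simps)
    have "br x (br (al y) a) = - br x (br a (al y))"
      using brk_skew[of "al y" a] gs by (simp add: g_simps)
    moreover have "br y (br a (al x)) = - br (br a (al x)) y" using gs by (intro brk_skew) (simp_all add: g_simps)
    moreover have "al (br a (br x y)) = br (al a) (br (al x) (al y))" using gs by (simp add: twist_brk g_simps)
    ultimately have "al (br a (br x y)) = br (br a (al x)) y + br x (br a (al y))"
      using j twist_twist gs by (simp add: algebra_simps)
    then have "p (al (br a (p (br x y)))) = p (br (br a (al x)) y) + p (br x (br a (al y)))"
      unfolding 1 by (simp add: p_simps)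
    then show "twist (red W p) (br a (brk (red W p) x y))
        = brk (red W p) (br a (twist (red W p) x)) y + brk (red W p) x (br a (twist (red W p) y))"
      by (simp add: p(3)[OF alW[OF x]] p(3)[OF alW[OF y]])
    show "form (red W p) (br a x) y = - form (red W p) x (br a y)" using bf_br[OF gs] by simp
  next
    fix a x assume "a \<in> carr A" "x \<in> carr (red W p)"
    then have a: "a \<in> S" and x: "x \<in> W" by (simp_all add: A)
    have "al (br a (al x)) = br (al a) x"
      using twist_brk[OF Sg[OF a] al_simps(1)[OF Wg[OF x]]] twist_twist[OF Wg[OF x]] by simp
    moreover have "br (al a) x \<in> W" by (rule brSW[OF S(4)[OF a] x])
    ultimately show "br (twist A a) x = twist (red W p) (br a (twist (red W p) x))"
      by (simp add: A p(3)[OF alW[OF x]] p(3))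
  qed (use Sg in \<open>auto simp: A intro: form_sym form_invariant form_twist\<close>)
  obtain qS where qS: "lin qS" "\<And>x. qS x \<in> S" "\<And>x. x \<in> S \<Longrightarrow> qS x = x" "\<And>x. x \<in> ?R \<Longrightarrow> qS x = 0"
    by (rule direct_projection[OF S(1) sR S(5)]) (rule that)
  have qR: "z - qS z \<in> ?R" if z: "z \<in> g" for z
  proof -
    obtain r a where ra: "r \<in> ?R" "a \<in> S" "z = r + a" using S(6)[OF z] by blast
    then have "qS z = a" by (simp add: lin_add[OF qS(1)] qS(3,4))
    then show ?thesis using ra by simp
  qed
  let ?D = "dual_space A"
  have Ddef: "f \<in> ?D \<longleftrightarrow> linear_functional S f \<and> (\<forall>a. a \<notin> S \<longrightarrow> f a = 0)" for f
    unfolding dual_space_def linear_on_def linear_functional_def A by auto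
  \<comment> \<open>Inverse of the isomorphism from \<open>I\<close> to the dual of \<open>S\<close>
    given by the form; uniqueness of the choice is \<open>rep_eq\<close>.\<close>
  define rep where "rep f = (SOME i. i \<in> I \<and> (\<forall>a\<in>S. bf i a = f a))" for f
  have rep_ex: "\<exists>i. i \<in> I \<and> (\<forall>a\<in>S. bf i a = f a)" if f: "f \<in> ?D" for f
  proof -
    have fa: "f (a + c) = f a + f c" "f (scal G k a) = k * f a" if "a \<in> S" "c \<in> S" for a c k
      using f that unfolding Ddef linear_functional_def by blast+
    \<comment> \<open>Extend \<open>f\<close> by 0 on \<open>perp I\<close>. The vector representing
      the extension is orthogonal to \<open>perp I\<close>, hence lies in \<open>I\<close> by
      \<open>perp_perp\<close>.\<close>
    have "linear_functional g (\<lambda>x. f (qS x))"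
      unfolding linear_functional_def
      by (simp add: lin_add[OF qS(1)] lin_scale[OF qS(1)] fa(1)[OF qS(2) qS(2)] fa(2)[OF qS(2) qS(2)])
    then obtain i where i: "i \<in> g" "\<And>x. x \<in> g \<Longrightarrow> bf i x = f (qS x)" by (rule riesz_g) (rule that)
    have "f 0 = 0" using fa(2)[of 0 0 0] subspace_0[OF S(1)] by simp
    then have "bf i u = 0" if "u \<in> ?R" for u using i(2)[OF Rg[OF that]] qS(4)[OF that] by simp
    then have "i \<in> perp ?R" unfolding perp_def[of ?R] using i(1) by blast
    then have "i \<in> I" using perp_perp[OF sI] Ig by blast
    moreover have "\<forall>a\<in>S. bf i a = f a" using i(2) Sg qS(3) by simp
    ultimately show ?thesis by blast
  qed
  have repI: "rep f \<in> I" and repS: "a \<in> S \<Longrightarrow> bf (rep f) a = f a" if f: "f \<in> ?D" for f a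
    using someI_ex[OF rep_ex[OF f]] unfolding rep_def by blast+
  have repg: "rep f \<in> g" if "f \<in> ?D" for f using Ig[OF repI[OF that]] .
  have rep_eq: "rep f = i" if "f \<in> ?D" "i \<in> I" "\<And>a. a \<in> S \<Longrightarrow> bf i a = f a" for f i
  proof -
    have "rep f - i = 0"
    proof (rule uniq)
      show "rep f - i \<in> I" using repI[OF that(1)] that(2) by (rule subspace_diff[OF sI])
      show "bf (rep f - i) a = 0" if a: "a \<in> S" for a
        using bf_diff(2)[OF repg[OF \<open>f \<in> ?D\<close>] Ig[OF \<open>i \<in> I\<close>] Sg[OF a]] repS[OF \<open>f \<in> ?D\<close> a] \<open>\<And>a. a \<in> S \<Longrightarrow> bf i a = f a\<close>[OF a] by simp
    qed
    then show ?thesis by simp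
  qed
  have DI: "restrict0 S (bf i) \<in> ?D" if "i \<in> g" for i
    unfolding Ddef linear_functional_def restrict0_def
    using that Sg subspace_add[OF S(1)] subspace_scale[OF S(1)] by (simp add: g_simps)
  have D_eq: "f = restrict0 S (bf (rep f))" if "f \<in> ?D" for f
    using that repS[OF that] unfolding restrict0_def by (auto simp: Ddef)
  let ?E = "double_extension (red W p) A br bf"
  let ?h = "\<lambda>(f, v, a). rep f + v + a"
  have E: "carr ?E = ?D \<times> W \<times> S" "scal ?E = (\<lambda>c (f, v, a). ((\<lambda>b. c * f b), scal G c v, scal G c a))"
    "brk ?E = (\<lambda>(f, v, a) (f', v', a').
        (coadjoint A a f' - coadjoint A a' f + restrict0 S (\<lambda>a. bf (br a v) v'),
         p (br v v') + br a v' - br a' v, br a a'))"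
    "twist ?E = (\<lambda>(f, v, a). (restrict0 S (f \<circ> al), p (al v), al a))"
    "form ?E = (\<lambda>(f, v, a) (f', v', a'). bf v v' + f a' + f' a + bf a a')"
    unfolding double_extension_def by (simp_all add: A Let_def)
  have "?E \<simeq> G"
    unfolding iqh_isomorphic_def
  proof (intro exI[of _ ?h] conjI ballI)
    have rep_add: "rep (f + f') = rep f + rep f'" if "f \<in> ?D" "f' \<in> ?D" for f f'
    proof (rule rep_eq)
      show "f + f' \<in> ?D" using that unfolding Ddef linear_functional_def by (simp add: algebra_simps)
      show "rep f + rep f' \<in> I" using repI that by (intro subspace_add[OF sI])
      show "bf (rep f + rep f') a = (f + f') a" if "a \<in> S" for a
        using that \<open>f \<in> ?D\<close> \<open>f' \<in> ?D\<close> repg repS Sg by (simp add: g_simps)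
    qed
    have rep_scale: "rep (\<lambda>b. c * f b) = scal G c (rep f)" if "f \<in> ?D" for c f
    proof (rule rep_eq)
      show "(\<lambda>b. c * f b) \<in> ?D" using that unfolding Ddef linear_functional_def by (simp add: algebra_simps)
      show "scal G c (rep f) \<in> I" using repI that by (intro subspace_scale[OF sI])
      show "bf (scal G c (rep f)) a = c * f a" if "a \<in> S" for a
        using that \<open>f \<in> ?D\<close> repg repS Sg by (simp add: g_simps)
    qed
    show "linear_on (scal ?E) (scal G) (carr ?E) g ?h"
      unfolding linear_on_def E using repg Wg Sg rep_add rep_scale
      by (auto simp: scale_right_distrib algebra_simps)
    show "bij_betw ?h (carr ?E) g"
    proof (rule bij_betw_byWitness)
      \<comment> \<open>Subtracting the component in \<open>S\<close> leaves an element of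
        \<open>perp I\<close>; subtracting then its component in \<open>W\<close> leaves one of
        \<open>I\<close>, which is read as a functional on \<open>S\<close>.\<close>
      let ?k = "\<lambda>z. (restrict0 S (bf (z - qS z - p (z - qS z))), p (z - qS z), qS z)"
      show "\<forall>s\<in>carr ?E. ?k (?h s) = s"
      proof
        fix s assume "s \<in> carr ?E"
        then obtain f v a where s: "s = (f, v, a)" "f \<in> ?D" "v \<in> W" "a \<in> S" unfolding E by auto
        have fR: "rep f \<in> ?R" using repI[OF s(2)] I(3) by blast
        have 1: "qS (rep f + v + a) = a"
          using fR WR[OF s(3)] s(4) by (simp add: lin_add[OF qS(1)] qS(3,4))
        have 2: "rep f + v + a - a = rep f + v" by simp
        have 3: "p (rep f + v) = v" by (simp add: p_simps p(3)[OF s(3)] p(4)[OF repI[OF s(2)]])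
        have 4: "rep f + v - v = rep f" by simp
        show "?k (?h s) = s" unfolding s(1) prod.case 1 2 3 4 D_eq[OF s(2), symmetric] ..
      qed
      show "\<forall>z\<in>g. ?h (?k z) = z"
      proof
        fix z assume z: "z \<in> g"
        have i: "z - qS z - p (z - qS z) \<in> I" by (rule p(5)[OF qR[OF z]])
        have "rep (restrict0 S (bf (z - qS z - p (z - qS z)))) = z - qS z - p (z - qS z)"
          by (rule rep_eq[OF DI[OF Ig[OF i]] i]) (simp add: restrict0_def)
        then show "?h (?k z) = z" by simp
      qed
      show "?h ` carr ?E \<subseteq> g" unfolding E using repg Wg Sg by auto
      show "?k ` g \<subseteq> carr ?E"
      proof
        fix s assume "s \<in> ?k ` g"
        then obtain z where z: "z \<in> g" "s = ?k z" by blast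
        show "s \<in> carr ?E" unfolding z(2) E using DI[OF Ig[OF p(5)[OF qR[OF z(1)]]]] p(2) qS(2) by simp
      qed
    qed
    fix s assume "s \<in> carr ?E"
    then obtain f v a where s: "s = (f, v, a)" "f \<in> ?D" "v \<in> W" "a \<in> S" unfolding E by auto
    have fg: "rep f \<in> g" and fI: "rep f \<in> I" and vg: "v \<in> g" and ag: "a \<in> g"
      using repg repI Wg Sg s by auto
    have "rep (restrict0 S (f \<circ> al)) = al (rep f)"
    proof (rule rep_eq)
      show "al (rep f) \<in> I" by (rule hom_idealD(4)[OF I(1) fI])
      show b: "bf (al (rep f)) c = restrict0 S (f \<circ> al) c" if "c \<in> S" for c
        using form_twist[OF fg Sg[OF that]] repS[OF s(2) S(4)[OF that]] that by (simp add: restrict0_def)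
      have "restrict0 S (f \<circ> al) = restrict0 S (bf (al (rep f)))"
        using b by (auto simp: restrict0_def)
      then show "restrict0 S (f \<circ> al) \<in> ?D" using DI[OF al_simps(1)[OF fg]] by simp
    qed
    then show "?h (twist ?E s) = al (?h s)"
      unfolding E s(1) using fg vg ag by (simp add: g_simps p(3)[OF alW[OF s(3)]])
    fix s' assume "s' \<in> carr ?E"
    then obtain f' v' a' where s': "s' = (f', v', a')" "f' \<in> ?D" "v' \<in> W" "a' \<in> S" unfolding E by auto
    have fg': "rep f' \<in> g" and fI': "rep f' \<in> I" and vg': "v' \<in> g" and ag': "a' \<in> g"
      using repg repI Wg Sg s' by auto
    have "bf a (rep f') = f' a" using form_sym[OF ag fg'] repS[OF s'(2) s(4)] by simp
    then show "form ?E s s' = bf (?h s) (?h s')"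
      unfolding E s(1) s'(1)
      using fg vg ag fg' vg' ag' II[OF fI fI'] WI[OF s(3) fI'] WI[OF s'(3) fI] WS[OF s(3) s'(4)] WS[OF s'(3) s(4)]
        repS[OF s(2) s'(4)] by (simp add: g_simps)
    have vvR: "br v v' \<in> ?R" by (rule hom_idealD(3)[OF R WR[OF s(3)] vg'])
    \<comment> \<open>The component of the full bracket in \<open>I\<close>: the coadjoint terms
      together with the part of \<open>br v v'\<close> that \<open>p\<close> discards. That part
      corresponds to the functional \<open>\<psi> v v'\<close>.\<close>
    let ?i = "br a (rep f') - br a' (rep f) + (br v v' - p (br v v'))"
    have pg: "p (br v v') \<in> g" by (rule Wg[OF p(2)])
    have "rep (coadjoint A a f' - coadjoint A a' f + restrict0 S (\<lambda>a. bf (br a v) v')) = ?i"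
    proof (rule rep_eq)
      show iI: "?i \<in> I"
        by (rule subspace_add[OF sI subspace_diff[OF sI hom_idealD(5)[OF I(1) fI' ag]
                hom_idealD(5)[OF I(1) fI ag']] p(5)[OF vvR]])
      show b: "bf ?i c = (coadjoint A a f' - coadjoint A a' f + restrict0 S (\<lambda>a. bf (br a v) v')) c"
        if c: "c \<in> S" for c
      proof -
        note cg = Sg[OF c]
        have "bf (br a (rep f')) c = - f' (br a c)"
          using bf_br[OF ag fg' cg] repS[OF s'(2) S(3)[OF s(4) c]] by simp
        moreover have "bf (br a' (rep f)) c = - f (br a' c)"
          using bf_br[OF ag' fg cg] repS[OF s(2) S(3)[OF s'(4) c]] by simp
        moreover have "bf (p (br v v')) c = 0" by (rule WS(1)[OF p(2) c])
        moreover have "bf (br v v') c = bf (br c v) v'"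
          using form_invariant[OF cg vg vg'] form_sym[OF br_right(1)[OF vg vg'] cg] by simp
        ultimately show ?thesis
          using c cg ag fg' ag' fg vg vg' pg
          by (simp add: g_simps coadjoint_def restrict0_def A)
      qed
      have "coadjoint A a f' - coadjoint A a' f + restrict0 S (\<lambda>a. bf (br a v) v') = restrict0 S (bf ?i)"
      proof
        fix c
        show "(coadjoint A a f' - coadjoint A a' f + restrict0 S (\<lambda>a. bf (br a v) v')) c = restrict0 S (bf ?i) c"
        proof (cases "c \<in> S")
          case True
          then show ?thesis unfolding b[OF True, symmetric] by (simp add: restrict0_def)
        next
          case False
          then show ?thesis by (simp add: coadjoint_def restrict0_def A)
        qed
      qed
      then show "coadjoint A a f' - coadjoint A a' f + restrict0 S (\<lambda>a. bf (br a v) v') \<in> ?D"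
        using DI[OF Ig[OF iI]] by simp
    qed
    then have "?h (brk ?E s s') = ?i + (p (br v v') + br a v' - br a' v) + br a a'"
      unfolding E s(1) s'(1) by simp
    also have "\<dots> = br (rep f + v + a) (rep f' + v' + a')"
    proof -
      have z: "br (rep f) (rep f') = 0" "br (rep f) v' = 0" "br v (rep f') = 0"
        using RI I(3) fI fI' WR[OF s(3)] WR[OF s'(3)] by blast+
      have sk: "br (rep f) a' = - br a' (rep f)" "br v a' = - br a' v"
        using brk_skew[OF fg ag'] brk_skew[OF vg ag'] by simp_all
      show ?thesis using fg vg ag fg' vg' ag' by (simp add: g_simps z sk algebra_simps)
    qed
    finally show "?h (brk ?E s s') = br (?h s) (?h s')" unfolding s(1) s'(1) by simp
  qed
  then show ?thesis by (rule obtained.simple_ext[OF oV simple data iqh_G])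
qed

section \<open>The induction on the dimension\<close>

lemma central_eigenvector:
  assumes "center G \<noteq> {0}"
  obtains e lam where "e \<in> center G" "e \<noteq> 0" "lam \<in> {-1, 1}" "al e = scal G lam e"
proof -
  have zc: "0 \<in> center G" by (simp add: center_def)
  then obtain z where z: "z \<in> center G" "z \<noteq> 0" using assms by blast
  have zg: "z \<in> g" and z0: "\<And>y. y \<in> g \<Longrightarrow> br z y = 0" using z(1) by (simp_all add: center_def)
  have a0: "br (al z) y = 0" if y: "y \<in> g" for y
    using twist_brk[OF zg al_simps(1)[OF y]] twist_twist[OF y] z0[OF al_simps(1)[OF y]] by simp
  \<comment> \<open>The twist preserves the centre, and these two vectors are eigenvectors for 1 and
    -1. They cannot both vanish, since their sum is \<open>2 z\<close>.\<close>
  have c: "z + al z \<in> center G" "z - al z \<in> center G"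
    using zg z0 a0 by (simp_all add: center_def g_simps)
  show ?thesis
  proof (cases "z + al z = 0")
    case False
    have "al (z + al z) = scal G 1 (z + al z)" using zg by (simp add: g_simps twist_twist add.commute)
    then show ?thesis using that[OF c(1) False] by blast
  next
    case True
    have "z - al z \<noteq> 0"
    proof
      assume "z - al z = 0"
      then have "z + z = 0" using True by simp
      then have "scal G 2 z = 0" using scale_left_distrib[of 1 1 z] by simp
      then show False using z(2) by simp
    qed
    moreover have "al (z - al z) = scal G (-1) (z - al z)" using zg by (simp add: g_simps twist_twist)
    ultimately show ?thesis using that[OF c(2)] by blast
  qed
qed

lemma minimal_ideal_exists:
  assumes "g \<noteq> {0}"
  obtains I where "hom_ideal G I" "I \<noteq> {0}" "\<forall>J. hom_ideal G J \<longrightarrow> J \<subseteq> I \<longrightarrow> J = {0} \<or> J = I"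
proof -
  let ?P = "\<lambda>I. hom_ideal G I \<and> I \<noteq> {0}"
  have "hom_ideal G g" unfolding hom_ideal_def using subspace_carr by (auto simp: g_simps)
  then obtain I where I: "?P I" "\<And>J. ?P J \<Longrightarrow> dim I \<le> dim J"
    using ex_has_least_nat[of ?P g dim] assms by blast
  have "J = {0} \<or> J = I" if J: "hom_ideal G J" "J \<subseteq> I" for J
  proof (rule ccontr)
    assume ne: "\<not> (J = {0} \<or> J = I)"
    then have "dim J < dim I" using I(1) fd_dim_less[OF hom_idealD(6) hom_idealD(1)[OF J(1)] J(2)] by blast
    moreover have "dim I \<le> dim J" using ne J(1) by (intro I(2)) simp
    ultimately show False by simp
  qed
  then show ?thesis using that I(1) by blast
qed

lemma obtained_step:
  assumes ih: induction_hyp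
  shows "obtained G"
proof (cases "g = {0}")
  case True
  then show ?thesis by (intro obtained.base) (simp add: in_U_def iqh_G)
next
  case g0: False
  show ?thesis
  proof (cases "center G = {0}")
    case False
    then obtain e lam where e: "e \<in> center G" "e \<noteq> 0" "lam \<in> {-1, 1}" "al e = scal G lam e"
      by (rule central_eigenvector)
    have eg: "e \<in> g" using e(1) by (simp add: center_def)
    show ?thesis
    proof (cases "bf e e = 0")
      case True
      then show ?thesis using obtained_one_dim[OF ih e(1,2) _ e(4,3)] by blast
    next
      case False
      let ?I = "span {e}"
      have eI: "e \<in> ?I" by (simp add: span_base)
      have I: "hom_ideal G ?I" by (rule central_line_ideal[OF e(1,4)])
      have nd: "nondegenerate ?I bf"
      proof (rule nondegenerateI)
        fix u assume u: "u \<in> ?I" and 0: "\<And>v. v \<in> ?I \<Longrightarrow> bf u v = 0"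
        obtain c where c: "u = scal G c e" using u by (auto simp: span_singleton)
        have "c * bf e e = 0" using 0[OF eI] c eg by (simp add: g_simps)
        then show "u = 0" using False c by simp
      qed
      show ?thesis
      proof (cases "?I = g")
        case True
        have "dim g = 1"
          unfolding True[symmetric] using e(2) dim_span_eq_card_independent[of "{e}"] by simp
        then show ?thesis by (intro obtained.base) (simp add: in_U_def iqh_G)
      next
        case False
        moreover have "?I \<noteq> {0}" using eI e(2) by blast
        ultimately show ?thesis using obtained_orth_sum[OF ih I _ _ nd] by blast
      qed
    qed
  next
    case cen: True
    obtain I where I: "hom_ideal G I" "I \<noteq> {0}" "\<forall>J. hom_ideal G J \<longrightarrow> J \<subseteq> I \<longrightarrow> J = {0} \<or> J = I"
      using minimal_ideal_exists[OF g0] .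
    have min: "J = {0} \<or> J = I" if "hom_ideal G J" "J \<subseteq> I" for J using I(3) that by simp
    have sI: "subspace I" by (rule hom_idealD(1)[OF I(1)])
    have P: "hom_ideal G (perp I)" by (rule perp_ideal[OF I(1)])
    have "hom_ideal G (I \<inter> perp I)"
      using I(1) P subspace_inter[of I "perp I"] unfolding hom_ideal_def by blast
    then consider "I \<inter> perp I = {0}" | "I \<inter> perp I = I" using min by blast
    then show ?thesis
    proof cases
      case 2
      then have "I \<subseteq> perp I" by blast
      then show ?thesis using obtained_simple_ext[OF ih cen I(1,2) _ min] by blast
    next
      case 1
      have nd: "nondegenerate I bf"
      proof (rule nondegenerateI)
        fix u assume "u \<in> I" "\<And>v. v \<in> I \<Longrightarrow> bf u v = 0"
        then have "u \<in> I \<inter> perp I" using hom_idealD(2)[OF I(1)] by (simp add: perp_def)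
        then show "u = 0" using 1 by blast
      qed
      show ?thesis
      proof (cases "I = g")
        case False
        then show ?thesis using obtained_orth_sum[OF ih I(1,2) _ nd] by blast
      next
        case True
        \<comment> \<open>Here \<open>g\<close> has no proper nonzero ideal, and a zero bracket
          would make it its own centre; hence it is simple.\<close>
        have "\<exists>x\<in>g. \<exists>y\<in>g. br x y \<noteq> 0"
        proof (rule ccontr)
          assume "\<not> (\<exists>x\<in>g. \<exists>y\<in>g. br x y \<noteq> 0)"
          then have "center G = g" by (auto simp: center_def)
          then show False using cen g0 by simp
        qed
        moreover have "J = {0} \<or> J = g" if J: "hom_ideal G J" for J
          using min[OF J] hom_idealD(2)[OF J] unfolding True by blast
        ultimately have "simple_alg G" by (simp add: simple_alg_def)
        then show ?thesis by (intro obtained.base) (simp add: in_U_def iqh_G)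
      qed
    qed
  qed
qed

end

theorem all_obtained:
  fixes G :: "('k::{alg_closed_field, field_char_0}, 'v::ab_group_add) quad_hom_alg"
  assumes "iqh_lie_algebra G" "finite_dim G"
  shows "obtained G"
  using assms
proof (induction "vector_space.dim (scal G) (carr G)" arbitrary: G rule: less_induct)
  case less
  interpret fd_iqh G using less(2,3) by (intro fd_iqh.intro fd_iqh_axioms.intro)
  have "induction_hyp"
    unfolding induction_hyp_def
  proof (intro allI impI)
    fix V :: "('k, 'v) quad_hom_alg"
    assume V: "iqh_lie_algebra V" "finite_dim V" "scal V = scal G" "dim (carr V) < dim g"
    show "obtained V" by (rule less(1)) (use V in simp_all)
  qed
  then show ?case by (rule obtained_step)
qed

theorem theorem7p9:
  fixes G :: "('k::{alg_closed_field, field_char_0}, 'v::ab_group_add) quad_hom_alg"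
  assumes "iqh_lie_algebra G"
    and "finite_dim G"
    and "center G = {0}"
  shows "in_U G \<or> obtained G"
  using all_obtained[OF assms(1,2)] by simp

end
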